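(* Let $N\ge 1$ be an integer, and let $f$ and $g$ be normalised eigenforms for $\Gamma_0(N)$, both with character $\chi$, of respective positive integer weights $k_1 \le k_2$. Let $R$ be the ring of integers of a number field, and assume that $R$ contains the Fourier coefficients of $f$ and $g$. Let $\mathfrak p$ be a nonzero prime ideal in $R$, and define the prime number $p$ by $p\mathbb Z = \mathfrak p \cap \mathbb Z$. Assume that $p \ge 5$ and that $f \not\equiv g \mod \mathfrak p$. Then there exists $$n \le \max\left\{ g^*(p,N)^2,\ \frac{k_2}{12}[SL_2(\mathbb Z):\Gamma_0(N)] \right\}$$ such that $a_n(f) \not\equiv a_n(g) \mod \mathfrak p$, where $g^*(p,N)$ is the least prime primitive root modulo $p$ that does not divide $N$.
   Context: A modular form of weight $k$ and character $\chi$ for $\Gamma_0(N)$ satisfies $f\left(\frac{az+b}{cz+d}\right)=\chi(d)(cz+d)^k f(z)$ for all $\begin{pmatrix}a&b\\c&d\end{pmatrix}\in\Gamma_0(N)$ (with the usual holomorphy conditions, including at the cusps); here $\chi$ is a Dirichlet character modulo $N$. An eigenform is an eigenvector for the full Hecke algebra, and it is normalised if its first Fourier coefficient is $a_1=1$. For a modular form $f$, $a_n(f)$ denotes the $n$th Fourier coefficient: $f(z)=\sum_{n\ge 0} a_n(f)e^{2\pi i nz}$; the $n$ in the claim is a nonnegative integer. $f\equiv g \mod \mathfrak p$ means $a_n(f)\equiv a_n(g)\mod\mathfrak p$ for all $n$. A prime primitive root modulo $p$ is a prime number that is also a primitive root modulo $p$. *)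

theory Defs
  imports
    "HOL-Complex_Analysis.Complex_Analysis"
    "HOL-Number_Theory.Residue_Primitive_Roots"
    "HOL-Algebra.Coset"
    "HOL-Algebra.Ideal"
    "HOL-Algebra.Embedded_Algebras"
    "HOL-Algebra.Algebraic_Closure_Type"
begin

section \<open>The groups \<open>SL\<^sub>2(\<int>)\<close> and \<open>\<Gamma>\<^sub>0(N)\<close>\<close>

definition SL2Z :: "(int^2^2) monoid" where
  "SL2Z = \<lparr>carrier = {A. det A = 1}, mult = (**), one = mat 1\<rparr>"

definition Gamma0 :: "nat \<Rightarrow> (int^2^2) set" where
  "Gamma0 N = {A \<in> carrier SL2Z. int N dvd A $ 2 $ 1}"

lemma group_SL2Z: "group SL2Z"
proof (rule groupI)
  fix A assume "A \<in> carrier SL2Z"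
  then have d: "A$1$1 * A$2$2 - A$1$2 * A$2$1 = 1"
    by (simp add: SL2Z_def det_2)
  define B :: "int^2^2" where
    "B = vector [vector [A$2$2, - (A$1$2)], vector [- (A$2$1), A$1$1]]"
  have "B ** A = mat 1"
    using d by (simp add: B_def vec_eq_iff forall_2 matrix_matrix_mult_def sum_2 mat_def vector_2
        algebra_simps)
  moreover have "det B = 1"
    using d by (simp add: B_def det_2 vector_2 algebra_simps)
  ultimately show "\<exists>B\<in>carrier SL2Z. B \<otimes>\<^bsub>SL2Z\<^esub> A = \<one>\<^bsub>SL2Z\<^esub>"
    by (auto simp: SL2Z_def)
qed (simp_all add: SL2Z_def det_mul matrix_mul_assoc)

lemma subgroup_Gamma0: "subgroup (Gamma0 N) SL2Z"
proof (rule group.subgroupI[OF group_SL2Z])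
  show "Gamma0 N \<subseteq> carrier SL2Z"
    by (auto simp: Gamma0_def)
  have "mat 1 \<in> Gamma0 N"
    using det_I by (simp add: Gamma0_def SL2Z_def) (simp add: mat_def)
  then show "Gamma0 N \<noteq> {}"
    by blast
next
  fix A assume A: "A \<in> Gamma0 N"
  then have d: "A$1$1 * A$2$2 - A$1$2 * A$2$1 = 1"
    by (simp add: Gamma0_def SL2Z_def det_2)
  define B :: "int^2^2" where
    "B = vector [vector [A$2$2, - (A$1$2)], vector [- (A$2$1), A$1$1]]"
  have "B ** A = mat 1"
    using d by (simp add: B_def vec_eq_iff forall_2 matrix_matrix_mult_def sum_2 mat_def vector_2
        algebra_simps)
  moreover have "det B = 1"
    using d by (simp add: B_def det_2 vector_2 algebra_simps)
  ultimately have "inv\<^bsub>SL2Z\<^esub> A = B"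
    using A by (intro group.inv_equality[OF group_SL2Z]) (auto simp: SL2Z_def Gamma0_def)
  then show "inv\<^bsub>SL2Z\<^esub> A \<in> Gamma0 N"
    using A \<open>det B = 1\<close> by (auto simp: Gamma0_def SL2Z_def B_def vector_2)
next
  fix A B assume "A \<in> Gamma0 N" "B \<in> Gamma0 N"
  then show "A \<otimes>\<^bsub>SL2Z\<^esub> B \<in> Gamma0 N"
    by (simp add: Gamma0_def SL2Z_def det_mul) (simp add: matrix_matrix_mult_def sum_2)
qed

definition group_index :: "('a, 'b) monoid_scheme \<Rightarrow> 'a set \<Rightarrow> nat" where
  "group_index G H = card (rcosets\<^bsub>G\<^esub> H)"


section \<open>Modular forms\<close>

definition upper_half_plane :: "complex set" where
  "upper_half_plane = {z. Im z > 0}"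

definition mobius :: "int^2^2 \<Rightarrow> complex \<Rightarrow> complex" where
  "mobius A z = (of_int (A$1$1) * z + of_int (A$1$2)) / (of_int (A$2$1) * z + of_int (A$2$2))"

definition automorphy_factor :: "int^2^2 \<Rightarrow> complex \<Rightarrow> complex" where
  "automorphy_factor A z = of_int (A$2$1) * z + of_int (A$2$2)"

definition slash :: "nat \<Rightarrow> (complex \<Rightarrow> complex) \<Rightarrow> int^2^2 \<Rightarrow> complex \<Rightarrow> complex" where
  "slash k f A z = f (mobius A z) / automorphy_factor A z ^ k"

definition dirichlet_character :: "nat \<Rightarrow> (int \<Rightarrow> complex) \<Rightarrow> bool" where
  "dirichlet_character N chi \<longleftrightarrow>
     (\<forall>a b. chi (a * b) = chi a * chi b) \<and>
     (\<forall>a. chi (a + int N) = chi a) \<and>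
     (\<forall>a. chi a \<noteq> 0 \<longleftrightarrow> coprime a (int N))"

definition has_q_expansion :: "nat \<Rightarrow> (complex \<Rightarrow> complex) \<Rightarrow> (nat \<Rightarrow> complex) \<Rightarrow> bool" where
  "has_q_expansion h f a \<longleftrightarrow>
     (\<forall>z\<in>upper_half_plane. (\<lambda>n. a n * exp (2 * of_real pi * \<i> * of_nat n * z / of_nat h)) sums f z)"

text \<open>
  Functions on the upper half plane are represented by functions \<open>f :: complex \<Rightarrow> complex\<close>
  whose values elsewhere are irrelevant. The principal congruence subgroup \<open>\<Gamma>(N)\<close> is normal,
  contains the translation by \<open>N\<close>, and its elements have lower right entry congruent to 1
  modulo \<open>N\<close>. So for every \<open>A\<close> in \<open>SL\<^sub>2(\<int>)\<close> the function \<open>f|\<^sub>kA\<close> is \<open>N\<close>-periodic, and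
  holomorphy at the cusp \<open>A\<infinity>\<close> says that its Fourier expansion in \<open>exp (2\<pi>iz/N)\<close> has no terms
  of negative index.
\<close>

definition modular_form :: "nat \<Rightarrow> nat \<Rightarrow> (int \<Rightarrow> complex) \<Rightarrow> (complex \<Rightarrow> complex) \<Rightarrow> bool" where
  "modular_form N k chi f \<longleftrightarrow>
     f holomorphic_on upper_half_plane \<and>
     (\<forall>A\<in>Gamma0 N. \<forall>z\<in>upper_half_plane.
        f (mobius A z) = chi (A$2$2) * automorphy_factor A z ^ k * f z) \<and>
     (\<forall>A\<in>carrier SL2Z. \<exists>a. has_q_expansion N (slash k f A) a)"

definition fourier_coeff :: "(complex \<Rightarrow> complex) \<Rightarrow> nat \<Rightarrow> complex" where
  "fourier_coeff f = (THE a. has_q_expansion 1 f a)"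


lemma has_q_expansion_unique:
  assumes "has_q_expansion 1 f a" and "has_q_expansion 1 f b"
  shows "a = b"
proof (rule ccontr)
  assume "a \<noteq> b"
  then obtain m where m: "a m \<noteq> b m"
    by blast
  define c where "c n = (case n of 0 \<Rightarrow> 0 | Suc i \<Rightarrow> a i - b i)" for n
  have c: "(\<lambda>n. c n * q ^ n) sums 0" if "norm q < 1" for q :: complex
  proof (cases "q = 0")
    case True
    have "(\<lambda>n. c n * q ^ n) = (\<lambda>_. 0)"
      by (rule ext) (simp add: True c_def power_0_left)
    then show ?thesis
      by simp
  next
    case False
    define z where "z = Ln q / (2 * of_real pi * \<i>)"
    have q: "exp (2 * of_real pi * \<i> * of_nat n * z / of_nat 1) = q ^ n" for n
      using False by (simp add: z_def mult.commute exp_of_nat_mult)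
    have "ln (norm q) < 0"
      using False that by simp
    then have "z \<in> upper_half_plane"
      using False by (simp add: z_def upper_half_plane_def Im_divide power2_eq_square
          field_simps mult_neg_pos)
    then have "(\<lambda>n. a n * q ^ n) sums f z" "(\<lambda>n. b n * q ^ n) sums f z"
      using assms unfolding has_q_expansion_def by (simp_all only: flip: q)
    then have "(\<lambda>n. q * (a n * q ^ n - b n * q ^ n)) sums (q * (f z - f z))"
      by (intro sums_mult sums_diff)
    then have "(\<lambda>n. c (Suc n) * q ^ Suc n) sums 0"
      by (simp add: c_def algebra_simps)
    then show ?thesis
      using sums_Suc_iff[of "\<lambda>n. c n * q ^ n" 0] by (simp add: c_def)
  qed
  have "c (Suc m) \<noteq> 0"
    using m by (simp add: c_def)
  then obtain s :: real where "s > 0" and s: "\<And>q. q \<in> cball (0::complex) s - {0} \<Longrightarrow> (0::complex) \<noteq> 0"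
    using powser_0_nonzero[of 1 "0::complex" c "\<lambda>_. 0" "Suc m"] c by auto
  then show False
    using s[of "of_real s"] by auto
qed


section \<open>Hecke operators and eigenforms\<close>

text \<open>
  The operator \<open>T\<^sub>m\<close> on forms of weight \<open>k\<close> and character \<open>chi\<close>:
  \<open>T\<^sub>m f (z) = m\<^bsup>k-1\<^esup> \<Sum>\<^bsub>ad=m\<^esub> \<Sum>\<^bsub>0\<le>b<d\<^esub> chi(a) d\<^bsup>-k\<^esup> f((az + b)/d)\<close>.
  As \<open>chi\<close> vanishes at integers not coprime to the level, this covers also the operators whose
  index is not coprime to the level (usually written \<open>U\<^sub>p\<close> for a prime \<open>p\<close> dividing the level).
\<close>

definition hecke_op ::
    "nat \<Rightarrow> (int \<Rightarrow> complex) \<Rightarrow> nat \<Rightarrow> (complex \<Rightarrow> complex) \<Rightarrow> complex \<Rightarrow> complex" where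
  "hecke_op k chi m f z =
     of_nat m powi (int k - 1) *
       (\<Sum>d | d dvd m. \<Sum>b<d. chi (int (m div d)) / of_nat d ^ k *
          f ((of_nat (m div d) * z + of_nat b) / of_nat d))"

text \<open>
  The diamond operators act on forms with character \<open>chi\<close> by the scalars \<open>chi(d)\<close>, so they need no
  generators of their own.
\<close>

inductive_set hecke_algebra ::
    "nat \<Rightarrow> (int \<Rightarrow> complex) \<Rightarrow> ((complex \<Rightarrow> complex) \<Rightarrow> complex \<Rightarrow> complex) set"
  for k chi where
  hecke_op: "m > 0 \<Longrightarrow> hecke_op k chi m \<in> hecke_algebra k chi"
| scalar: "(\<lambda>f z. c * f z) \<in> hecke_algebra k chi"
| add: "S \<in> hecke_algebra k chi \<Longrightarrow> T \<in> hecke_algebra k chi \<Longrightarrow>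
    (\<lambda>f z. S f z + T f z) \<in> hecke_algebra k chi"
| comp: "S \<in> hecke_algebra k chi \<Longrightarrow> T \<in> hecke_algebra k chi \<Longrightarrow> S \<circ> T \<in> hecke_algebra k chi"

definition eigenform :: "nat \<Rightarrow> nat \<Rightarrow> (int \<Rightarrow> complex) \<Rightarrow> (complex \<Rightarrow> complex) \<Rightarrow> bool" where
  "eigenform N k chi f \<longleftrightarrow>
     modular_form N k chi f \<and>
     (\<exists>z\<in>upper_half_plane. f z \<noteq> 0) \<and>
     (\<forall>T\<in>hecke_algebra k chi. \<exists>c. \<forall>z\<in>upper_half_plane. T f z = c * f z)"

definition normalised_eigenform ::
    "nat \<Rightarrow> nat \<Rightarrow> (int \<Rightarrow> complex) \<Rightarrow> (complex \<Rightarrow> complex) \<Rightarrow> bool" where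
  "normalised_eigenform N k chi f \<longleftrightarrow> eigenform N k chi f \<and> fourier_coeff f 1 = 1"


section \<open>Number fields and congruences\<close>

text \<open>
  Fourier coefficients are complex numbers, so number fields are taken inside \<open>\<complex>\<close>.
\<close>

definition number_field :: "complex set \<Rightarrow> bool" where
  "number_field K \<longleftrightarrow>
     subfield K ring_of_type_algebra \<and> ring.finite_dimension ring_of_type_algebra \<rat> K"

definition ring_of_integers :: "complex set \<Rightarrow> complex set" where
  "ring_of_integers K = {x \<in> K. algebraic_int x}"

definition prime_ideal_of :: "complex set \<Rightarrow> complex set \<Rightarrow> bool" where
  "prime_ideal_of P R \<longleftrightarrow> primeideal P (ring_of_type_algebra\<lparr>carrier := R\<rparr>)"

definition cong_ideal :: "complex set \<Rightarrow> complex \<Rightarrow> complex \<Rightarrow> bool" where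
  "cong_ideal P x y \<longleftrightarrow> x - y \<in> P"

definition form_cong :: "complex set \<Rightarrow> (complex \<Rightarrow> complex) \<Rightarrow> (complex \<Rightarrow> complex) \<Rightarrow> bool" where
  "form_cong P f g \<longleftrightarrow> (\<forall>n. cong_ideal P (fourier_coeff f n) (fourier_coeff g n))"

definition least_prime_primroot :: "nat \<Rightarrow> nat \<Rightarrow> nat" where
  "least_prime_primroot p N = (LEAST l. Factorial_Ring.prime l \<and> residue_primroot p l \<and> \<not> l dvd N)"

end

theory Submission
  imports Defs "HOL-Computational_Algebra.Squarefree" "HOL-Number_Theory.Prime_Powers"
begin

text \<open>Let \<open>l\<close> be the least prime primitive root modulo \<open>p\<close> that does not divide \<open>N\<close>; it exists by
  Dirichlet's theorem for the modulus \<open>p\<close>. If the coefficients of \<open>f\<close> and \<open>g\<close> at \<open>l\<close> and \<open>l\<^sup>2\<close> agree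
  modulo \<open>P\<close>, then the Hecke relation expressing \<open>\<chi>(l) l\<^bsup>k-1\<^esup>\<close> by these coefficients gives
  \<open>l\<^bsup>k1-1\<^esup> = l\<^bsup>k2-1\<^esup>\<close> modulo \<open>p\<close>, so \<open>p - 1\<close> divides \<open>k2 - k1\<close>. As the Eisenstein series of weight
  \<open>p - 1\<close> is congruent to 1, a power of it times \<open>f\<close> is a form of the weight of \<open>g\<close> with the same
  reduction as \<open>f\<close>, and Sturm's bound applies to the difference. Congruences are read in a valuation
  ring of the complex numbers whose maximal ideal lies over \<open>P\<close>: its existence needs no finiteness
  of the number field, and in it finitely many numbers can be scaled to be integral with one of
  them a unit.\<close>

text \<open>Otherwise \<open>$\<close> would be ambiguous between vectors and power series, and terms with many matrix
  entries would have exponentially many parses.\<close>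

no_notation fps_nth (infixl "$" 75)

section \<open>Valuation rings\<close>

text \<open>The character common to \<open>f\<close> and \<open>g\<close> cancels at
  \<open>l\<close>, where its value is a root of unity because \<open>l\<close> is prime to
  \<open>N\<close>, and it is the character of the difference to which Sturm's bound is applied. The
  use of the coefficient at \<open>l ^ 2\<close> is the origin of the square in the bound. The
  obstacle in Sturm's argument is that the expansions of a form at other cusps may have denominators
  at \<open>p\<close>, in particular when \<open>p\<close> divides \<open>N\<close>. Symmetric
  functions of the conjugates have level one, where integrality is controlled by an explicit basis.
  Triangularity of that basis rests on dividing by \<open>delta\<close>, hence on
  \<open>delta\<close> having no zero in the upper half plane. The condition
  \<open>p \<ge> 5\<close> makes the weight \<open>p - 1\<close> at least 4, so that the Eisenstein
  series converges absolutely, and makes 1728, the leading coefficient of \<open>delta\<close>, a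
  unit modulo \<open>p\<close>. The congruence of the Eisenstein series with 1 requires its
  coefficients as rational numbers; this is why Euler's formula for the zeta values is
  proved.\<close>

definition subring_set :: "'a::field set \<Rightarrow> bool" where
  "subring_set S \<longleftrightarrow> 1 \<in> S \<and> (\<forall>x\<in>S. \<forall>y\<in>S. x + y \<in> S \<and> x * y \<in> S) \<and> (\<forall>x\<in>S. - x \<in> S)"

text \<open>The whole ring counts as an ideal; properness is stated separately, as
  \<open>1 \<notin> P\<close>.\<close>

definition ideal_of_set :: "'a::field set \<Rightarrow> 'a set \<Rightarrow> bool" where
  "ideal_of_set I S \<longleftrightarrow> I \<subseteq> S \<and> 0 \<in> I \<and> (\<forall>x\<in>I. \<forall>y\<in>I. x + y \<in> I) \<and> (\<forall>x\<in>S. \<forall>y\<in>I. x * y \<in> I)"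

lemma subring_setD:
  assumes "subring_set S"
  shows "1 \<in> S" "0 \<in> S" "x \<in> S \<Longrightarrow> y \<in> S \<Longrightarrow> x + y \<in> S" "x \<in> S \<Longrightarrow> y \<in> S \<Longrightarrow> x * y \<in> S"
    "x \<in> S \<Longrightarrow> - x \<in> S" "x \<in> S \<Longrightarrow> x ^ n \<in> S"
proof -
  show *: "1 \<in> S" "x \<in> S \<Longrightarrow> y \<in> S \<Longrightarrow> x + y \<in> S" "x \<in> S \<Longrightarrow> y \<in> S \<Longrightarrow> x * y \<in> S" "x \<in> S \<Longrightarrow> - x \<in> S" for x y
    using assms by (auto simp: subring_set_def)
  show "0 \<in> S" using *(2)[OF *(1) *(4)[OF *(1)]] by simp
  show "x \<in> S \<Longrightarrow> x ^ n \<in> S" by (induction n) (auto intro: *)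
qed

lemma subring_set_sum: "subring_set S \<Longrightarrow> (\<And>i. i \<in> A \<Longrightarrow> f i \<in> S) \<Longrightarrow> sum f A \<in> S"
  by (induction A rule: infinite_finite_induct) (auto intro: subring_setD)

lemma ideal_of_setD:
  assumes "ideal_of_set I S"
  shows "x \<in> I \<Longrightarrow> x \<in> S" "0 \<in> I" "x \<in> I \<Longrightarrow> y \<in> I \<Longrightarrow> x + y \<in> I" "x \<in> S \<Longrightarrow> y \<in> I \<Longrightarrow> x * y \<in> I"
    "x \<in> S \<Longrightarrow> y \<in> I \<Longrightarrow> y * x \<in> I"
  using assms by (auto simp: ideal_of_set_def mult.commute[of y])

lemma ideal_of_set_sum: "ideal_of_set I S \<Longrightarrow> (\<And>i. i \<in> A \<Longrightarrow> f i \<in> I) \<Longrightarrow> sum f A \<in> I"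
  by (induction A rule: infinite_finite_induct) (auto intro: ideal_of_setD)

lemma ideal_of_set_uminus: "subring_set S \<Longrightarrow> ideal_of_set I S \<Longrightarrow> x \<in> I \<Longrightarrow> - x \<in> I"
  using ideal_of_setD(4)[of I S "-1" x] subring_setD[of S] by simp

locale valuation_ring =
  fixes V :: "'a::field set"
  assumes subring: "subring_set V"
    and total: "x \<noteq> 0 \<Longrightarrow> x \<in> V \<or> inverse x \<in> V"
begin

text \<open>The nonunits of \<open>V\<close>, its unique maximal ideal. Zero is listed apart because
  \<open>inverse 0 = 0\<close> belongs to \<open>V\<close>.\<close>

definition M :: "'a set" where
  "M = {x \<in> V. x = 0 \<or> inverse x \<notin> V}"

lemmas VD = subring_setD[OF subring]

lemma V_diff: "x \<in> V \<Longrightarrow> y \<in> V \<Longrightarrow> x - y \<in> V"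
  using VD(3)[of x "-y"] VD(5)[of y] by simp

lemma M_V: "x \<in> M \<Longrightarrow> x \<in> V"
  by (simp add: M_def)

lemma M_mult: assumes "x \<in> V" "y \<in> M" shows "x * y \<in> M"
proof (cases "x * y = 0")
  case False
  have "inverse (x * y) \<notin> V"
  proof
    assume "inverse (x * y) \<in> V"
    then have "x * inverse (x * y) \<in> V" using assms VD by blast
    moreover have "x * inverse (x * y) = inverse y" using False by (simp add: field_simps)
    ultimately have "inverse y \<in> V" by metis
    then show False using assms False by (auto simp: M_def)
  qed
  then show ?thesis using assms VD by (auto simp: M_def)
qed (use VD(2) in \<open>auto simp: M_def\<close>)

text \<open>One of the quotients of \<open>x\<close> and \<open>y\<close> lies in \<open>V\<close>,
  so the sum is an element of \<open>V\<close> times one of the two summands.\<close>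

lemma M_add: assumes "x \<in> M" "y \<in> M" shows "x + y \<in> M"
proof (cases "x = 0 \<or> y = 0")
  case False
  then have "x / y \<in> V \<or> y / x \<in> V" using total[of "x / y"] by (simp add: field_simps)
  then show ?thesis
  proof
    assume "x / y \<in> V"
    then have "(x / y + 1) * y \<in> M" using assms VD by (intro M_mult) auto
    then show ?thesis using False by (simp add: field_simps)
  next
    assume "y / x \<in> V"
    then have "(y / x + 1) * x \<in> M" using assms VD by (intro M_mult) auto
    then show ?thesis using False by (simp add: field_simps)
  qed
qed (use assms in auto)

lemma M_0: "0 \<in> M" using VD by (simp add: M_def)

lemma M_ideal: "ideal_of_set M V"
  unfolding ideal_of_set_def using M_mult M_add M_0 M_V by auto

lemmas M_D = ideal_of_setD[OF M_ideal]

lemma M_uminus: "x \<in> M \<Longrightarrow> - x \<in> M"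
  using ideal_of_set_uminus[OF subring M_ideal] .

lemma M_diff: "x \<in> M \<Longrightarrow> y \<in> M \<Longrightarrow> x - y \<in> M"
  using M_add[of x "-y"] M_uminus[of y] by simp

lemma one_notin_M: "1 \<notin> M" using VD by (simp add: M_def)

lemma M_prime: assumes "x \<in> V" "y \<in> V" "x * y \<in> M" shows "x \<in> M \<or> y \<in> M"
proof (rule ccontr)
  assume "\<not> ?thesis"
  then have "inverse x \<in> V" "inverse y \<in> V" "x \<noteq> 0" "y \<noteq> 0" using assms by (auto simp: M_def)
  then have "inverse x * inverse y \<in> V" using VD by blast
  then have "inverse (x * y) \<in> V" by (simp add: mult.commute)
  then show False using assms(3) \<open>x \<noteq> 0\<close> \<open>y \<noteq> 0\<close> by (auto simp: M_def simp del: inverse_mult_distrib)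
qed

lemma unit_inverse: "x \<in> V \<Longrightarrow> x \<notin> M \<Longrightarrow> inverse x \<in> V"
  by (auto simp: M_def)

lemma M_pow: "x \<in> V \<Longrightarrow> x ^ n \<in> M \<Longrightarrow> x \<in> M"
proof (induction n)
  case (Suc n) then show ?case using M_prime[of x "x ^ n"] VD by auto
qed (use one_notin_M in auto)

lemma of_nat_V: "of_nat n \<in> V"
  by (induction n) (auto intro: VD)

lemma of_int_V: "of_int n \<in> V"
  by (cases n rule: int_cases2) (auto intro: VD of_nat_V)

text \<open>Such an \<open>x\<close> is a power of its own inverse, so it lies in \<open>V\<close>
  whichever of the two does. This makes the values of a Dirichlet character integral at
  once.\<close>

lemma root_of_unity_V: assumes "x ^ n = 1" "n > 0" shows "x \<in> V"
proof (rule ccontr)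
  assume "x \<notin> V"
  have x: "x \<noteq> 0" using assms by (cases "x = 0") (auto simp: power_0_left)
  then have "inverse x \<in> V" using total \<open>x \<notin> V\<close> by blast
  then have "inverse x ^ (n - 1) \<in> V" by (rule VD(6))
  moreover have "inverse x ^ (n - 1) * x ^ n = x"
    using x assms(2) by (cases n) (auto simp: field_simps)
  ultimately show False using assms \<open>x \<notin> V\<close> by (metis mult.right_neutral)
qed

text \<open>Divisibility in \<open>V\<close> is a total preorder, so a finite set has an element
  dividing all the others. Dividing by it is the scaling in the proof of Sturm's bound.\<close>

lemma exists_max_divisor:
  assumes "finite A" "A \<noteq> {}"
  shows "\<exists>a\<in>A. \<forall>b\<in>A. \<exists>v\<in>V. b = v * a"
  using assms
proof (induction A rule: finite_ne_induct)
  case (singleton x)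
  then show ?case using VD by (intro bexI[of _ x]) (auto intro!: bexI[of _ 1])
next
  case (insert x A)
  then obtain a where a: "a \<in> A" "\<And>b. b \<in> A \<Longrightarrow> \<exists>v\<in>V. b = v * a" by blast
  have "(\<exists>v\<in>V. x = v * a) \<or> (\<exists>v\<in>V. a = v * x)"
  proof (cases "x = 0 \<or> a = 0")
    case True then show ?thesis using VD by (auto intro!: bexI[of _ 0])
  next
    case False
    then have "x / a \<in> V \<or> a / x \<in> V" using total[of "x / a"] by (simp add: field_simps)
    then show ?thesis using False
      by (metis nonzero_eq_divide_eq)
  qed
  then show ?case
  proof
    assume "\<exists>v\<in>V. x = v * a" then show ?thesis using a by blast
  next
    assume "\<exists>v\<in>V. a = v * x"
    then obtain v where v: "v \<in> V" "a = v * x" by blast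
    have "\<exists>w\<in>V. b = w * x" if bA: "b \<in> A" for b
    proof -
      obtain u where "u \<in> V" "b = u * a" using a(2)[OF bA] by blast
      then have "b = (u * v) * x" "u * v \<in> V" using v VD(4) by simp_all
      then show ?thesis by blast
    qed
    moreover have "\<exists>w\<in>V. x = w * x" using VD(1) by (intro bexI[of _ 1]) auto
    ultimately show ?thesis by blast
  qed
qed

end

text \<open>Clearing denominators turns a relation satisfied by \<open>inverse t\<close> into the
  reversed polynomial evaluated at \<open>t\<close>.\<close>

lemma poly_inverse_times_power:
  fixes t :: "'a::field"
  assumes "t \<noteq> 0" "Polynomial.degree p \<le> n"
  shows "poly p (inverse t) * t ^ n = (\<Sum>i\<le>n. Polynomial.coeff p i * t ^ (n - i))"
proof -
  have "poly p (inverse t) = (\<Sum>i\<le>n. Polynomial.coeff p i * inverse t ^ i)"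
    unfolding poly_altdef using assms(2)
    by (intro sum.mono_neutral_left) (auto simp: coeff_eq_0)
  moreover have "inverse t ^ i * t ^ n = t ^ (n - i)" if "i \<le> n" for i
    using that assms(1) by (simp add: field_simps flip: power_add)
  ultimately show ?thesis
    by (simp add: sum_distrib_right mult.assoc)
qed

text \<open>Chevalley's extension theorem: among the pairs \<open>(S, I)\<close> of a ring \<open>S \<supseteq> R\<close> and an ideal \<open>I\<close> of \<open>S\<close>
  lying over \<open>P\<close>, a maximal one is a valuation ring.\<close>

theorem exists_valuation_ring:
  fixes R P :: "'a::field set"
  assumes R: "subring_set R" and P: "ideal_of_set P R" and one: "1 \<notin> P"
    and prime: "\<And>x y. x \<in> R \<Longrightarrow> y \<in> R \<Longrightarrow> x * y \<in> P \<Longrightarrow> x \<in> P \<or> y \<in> P"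
  obtains V where "valuation_ring V" "R \<subseteq> V" "R \<inter> valuation_ring.M V = P"
proof -
  define adm where "adm S I \<longleftrightarrow> subring_set S \<and> ideal_of_set I S \<and> R \<subseteq> S \<and> P \<subseteq> I \<and> I \<inter> R \<subseteq> P"
    for S I :: "'a set"
  \<comment> \<open>A pair of a ring and an ideal is coded as one set of tagged elements, so that
    the order on pairs is plain inclusion and the subset form of Zorn's lemma applies.\<close>
  define c1 where "c1 W = {x. (x, True) \<in> W}" for W :: "('a \<times> bool) set"
  define c2 where "c2 W = {x. (x, False) \<in> W}" for W :: "('a \<times> bool) set"
  define AA where "AA = {W. adm (c1 W) (c2 W)}"
  have RP: "R \<times> {True} \<union> P \<times> {False} \<in> AA"
    using R P by (auto simp: AA_def adm_def c1_def c2_def)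
  have "\<exists>Mx\<in>AA. \<forall>W\<in>AA. Mx \<subseteq> W \<longrightarrow> W = Mx"
  proof (rule subset_Zorn)
    fix C assume C: "subset.chain AA C"
    show "\<exists>U\<in>AA. \<forall>W\<in>C. W \<subseteq> U"
    proof (cases "C = {}")
      case True then show ?thesis using RP by blast
    next
      case False
      have CA: "adm (c1 W) (c2 W)" if "W \<in> C" for W
        using C that by (auto simp: AA_def subset.chain_def)
      have two: "\<exists>Z\<in>C. W \<subseteq> Z \<and> Y \<subseteq> Z" if "W \<in> C" "Y \<in> C" for W Y
      proof -
        have "W \<subseteq> Y \<or> Y \<subseteq> W" using C that by (simp add: subset_chain_def)
        then show ?thesis using that by auto
      qed
      have in1: "x \<in> c1 (\<Union>C) \<longleftrightarrow> (\<exists>W\<in>C. x \<in> c1 W)" and in2: "x \<in> c2 (\<Union>C) \<longleftrightarrow> (\<exists>W\<in>C. x \<in> c2 W)" for x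
        by (auto simp: c1_def c2_def)
      have mono: "c1 W \<subseteq> c1 Z" "c2 W \<subseteq> c2 Z" if "W \<subseteq> Z" for W Z using that by (auto simp: c1_def c2_def)
      have s1: "x + y \<in> c1 (\<Union>C) \<and> x * y \<in> c1 (\<Union>C)" if xy: "x \<in> c1 (\<Union>C)" "y \<in> c1 (\<Union>C)" for x y
      proof -
        obtain W Y where WY: "W \<in> C" "Y \<in> C" "x \<in> c1 W" "y \<in> c1 Y" using xy in1 by blast
        obtain Z where Z: "Z \<in> C" "W \<subseteq> Z" "Y \<subseteq> Z" using two[OF WY(1,2)] by blast
        then have "x \<in> c1 Z" "y \<in> c1 Z" using mono(1) WY by blast+
        moreover have "subring_set (c1 Z)" using CA[OF Z(1)] by (simp add: adm_def)
        ultimately have "x + y \<in> c1 Z" "x * y \<in> c1 Z" by (auto simp: subring_set_def)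
        then show ?thesis using in1 Z(1) by auto
      qed
      have s2: "x + y \<in> c2 (\<Union>C)" if xy: "x \<in> c2 (\<Union>C)" "y \<in> c2 (\<Union>C)" for x y
      proof -
        obtain W Y where WY: "W \<in> C" "Y \<in> C" "x \<in> c2 W" "y \<in> c2 Y" using xy in2 by blast
        obtain Z where Z: "Z \<in> C" "W \<subseteq> Z" "Y \<subseteq> Z" using two[OF WY(1,2)] by blast
        then have "x \<in> c2 Z" "y \<in> c2 Z" using mono(2) WY by blast+
        moreover have "ideal_of_set (c2 Z) (c1 Z)" using CA[OF Z(1)] by (simp add: adm_def)
        ultimately have "x + y \<in> c2 Z" by (auto simp: ideal_of_set_def)
        then show ?thesis using in2 Z(1) by auto
      qed
      have s3: "x * y \<in> c2 (\<Union>C)" if xy: "x \<in> c1 (\<Union>C)" "y \<in> c2 (\<Union>C)" for x y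
      proof -
        obtain W Y where WY: "W \<in> C" "Y \<in> C" "x \<in> c1 W" "y \<in> c2 Y" using xy in1 in2 by blast
        obtain Z where Z: "Z \<in> C" "W \<subseteq> Z" "Y \<subseteq> Z" using two[OF WY(1,2)] by blast
        then have "x \<in> c1 Z" "y \<in> c2 Z" using mono WY by blast+
        moreover have "ideal_of_set (c2 Z) (c1 Z)" using CA[OF Z(1)] by (simp add: adm_def)
        ultimately have "x * y \<in> c2 Z" by (auto simp: ideal_of_set_def)
        then show ?thesis using in2 Z(1) by auto
      qed
      obtain W0 where W0: "W0 \<in> C" using False by blast
      have "c1 W0 \<subseteq> c1 (\<Union>C)" "c2 W0 \<subseteq> c2 (\<Union>C)" using mono[of W0 "\<Union>C"] W0 by auto
      moreover have "1 \<in> c1 W0" "0 \<in> c2 W0" "R \<subseteq> c1 W0" "P \<subseteq> c2 W0"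
        using CA[OF W0] by (simp_all add: adm_def subring_set_def ideal_of_set_def)
      ultimately have "1 \<in> c1 (\<Union>C)" "0 \<in> c2 (\<Union>C)" "R \<subseteq> c1 (\<Union>C)" "P \<subseteq> c2 (\<Union>C)" by blast+
      moreover have "- x \<in> c1 (\<Union>C)" if x: "x \<in> c1 (\<Union>C)" for x
      proof -
        obtain W where W: "W \<in> C" "x \<in> c1 W" using x in1 by blast
        then have "- x \<in> c1 W" using CA[OF W(1)] by (simp add: adm_def subring_set_def)
        then show ?thesis using in1 W by blast
      qed
      moreover have "c2 (\<Union>C) \<subseteq> c1 (\<Union>C)"
      proof
        fix x assume "x \<in> c2 (\<Union>C)"
        then obtain W where W: "W \<in> C" "x \<in> c2 W" using in2 by blast
        then have "x \<in> c1 W" using CA[OF W(1)] by (auto simp: adm_def ideal_of_set_def)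
        then show "x \<in> c1 (\<Union>C)" using in1 W by blast
      qed
      moreover have "c2 (\<Union>C) \<inter> R \<subseteq> P"
      proof
        fix x assume x: "x \<in> c2 (\<Union>C) \<inter> R"
        then obtain W where W: "W \<in> C" "x \<in> c2 W" using in2 by blast
        then show "x \<in> P" using CA[OF W(1)] x by (auto simp: adm_def)
      qed
      ultimately have "adm (c1 (\<Union>C)) (c2 (\<Union>C))"
        unfolding adm_def subring_set_def ideal_of_set_def using s1 s2 s3 by simp
      then show ?thesis by (intro bexI[of _ "\<Union>C"]) (auto simp: AA_def)
    qed
  qed
  then obtain W where W: "W \<in> AA" "\<And>Y. Y \<in> AA \<Longrightarrow> W \<subseteq> Y \<Longrightarrow> Y = W" by blast
  define S I where "S = c1 W" and "I = c2 W"
  have SI: "adm S I" using W by (simp add: AA_def S_def I_def)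
  have maximal: "S' = S" if "adm S' I'" "S \<subseteq> S'" "I \<subseteq> I'" for S' I'
  proof -
    have *: "c1 (S' \<times> {True} \<union> I' \<times> {False}) = S'" "c2 (S' \<times> {True} \<union> I' \<times> {False}) = I'"
      by (auto simp: c1_def c2_def)
    have "S' \<times> {True} \<union> I' \<times> {False} = W"
    proof (rule W(2))
      show "S' \<times> {True} \<union> I' \<times> {False} \<in> AA" using that(1) by (simp add: AA_def *)
      show "W \<subseteq> S' \<times> {True} \<union> I' \<times> {False}"
      proof (rule subrelI)
        fix x b assume "(x, b) \<in> W"
        then show "(x, b) \<in> S' \<times> {True} \<union> I' \<times> {False}"
          using that(2,3) by (cases b) (auto simp: S_def I_def c1_def c2_def)
      qed
    qed
    then show ?thesis using * by (simp add: S_def)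
  qed
  have sub: "subring_set S" and ide: "ideal_of_set I S" and RS: "R \<subseteq> S" and PI: "P \<subseteq> I" and IR: "I \<inter> R \<subseteq> P"
    using SI by (auto simp: adm_def)
  note SD = subring_setD[OF sub] and ID = ideal_of_setD[OF ide] and RD = subring_setD[OF R]
  have one_I: "1 \<notin> I" using one IR RD by blast
  \<comment> \<open>The pair formed by adjoining \<open>x\<close> to \<open>S\<close> and to
    \<open>I\<close> is admissible unless the enlarged ideal meets \<open>R\<close> outside
    \<open>P\<close>. Maximality leaves only these two possibilities.\<close>
  have dich: "x \<in> S \<or> (\<exists>p. (\<forall>i. Polynomial.coeff p i \<in> I) \<and> poly p x \<in> R - P)" for x
  proof (rule ccontr)
    assume neg: "\<not> ?thesis"
    define S' where "S' = {poly p x | p. \<forall>i. Polynomial.coeff p i \<in> S}"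
    define I' where "I' = {poly p x | p. \<forall>i. Polynomial.coeff p i \<in> I}"
    have "subring_set S'"
      unfolding subring_set_def
    proof (intro conjI ballI)
      show "1 \<in> S'" unfolding S'_def using SD by (auto intro!: exI[of _ 1] simp: coeff_1)
      fix a assume "a \<in> S'"
      then obtain p where p: "a = poly p x" "\<forall>i. Polynomial.coeff p i \<in> S" by (auto simp: S'_def)
      then show "- a \<in> S'" unfolding S'_def using SD by (auto intro!: exI[of _ "-p"])
      fix b assume "b \<in> S'"
      then obtain q where q: "b = poly q x" "\<forall>i. Polynomial.coeff q i \<in> S" by (auto simp: S'_def)
      show "a + b \<in> S'" unfolding S'_def using SD p q by (auto intro!: exI[of _ "p+q"])
      have "Polynomial.coeff (p * q) i \<in> S" for i unfolding coeff_mult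
        using p q SD by (intro subring_set_sum[OF sub]) auto
      then show "a * b \<in> S'" unfolding S'_def using p q by (auto intro!: exI[of _ "p*q"])
    qed
    moreover have "ideal_of_set I' S'"
      unfolding ideal_of_set_def
    proof (intro conjI ballI)
      show "I' \<subseteq> S'" unfolding I'_def S'_def using ID by blast
      show "0 \<in> I'" unfolding I'_def using ID by (auto intro!: exI[of _ 0])
      fix a assume "a \<in> I'"
      then obtain p where p: "a = poly p x" "\<forall>i. Polynomial.coeff p i \<in> I" by (auto simp: I'_def)
      fix b assume "b \<in> I'"
      then obtain q where q: "b = poly q x" "\<forall>i. Polynomial.coeff q i \<in> I" by (auto simp: I'_def)
      show "a + b \<in> I'" unfolding I'_def using ID p q by (auto intro!: exI[of _ "p+q"])
    next
      fix a b assume "a \<in> S'" "b \<in> I'"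
      then obtain p q where p: "a = poly p x" "\<forall>i. Polynomial.coeff p i \<in> S" and q: "b = poly q x" "\<forall>i. Polynomial.coeff q i \<in> I"
        by (auto simp: S'_def I'_def)
      have "Polynomial.coeff (p * q) i \<in> I" for i unfolding coeff_mult
        using p q ID by (intro ideal_of_set_sum[OF ide]) auto
      then show "a * b \<in> I'" unfolding I'_def using p q by (auto intro!: exI[of _ "p*q"])
    qed
    moreover have sS: "S \<subseteq> S'"
    proof
      fix a assume "a \<in> S"
      then show "a \<in> S'" unfolding S'_def using SD
        by (auto intro!: exI[of _ "[:a:]"] simp: coeff_pCons split: nat.split)
    qed
    moreover have sI: "I \<subseteq> I'"
    proof
      fix a assume "a \<in> I"
      then show "a \<in> I'" unfolding I'_def using ID
        by (auto intro!: exI[of _ "[:a:]"] simp: coeff_pCons split: nat.split)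
    qed
    moreover have "I' \<inter> R \<subseteq> P" using neg by (auto simp: I'_def)
    ultimately have "adm S' I'" using RS PI by (auto simp: adm_def)
    then have "S' = S" using maximal sS sI by blast
    moreover have "x \<in> S'" unfolding S'_def using SD
      by (auto intro!: exI[of _ "[:0,1:]"] simp: coeff_pCons split: nat.split)
    ultimately show False using neg by blast
  qed
  have sumI: "(\<Sum>i\<le>n. Polynomial.coeff p i * t ^ (n - i)) \<in> I" if "\<forall>i. Polynomial.coeff p i \<in> I" "t \<in> S" for p t n
    using that ID SD by (intro ideal_of_set_sum[OF ide]) auto
  have powRP: "t ^ n \<in> R - P" if "t \<in> R - P" for t and n :: nat
  proof (induction n)
    case (Suc n)
    then show ?case using prime[of t "t ^ n"] that RD by auto
  qed (use one RD(1) in simp)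
  \<comment> \<open>Were \<open>inverse t\<close> not in \<open>S\<close>, the dichotomy would give
    a relation for it over \<open>I\<close>; multiplied by a power of \<open>t\<close> it exhibits a
    product of elements of \<open>R - P\<close> inside \<open>P\<close>.\<close>
  have unitR: "inverse t \<in> S" if t: "t \<in> R - P" for t
  proof (rule ccontr)
    assume "inverse t \<notin> S"
    then obtain p where p: "\<forall>i. Polynomial.coeff p i \<in> I" "poly p (inverse t) \<in> R - P" using dich by blast
    have "t \<noteq> 0" using t ideal_of_setD(2)[OF P] by auto
    then have eq: "poly p (inverse t) * t ^ Polynomial.degree p = (\<Sum>i\<le>Polynomial.degree p. Polynomial.coeff p i * t ^ (Polynomial.degree p - i))"
      by (intro poly_inverse_times_power) auto
    have "\<dots> \<in> I" using p t RS by (intro sumI) auto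
    moreover have "poly p (inverse t) * t ^ Polynomial.degree p \<in> R" using p(2) powRP[OF t] RD by auto
    ultimately have "poly p (inverse t) * t ^ Polynomial.degree p \<in> P" using IR eq by auto
    then show False using prime p(2) powRP[OF t] by blast
  qed
  have dich': "x \<in> S \<or> (\<exists>p. (\<forall>i. Polynomial.coeff p i \<in> I) \<and> poly p x = 1)" for x
  proof (cases "x \<in> S")
    case False
    obtain p where p: "\<forall>i. Polynomial.coeff p i \<in> I" "poly p x \<in> R - P" using dich[of x] False by blast
    have "poly p x \<noteq> 0" using p(2) ideal_of_setD(2)[OF P] by auto
    then have "poly (Polynomial.smult (inverse (poly p x)) p) x = 1" by simp
    moreover have "\<forall>i. Polynomial.coeff (Polynomial.smult (inverse (poly p x)) p) i \<in> I"
      using ID(4)[OF unitR[OF p(2)]] p(1) by simp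
    ultimately show ?thesis by blast
  qed simp
  have unitI: "inverse (1 - b) \<in> S" if b: "b \<in> I" for b
  proof (rule ccontr)
    assume "inverse (1 - b) \<notin> S"
    then obtain p where p: "\<forall>i. Polynomial.coeff p i \<in> I" "poly p (inverse (1 - b)) = 1" using dich' by blast
    have "1 - b \<noteq> 0" using b one_I by auto
    then have eq: "poly p (inverse (1 - b)) * (1 - b) ^ Polynomial.degree p = (\<Sum>i\<le>Polynomial.degree p. Polynomial.coeff p i * (1 - b) ^ (Polynomial.degree p - i))"
      by (intro poly_inverse_times_power) auto
    have bS: "1 - b \<in> S" using SD(3)[OF SD(1) SD(5)[OF ID(1)[OF b]]] by simp
    have 1: "(1 - b) ^ Polynomial.degree p \<in> I" using sumI[OF p(1) bS] eq p(2) by simp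
    have 2: "1 - (1 - b) ^ n \<in> I" for n
    proof (induction n)
      case (Suc n)
      have e: "1 - (1 - b) ^ Suc n = (1 - (1 - b) ^ n) + (1 - b) ^ n * b" by (simp add: algebra_simps)
      show ?case unfolding e using ID(3)[OF Suc ID(4)[OF SD(6)[OF bS] b]] .
    qed (use ID(2) in simp)
    have "(1 - b) ^ Polynomial.degree p + (1 - (1 - b) ^ Polynomial.degree p) \<in> I" using ID(3)[OF 1 2] .
    then show False using one_I by simp
  qed
  \<comment> \<open>Degree descent. In the relation for \<open>inverse x\<close> the constant term
    lies in \<open>I\<close>, so one minus it is a unit and \<open>x ^ m\<close> becomes a
    combination of lower powers with coefficients in \<open>I\<close>. Substituting this for the top
    power of \<open>x\<close> in the shortest relation for \<open>x\<close> shortens it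
    further.\<close>
  have red: False
    if x: "x \<noteq> 0" and p: "\<forall>i. Polynomial.coeff p i \<in> I" "poly p x = 1"
      and q: "\<forall>i. Polynomial.coeff q i \<in> I" "poly q (inverse x) = 1" and d: "Polynomial.degree q \<le> Polynomial.degree p"
      and minp: "\<And>r. \<forall>i. Polynomial.coeff r i \<in> I \<Longrightarrow> poly r x = 1 \<Longrightarrow> Polynomial.degree p \<le> Polynomial.degree r" for x p q
  proof -
    define n m where "n = Polynomial.degree p" and "m = Polynomial.degree q"
    have m: "m > 0"
    proof (rule ccontr)
      assume "\<not> m > 0"
      then obtain c where c: "q = [:c:]" using degree_eq_zeroE[of q] by (auto simp: m_def)
      then have "c = 1" using q(2) by simp
      then show False using q(1)[rule_format, of 0] one_I c by simp
    qed
    define u where "u = inverse (1 - Polynomial.coeff q 0)"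
    have u: "u \<in> S" unfolding u_def using unitI q by blast
    have u': "1 - Polynomial.coeff q 0 \<noteq> 0" using q(1)[rule_format, of 0] one_I by auto
    have "x ^ m = (\<Sum>i\<le>m. Polynomial.coeff q i * x ^ (m - i))"
      using poly_inverse_times_power[OF x, of q m] q(2) by (simp add: m_def)
    also have "\<dots> = Polynomial.coeff q 0 * x ^ m + (\<Sum>i\<in>{1..m}. Polynomial.coeff q i * x ^ (m - i))"
      by (simp add: atMost_atLeast0 sum.atLeast_Suc_atMost)
    finally have "(1 - Polynomial.coeff q 0) * x ^ m = (\<Sum>i\<in>{1..m}. Polynomial.coeff q i * x ^ (m - i))"
      by (simp add: algebra_simps)
    then have "u * ((1 - Polynomial.coeff q 0) * x ^ m) = u * (\<Sum>i\<in>{1..m}. Polynomial.coeff q i * x ^ (m - i))" by simp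
    moreover have uu: "u * ((1 - Polynomial.coeff q 0) * x ^ m) = x ^ m" using u' by (simp add: u_def)
    ultimately have xm: "x ^ m = (\<Sum>i\<in>{1..m}. u * Polynomial.coeff q i * x ^ (m - i))"
      by (simp only: uu sum_distrib_left mult.assoc)
    define r where "r = (\<Sum>i\<in>{1..m}. Polynomial.monom (u * Polynomial.coeff q i) (n - i))"
    have nm: "n \<ge> m" using d by (simp add: n_def m_def)
    have "x ^ n = x ^ (n - m) * x ^ m" using nm by (simp flip: power_add)
    also have "\<dots> = (\<Sum>i\<in>{1..m}. u * Polynomial.coeff q i * x ^ (n - i))"
      unfolding xm sum_distrib_left
    proof (rule sum.cong)
      fix i assume i: "i \<in> {1..m}"
      have "x ^ (n - m) * x ^ (m - i) = x ^ (n - i)" using i nm by (simp flip: power_add)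
      then show "x ^ (n - m) * (u * Polynomial.coeff q i * x ^ (m - i)) = u * Polynomial.coeff q i * x ^ (n - i)"
        by (simp add: algebra_simps)
    qed simp
    also have "\<dots> = poly r x" by (simp add: r_def poly_sum poly_monom)
    finally have xr: "poly r x = x ^ n" by simp
    have rI: "Polynomial.coeff r i \<in> I" for i unfolding r_def coeff_sum
      using u q(1) ID(2) ID(4) by (intro ideal_of_set_sum[OF ide]) (simp add: coeff_monom)
    have rn: "Polynomial.coeff r i = 0" if "i \<ge> n" for i unfolding r_def coeff_sum
      using that nm by (intro sum.neutral) (auto simp: coeff_monom)
    define p' where "p' = p - Polynomial.monom (Polynomial.coeff p n) n + Polynomial.smult (Polynomial.coeff p n) r"
    have "poly p' x = 1" using p xr by (simp add: p'_def poly_monom)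
    moreover have "\<forall>i. Polynomial.coeff p' i \<in> I"
    proof
      fix i
      have "Polynomial.coeff p n * Polynomial.coeff r i \<in> I" using ID(4)[OF ID(1) rI] p(1) by blast
      then show "Polynomial.coeff p' i \<in> I" using p(1) ID(3) by (cases "i = n") (simp_all add: p'_def coeff_monom)
    qed
    moreover have "Polynomial.degree p' < n"
    proof (rule ccontr)
      assume "\<not> Polynomial.degree p' < n"
      then have ge: "Polynomial.degree p' \<ge> n" by simp
      then have "Polynomial.coeff p' (Polynomial.degree p') = 0"
        using rn[OF ge] by (cases "Polynomial.degree p' = n")
          (auto simp: p'_def coeff_monom coeff_eq_0 n_def[symmetric])
      then have "p' = 0" by simp
      then show False using ge m nm by simp
    qed
    ultimately show False using minp[of p'] by (simp add: n_def)
  qed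
  have val: "valuation_ring S"
  proof (unfold_locales)
    show "subring_set S" by fact
    fix x :: 'a assume x: "x \<noteq> 0"
    show "x \<in> S \<or> inverse x \<in> S"
    proof (rule ccontr)
      assume "\<not> ?thesis"
      then have ex: "\<exists>p. (\<forall>i. Polynomial.coeff p i \<in> I) \<and> poly p x = 1" "\<exists>p. (\<forall>i. Polynomial.coeff p i \<in> I) \<and> poly p (inverse x) = 1"
        using dich' by blast+
      obtain p0 where p0: "(\<forall>i. Polynomial.coeff p0 i \<in> I) \<and> poly p0 x = 1" using ex(1) by blast
      obtain p where p': "(\<forall>i. Polynomial.coeff p i \<in> I) \<and> poly p x = 1"
        "\<forall>r. (\<forall>i. Polynomial.coeff r i \<in> I) \<and> poly r x = 1 \<longrightarrow> Polynomial.degree p \<le> Polynomial.degree r"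
        using ex_has_least_nat[where P = "\<lambda>p. (\<forall>i. Polynomial.coeff p i \<in> I) \<and> poly p x = 1" and m = Polynomial.degree, OF p0]
        by (elim exE conjE) (rule that, auto)
      have p: "\<forall>i. Polynomial.coeff p i \<in> I" "poly p x = 1"
        "\<And>r. \<forall>i. Polynomial.coeff r i \<in> I \<Longrightarrow> poly r x = 1 \<Longrightarrow> Polynomial.degree p \<le> Polynomial.degree r"
        using p' by auto
      obtain q0 where q0: "(\<forall>i. Polynomial.coeff q0 i \<in> I) \<and> poly q0 (inverse x) = 1" using ex(2) by blast
      obtain q where q': "(\<forall>i. Polynomial.coeff q i \<in> I) \<and> poly q (inverse x) = 1"
        "\<forall>r. (\<forall>i. Polynomial.coeff r i \<in> I) \<and> poly r (inverse x) = 1 \<longrightarrow> Polynomial.degree q \<le> Polynomial.degree r"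
        using ex_has_least_nat[where P = "\<lambda>p. (\<forall>i. Polynomial.coeff p i \<in> I) \<and> poly p (inverse x) = 1" and m = Polynomial.degree, OF q0]
        by (elim exE conjE) (rule that, auto)
      have q: "\<forall>i. Polynomial.coeff q i \<in> I" "poly q (inverse x) = 1"
        "\<And>r. \<forall>i. Polynomial.coeff r i \<in> I \<Longrightarrow> poly r (inverse x) = 1 \<Longrightarrow> Polynomial.degree q \<le> Polynomial.degree r"
        using q' by auto
      show False
      proof (cases "Polynomial.degree q \<le> Polynomial.degree p")
        case True then show ?thesis by (rule red[OF x p(1,2) q(1,2) _ p(3)])
      next
        case False
          have x': "inverse x \<noteq> 0" "poly p (inverse (inverse x)) = 1" using x p(2) by simp_all
          show ?thesis by (rule red[OF x'(1) q(1,2) p(1) x'(2) _ q(3)]) (use False in simp)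
      qed
    qed
  qed
  have "R \<inter> valuation_ring.M S = P"
  proof (intro equalityI subsetI)
    fix x assume "x \<in> R \<inter> valuation_ring.M S"
    then have "x \<in> R" "x = 0 \<or> inverse x \<notin> S" by (auto simp: valuation_ring.M_def[OF val])
    then show "x \<in> P" using unitR[of x] ideal_of_setD(2)[OF P] by blast
  next
    fix x assume x: "x \<in> P"
    have "x = 0 \<or> inverse x \<notin> S"
    proof (rule ccontr)
      assume *: "\<not> (x = 0 \<or> inverse x \<notin> S)"
      then have "inverse x * x \<in> I" using x PI ID(4)[of "inverse x" x] by blast
      then show False using * one_I by simp
    qed
    moreover have "x \<in> R" using x P by (auto simp: ideal_of_set_def)
    ultimately show "x \<in> R \<inter> valuation_ring.M S"
      using RS by (auto simp: valuation_ring.M_def[OF val])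
  qed
  with val RS show ?thesis by (rule that)
qed

section \<open>Dirichlet's theorem for a prime modulus\<close>

lemma real_div_le: "real (n div d) \<le> real n / real d"
  using of_int_floor_le[of "real n / real d"] unfolding floor_divide_of_nat_eq by simp

lemma real_div_ge: "real n / real d \<le> real (n div d) + 1"
  using real_of_int_floor_add_one_ge[of "real n / real d"] unfolding floor_divide_of_nat_eq by simp

lemma sum_divisor_swap:
  fixes F :: "nat \<Rightarrow> nat \<Rightarrow> 'a::comm_monoid_add"
  shows "(\<Sum>k\<in>{1..n}. \<Sum>d | d dvd k. F d (k div d)) = (\<Sum>d\<in>{1..n}. \<Sum>e\<in>{1..n div d}. F d e)"
proof -
  have "(\<Sum>k\<in>{1..n}. \<Sum>d | d dvd k. F d (k div d)) = (\<Sum>(k, d)\<in>Sigma {1..n} (\<lambda>k. {d. d dvd k}). F d (k div d))"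
    by (intro sum.Sigma) auto
  also have "\<dots> = (\<Sum>(d, e)\<in>Sigma {1..n} (\<lambda>d. {1..n div d}). F d e)"
  proof (rule sum.reindex_bij_witness[where i = "\<lambda>(d, e). (d * e, d)" and j = "\<lambda>(k, d). (d, k div d)"])
    fix x assume "x \<in> Sigma {1..n} (\<lambda>k. {d. d dvd k})"
    then obtain k d where x: "x = (k, d)" "1 \<le> k" "k \<le> n" "d dvd k" by auto
    then have "d \<le> n" "d \<ge> 1" using dvd_imp_le[of d k] by (auto intro: Suc_leI gr0I)
    then show "(case x of (k, d) \<Rightarrow> (d, k div d)) \<in> Sigma {1..n} (\<lambda>d. {1..n div d})"
      using x by (auto simp: div_le_mono Suc_le_eq div_greater_zero_iff dvd_imp_le)
  next
    fix x assume "x \<in> Sigma {1..n} (\<lambda>d. {1..n div d})"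
    then obtain d e where x: "x = (d, e)" "1 \<le> d" "d \<le> n" "1 \<le> e" "e \<le> n div d" by auto
    then have "d * e \<le> n" using less_eq_div_iff_mult_less_eq[of d e n] by (simp add: mult.commute)
    then show "(case x of (d, e) \<Rightarrow> (d * e, d)) \<in> Sigma {1..n} (\<lambda>k. {d. d dvd k})"
      using x by (auto simp: Suc_le_eq)
  qed auto
  also have "\<dots> = (\<Sum>d\<in>{1..n}. \<Sum>e\<in>{1..n div d}. F d e)"
    by (intro sum.Sigma[symmetric]) auto
  finally show ?thesis .
qed

text \<open>Legendre's formula for the factorial in logarithmic form; both the Chebyshev and the
  Mertens bounds are read off from it.\<close>

lemma ln_fact_mangoldt: "ln (fact n :: real) = (\<Sum>d\<in>{1..n}. mangoldt d * real (n div d))"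
proof -
  have "ln (fact n :: real) = (\<Sum>k\<in>{1..n}. ln (real k))"
    by (induction n) (simp_all add: ln_mult add.commute)
  also have "\<dots> = (\<Sum>k\<in>{1..n}. \<Sum>d | d dvd k. mangoldt d)"
    by (intro sum.cong) (simp_all add: mangoldt_sum)
  also have "\<dots> = (\<Sum>d\<in>{1..n}. \<Sum>e\<in>{1..n div d}. mangoldt d)"
    by (rule sum_divisor_swap)
  finally show ?thesis by (simp add: mult.commute)
qed

text \<open>Chebyshev's argument with the central binomial coefficient, which is at most
  \<open>2 ^ (2 * n)\<close>. Its logarithm weights \<open>mangoldt d\<close> by
  \<open>2 * n div d\<close> minus twice \<open>n div d\<close>; this weight is never negative and
  equals 1 for \<open>d\<close> between \<open>n + 1\<close> and \<open>2 * n\<close>.\<close>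

lemma psi_double: "(\<Sum>d\<in>{1..2*n}. mangoldt d :: real) \<le> (\<Sum>d\<in>{1..n}. mangoldt d) + 2 * real n"
proof -
  have "(\<Sum>d\<in>{1..2*n}. mangoldt d :: real) - (\<Sum>d\<in>{1..n}. mangoldt d) = (\<Sum>d\<in>{1..2*n} - {1..n}. mangoldt d)"
    by (subst sum_diff) auto
  also have "\<dots> = (\<Sum>d\<in>{1..2*n} - {1..n}. mangoldt d * real (2 * n div d))"
  proof (intro sum.cong refl)
    fix d assume "d \<in> {1..2*n} - {1..n}"
    then have "2 * n div d = 1" by (intro div_nat_eqI) auto
    then show "(mangoldt d :: real) = mangoldt d * real (2 * n div d)" by simp
  qed
  also have "\<dots> = (\<Sum>d\<in>{1..2*n} - {1..n}. mangoldt d * (real (2 * n div d) - 2 * real (n div d)))"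
    by (intro sum.cong) auto
  also have "\<dots> \<le> (\<Sum>d\<in>{1..2*n}. mangoldt d * (real (2 * n div d) - 2 * real (n div d)))"
  proof (intro sum_mono2)
    fix d assume "d \<in> {1..2 * n} - ({1..2 * n} - {1..n})"
    have "2 * (n div d) \<le> 2 * n div d" using div_mult2_eq
      by (metis div_mult1_eq le_add1 mult.commute)
    then have "2 * real (n div d) \<le> real (2 * n div d)" by (metis of_nat_le_iff of_nat_mult of_nat_numeral)
    then show "0 \<le> mangoldt d * (real (2 * n div d) - 2 * real (n div d))"
      by (intro mult_nonneg_nonneg mangoldt_nonneg) simp
  qed auto
  also have "\<dots> = (\<Sum>d\<in>{1..2*n}. mangoldt d * real (2 * n div d)) - 2 * (\<Sum>d\<in>{1..2*n}. mangoldt d * real (n div d))"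
    by (simp add: algebra_simps sum_subtractf sum_distrib_left)
  also have "(\<Sum>d\<in>{1..2*n}. mangoldt d * real (n div d)) = (\<Sum>d\<in>{1..n}. mangoldt d * real (n div d))"
    by (intro sum.mono_neutral_right) auto
  also have "(\<Sum>d\<in>{1..2*n}. mangoldt d * real (2 * n div d)) - 2 * \<dots> = ln (fact (2 * n)) - 2 * ln (fact n)"
    by (simp only: ln_fact_mangoldt)
  also have "\<dots> = ln (fact (2 * n) / (fact n * fact n))"
    by (simp add: ln_div ln_mult)
  also have "fact (2 * n) / (fact n * fact n) = real ((2 * n) choose n)"
    by (simp add: binomial_fact)
  also have "ln \<dots> \<le> ln (real (2 ^ (2 * n)))"
  proof (subst ln_le_cancel_iff)
    show "real (2 * n choose n) \<le> real (2 ^ (2 * n))"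
      using binomial_le_pow2[of "2*n" n] of_nat_le_iff by blast
  qed (auto simp: zero_less_binomial_iff)
  also have "\<dots> = real (2 * n) * ln 2"
    by (simp add: ln_realpow)
  also have "\<dots> \<le> real (2 * n) * 1"
    using ln_2_less_1 by (intro mult_left_mono) auto
  finally show ?thesis by simp
qed

text \<open>Induction by halving. With \<open>m = n div 2\<close> the doubling step gives
  \<open>6 * m\<close>, and the remaining \<open>2 * m\<close> in the constant 4 absorbs the extra
  term for odd \<open>n\<close>.\<close>

lemma psi_le: "(\<Sum>d\<in>{1..n}. mangoldt d :: real) \<le> 4 * real n"
proof (induction n rule: less_induct)
  case (less n)
  show ?case
  proof (cases "n = 0")
    case False
    define m where "m = n div 2"
    have "m < n" using False by (simp add: m_def)
    then have IH: "(\<Sum>d\<in>{1..2*m}. mangoldt d :: real) \<le> 4 * real m + 2 * real m"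
      using less[of m] psi_double[of m] by linarith
    show ?thesis
    proof (cases "even n")
      case True
      then have "n = 2 * m" by (simp add: m_def)
      then show ?thesis using IH by simp
    next
      case False
      then have n: "n = Suc (2 * m)" by (simp add: m_def)
      have "mangoldt n \<le> ln (real n)" using n by (intro mangoldt_le) auto
      also have "\<dots> \<le> real (2 * m)" using n ln_add_one_self_le_self[of "real (2 * m)"] by (simp add: add.commute)
      finally have "(mangoldt n :: real) \<le> 2 * real m" by simp
      moreover have "(\<Sum>d\<in>{1..n}. mangoldt d :: real) = (\<Sum>d\<in>{1..2*m}. mangoldt d) + mangoldt n"
        using n by simp
      ultimately show ?thesis using IH n by simp
    qed
  qed simp
qed

text \<open>The series of \<open>exp n\<close> has only nonnegative terms and contains
  \<open>n ^ n / n!\<close>.\<close>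

lemma ln_fact_ge: "ln (fact n :: real) \<ge> real n * ln (real n) - real n"
proof (cases "n = 0")
  case False
  have "real n ^ n / fact n \<le> exp (real n)"
  proof -
    have "(\<lambda>k. real n ^ k /\<^sub>R fact k) sums exp (real n)" by (rule exp_converges)
    then have s: "(\<lambda>k. real n ^ k / fact k) sums exp (real n)" by (simp add: field_simps)
    have "sum (\<lambda>k. real n ^ k / fact k) {n} \<le> suminf (\<lambda>k. real n ^ k / fact k)"
      using s by (intro sum_le_suminf) (auto simp: sums_iff)
    then show ?thesis using s by (simp add: sums_iff)
  qed
  then have "ln (real n ^ n / fact n) \<le> ln (exp (real n))"
    using False by (subst ln_le_cancel_iff) auto
  then show ?thesis using False by (simp add: ln_div ln_realpow)
qed simp

lemma mangoldt_over_n_lower: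
  assumes "n > 0" shows "(\<Sum>d\<in>{1..n}. mangoldt d / real d) \<ge> ln (real n) - 1"
proof -
  have "real n * ln (real n) - real n \<le> (\<Sum>d\<in>{1..n}. mangoldt d * real (n div d))"
    using ln_fact_ge[of n] by (simp add: ln_fact_mangoldt)
  also have "\<dots> \<le> (\<Sum>d\<in>{1..n}. mangoldt d * (real n / real d))"
    by (intro sum_mono mult_left_mono real_div_le mangoldt_nonneg)
  also have "\<dots> = real n * (\<Sum>d\<in>{1..n}. mangoldt d / real d)"
    by (simp add: sum_distrib_left algebra_simps)
  finally have "real n * (ln (real n) - 1) \<le> real n * (\<Sum>d\<in>{1..n}. mangoldt d / real d)"
    by (simp add: algebra_simps)
  then show ?thesis using assms by simp
qed

text \<open>What matters is a leading factor below 2, since two vanishing L-values would force a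
  factor of at least 2. Working with the factorial of \<open>10 * n\<close> makes the rounding loss
  at each \<open>d \<le> n\<close> at most a tenth of \<open>10 * n / d\<close>, which yields
  10/9.\<close>

lemma mangoldt_over_n_upper:
  assumes "n > 0" shows "(\<Sum>d\<in>{1..n}. mangoldt d / real d) \<le> 10 / 9 * (ln (real n) + ln 10)"
proof -
  have "9 * real n * (\<Sum>d\<in>{1..n}. mangoldt d / real d) = (\<Sum>d\<in>{1..n}. mangoldt d * (9 * real n / real d))"
    by (simp add: sum_distrib_left algebra_simps)
  also have "\<dots> \<le> (\<Sum>d\<in>{1..n}. mangoldt d * real (10 * n div d))"
  proof (intro sum_mono mult_left_mono mangoldt_nonneg)
    fix d assume d: "d \<in> {1..n}"
    have "real (10 * n) / real d - real (10 * n div d) \<le> 1"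
      using real_div_ge[of "10*n" d] by simp
    moreover have "real n / real d \<ge> 1" using d by simp
    ultimately show "9 * real n / real d \<le> real (10 * n div d)" by simp
  qed
  also have "\<dots> \<le> (\<Sum>d\<in>{1..10*n}. mangoldt d * real (10 * n div d))"
    by (intro sum_mono2) (auto intro!: mult_nonneg_nonneg mangoldt_nonneg)
  also have "\<dots> = ln (fact (10 * n))" by (simp add: ln_fact_mangoldt)
  also have "\<dots> \<le> ln (real ((10 * n) ^ (10 * n)))"
  proof (subst ln_le_cancel_iff)
    show "fact (10 * n) \<le> real ((10 * n) ^ (10 * n))"
      using fact_le_power[of "10 * n", where ?'a = real] by simp
  qed (use assms in auto)
  also have "\<dots> = 10 * real n * (ln (real n) + ln 10)"
    using assms by (simp add: ln_realpow ln_mult algebra_simps)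
  finally have "real n * (9 * (\<Sum>d\<in>{1..n}. mangoldt d / real d)) \<le> real n * (10 * (ln (real n) + ln 10))"
    by (simp add: algebra_simps)
  then show ?thesis using assms by simp
qed

definition moebius :: "nat \<Rightarrow> real" where
  "moebius n = (if squarefree n then (-1) ^ card (prime_factors n) else 0)"

lemma abs_moebius_le: "\<bar>moebius n\<bar> \<le> 1"
  by (simp add: moebius_def power_abs)

text \<open>For a prime \<open>q\<close> dividing \<open>n\<close>, multiplication by
  \<open>q\<close> pairs the squarefree divisors prime to \<open>q\<close> with those divisible by
  \<open>q\<close>, and it changes the sign.\<close>

lemma sum_moebius:
  assumes "n > 0" shows "(\<Sum>d | d dvd n. moebius d) = (if n = 1 then 1 else 0)"
proof (cases "n = 1")
  case False
  then obtain q where q: "Factorial_Ring.prime q" "q dvd n" using prime_factor_nat by blast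
  have fin: "finite {d. d dvd n}" using assms by simp
  define D0 D1 where "D0 = {d. d dvd n \<and> squarefree d \<and> \<not> q dvd d}" and "D1 = {d. d dvd n \<and> squarefree d \<and> q dvd d}"
  have finD: "finite D0" "finite D1" using fin by (auto simp: D0_def D1_def)
  have "(\<Sum>d | d dvd n. moebius d) = (\<Sum>d\<in>D0 \<union> D1. moebius d)"
    using fin by (intro sum.mono_neutral_right) (auto simp: D0_def D1_def moebius_def)
  also have "\<dots> = sum moebius D0 + sum moebius D1"
    using finD by (intro sum.union_disjoint) (auto simp: D0_def D1_def)
  also have "sum moebius D1 = (\<Sum>d\<in>D0. - moebius d)"
  proof (rule sum.reindex_bij_witness[where i = "\<lambda>d. q * d" and j = "\<lambda>d. d div q"])
    fix d assume d: "d \<in> D1"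
    then obtain e where e: "d = q * e" by (auto simp: D1_def)
    have "q > 0" using q(1) by (simp add: prime_gt_0_nat)
    have sq: "squarefree (q * e)" "q * e dvd n" using d e by (auto simp: D1_def)
    then have "\<not> q dvd e" using q(1) \<open>q > 0\<close>
      by (metis dvd_refl mult_dvd_mono not_prime_unit power2_eq_square squarefree_def)
    moreover have "squarefree e" "e dvd n" using sq squarefree_multD by (auto intro: dvd_mult_right)
    ultimately show "q * (d div q) = d" "d div q \<in> D0" using e \<open>q > 0\<close> by (auto simp: D0_def)
    have "e \<noteq> 0" using sq assms by auto
    then have "prime_factors (q * e) = insert q (prime_factors e)"
      using q(1) \<open>q > 0\<close> by (subst prime_factors_product) (auto simp: prime_factorization_prime)
    moreover have "q \<notin> prime_factors e" using \<open>\<not> q dvd e\<close> by auto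
    ultimately show "- moebius (d div q) = moebius d"
      using e \<open>q > 0\<close> sq \<open>squarefree e\<close> by (simp add: moebius_def)
  next
    fix d assume d: "d \<in> D0"
    have "q > 0" using q(1) by (simp add: prime_gt_0_nat)
    have cop: "coprime q d" using d q(1) by (auto simp: D0_def intro: prime_imp_coprime)
    then show "q * d div q = d" "q * d \<in> D1" using d q \<open>q > 0\<close>
      by (auto simp: D0_def D1_def intro: divides_mult squarefree_mult_coprime squarefree_prime)
  qed
  finally show ?thesis using False by (simp add: sum_negf)
qed (simp add: moebius_def)

text \<open>Moebius inversion of the fact that the logarithm is the divisor sum of
  \<open>mangoldt\<close>.\<close>

lemma sum_moebius_ln:
  assumes "k > 0" shows "(\<Sum>d | d dvd k. moebius d * ln (real (k div d))) = mangoldt k"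
proof -
  have fin: "finite {d. d dvd k}" using assms by simp
  have "(\<Sum>d | d dvd k. moebius d * ln (real (k div d))) = (\<Sum>d | d dvd k. \<Sum>e | e dvd k div d. moebius d * mangoldt e)"
  proof (intro sum.cong refl)
    fix d assume "d \<in> {d. d dvd k}"
    then have "k div d > 0" using assms by (auto elim!: dvdE)
    then show "moebius d * ln (real (k div d)) = (\<Sum>e | e dvd k div d. moebius d * mangoldt e)"
      using mangoldt_sum[of "k div d", where ?'a = real] by (simp flip: sum_distrib_left)
  qed
  also have "\<dots> = (\<Sum>(d, e)\<in>Sigma {d. d dvd k} (\<lambda>d. {e. e dvd k div d}). moebius d * mangoldt e)"
    using assms by (intro sum.Sigma) (auto elim!: dvdE)
  also have "Sigma {d. d dvd k} (\<lambda>d. {e. e dvd k div d}) = {(d, e). d * e dvd k}"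
    using assms by (auto elim!: dvdE simp: mult.assoc intro: dvd_mult_left)
  also have "(\<Sum>(d, e)\<in>{(d, e). d * e dvd k}. moebius d * mangoldt e) = (\<Sum>(e, d)\<in>{(d, e). d * e dvd k}. moebius d * mangoldt e)"
    by (rule sum.reindex_bij_witness[where i = prod.swap and j = prod.swap]) (auto simp: mult.commute)
  also have "{(d, e). d * e dvd k} = Sigma {d. d dvd k} (\<lambda>d. {e. e dvd k div d})"
    using assms by (auto elim!: dvdE simp: mult.assoc intro: dvd_mult_left)
  also have "(\<Sum>(e, d)\<in>Sigma {d. d dvd k} (\<lambda>d. {e. e dvd k div d}). moebius d * mangoldt e) = 
      (\<Sum>e | e dvd k. \<Sum>d | d dvd k div e. moebius d * mangoldt e)"
    using assms by (intro sum.Sigma[symmetric]) (auto elim!: dvdE)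
  also have "\<dots> = (\<Sum>e | e dvd k. if e = k then mangoldt e else 0)"
  proof (intro sum.cong refl)
    fix e assume "e \<in> {d. d dvd k}"
    then have e: "k div e > 0" "k div e = 1 \<longleftrightarrow> e = k" using assms by (auto elim!: dvdE)
    have "(\<Sum>d | d dvd k div e. moebius d * mangoldt e) = (\<Sum>d | d dvd k div e. moebius d) * mangoldt e"
      by (simp add: sum_distrib_right)
    then show "(\<Sum>d | d dvd k div e. moebius d * mangoldt e) = (if e = k then mangoldt e else 0)"
      using sum_moebius[OF e(1)] e(2) by simp
  qed
  also have "\<dots> = mangoldt k" using fin by (simp add: sum.delta)
  finally show ?thesis .
qed

text \<open>Summation by parts. The partial sums are taken relative to the one at \<open>a\<close>,
  hence bounded by \<open>2 * B\<close>, and the differences of the decreasing weights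
  telescope.\<close>

lemma abel_bound:
  fixes c :: "nat \<Rightarrow> complex" and f :: "nat \<Rightarrow> real"
  assumes c: "\<And>N. cmod (\<Sum>n\<in>{1..N}. c n) \<le> B"
    and dec: "\<And>n. n \<ge> a \<Longrightarrow> f (Suc n) \<le> f n" and nn: "\<And>n. n \<ge> a \<Longrightarrow> f n \<ge> 0" and a: "a \<ge> 1"
  shows "cmod (\<Sum>n\<in>{a..<b}. c n * of_real (f n)) \<le> 2 * B * f a"
proof (cases "a \<le> b")
  case True
  define C where "C N = (\<Sum>n\<in>{1..<N}. c n)" for N
  have C: "cmod (C N) \<le> B" for N
  proof (cases N)
    case (Suc M) then show ?thesis using c[of M] by (simp add: C_def atLeastLessThanSuc_atLeastAtMost)
  qed (use c[of 0] in \<open>simp add: C_def\<close>)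
  have CC: "cmod (C N - C a) \<le> 2 * B" for N
    using norm_triangle_ineq4[of "C N" "C a"] C[of N] C[of a] by linarith
  have "(\<Sum>n\<in>{a..<b}. c n * of_real (f n)) = (C b - C a) * of_real (f b) + (\<Sum>n\<in>{a..<b}. (C (Suc n) - C a) * of_real (f n - f (Suc n)))
    \<and> (\<Sum>n\<in>{a..<b}. f n - f (Suc n)) = f a - f b"
    using True
  proof (induction b rule: dec_induct)
    case (step n)
    have "C (Suc n) = C n + c n" using step a by (simp add: C_def)
    then show ?case using step by (simp add: algebra_simps)
  qed simp
  then have eq: "(\<Sum>n\<in>{a..<b}. c n * of_real (f n)) = (C b - C a) * of_real (f b) + (\<Sum>n\<in>{a..<b}. (C (Suc n) - C a) * of_real (f n - f (Suc n)))"
    and tel: "(\<Sum>n\<in>{a..<b}. f n - f (Suc n)) = f a - f b" by auto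
  have "cmod (\<Sum>n\<in>{a..<b}. (C (Suc n) - C a) * of_real (f n - f (Suc n))) \<le> (\<Sum>n\<in>{a..<b}. 2 * B * (f n - f (Suc n)))"
  proof (rule sum_norm_le)
    fix n assume "n \<in> {a..<b}"
    then have "f n - f (Suc n) \<ge> 0" using dec[of n] by simp
    then show "cmod ((C (Suc n) - C a) * of_real (f n - f (Suc n))) \<le> 2 * B * (f n - f (Suc n))"
      unfolding norm_mult using CC[of "Suc n"] by (simp add: mult_right_mono del: of_real_diff)
  qed
  also have "\<dots> = 2 * B * (f a - f b)" by (simp only: tel flip: sum_distrib_left)
  finally have "cmod (\<Sum>n\<in>{a..<b}. c n * of_real (f n)) \<le> cmod ((C b - C a) * of_real (f b)) + 2 * B * (f a - f b)"
    unfolding eq by (smt (verit) norm_triangle_ineq)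
  moreover have "cmod ((C b - C a) * of_real (f b)) \<le> 2 * B * f b"
    unfolding norm_mult using CC[of b] nn[of b] True by (simp add: mult_right_mono)
  ultimately show ?thesis by (simp add: algebra_simps)
next
  case False
  have "B \<ge> 0" using c[of 0] by simp
  then show ?thesis using False nn[of a] by simp
qed

text \<open>This isolates the analytic input on a nonprincipal character: bounded partial sums stand
  for periodicity together with the vanishing of the sum over a period.\<close>

locale nonprincipal =
  fixes chi :: "nat \<Rightarrow> complex" and B :: real
  assumes mult: "chi (a * b) = chi a * chi b" and one: "chi 1 = 1"
    and bnd: "cmod (chi n) \<le> 1" and psum: "cmod (\<Sum>n\<in>{1..N}. chi n) \<le> B"
begin

lemma B_nonneg: "B \<ge> 0" using psum[of 0] by simp

definition S where "S x = (\<Sum>n\<in>{1..x}. chi n / of_nat n)"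
definition L where "L = lim S"

lemma S_diff: assumes "x \<le> y" shows "cmod (S y - S x) \<le> 2 * B / real (x + 1)"
proof -
  have "{1..y} = {1..x} \<union> {x+1..<y+1}" using assms by auto
  then have "S y = S x + (\<Sum>n\<in>{x+1..<y+1}. chi n / of_nat n)"
    unfolding S_def by (simp only:) (rule sum.union_disjoint, auto)
  moreover have "cmod (\<Sum>n\<in>{x+1..<y+1}. chi n * of_real (1 / real n)) \<le> 2 * B * (1 / real (x+1))"
    by (rule abel_bound[OF psum]) (auto intro!: divide_left_mono)
  ultimately show ?thesis by simp
qed

lemma S_tendsto: "S \<longlonglongrightarrow> L"
proof -
  have "Cauchy S"
  proof (rule CauchyI)
    fix e :: real assume e: "e > 0"
    obtain M where M: "real M > 4 * B / e" using reals_Archimedean2 by blast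
    show "\<exists>M. \<forall>m\<ge>M. \<forall>n\<ge>M. norm (S m - S n) < e"
    proof (intro exI[of _ M] allI impI)
      fix m n assume mn: "M \<le> m" "M \<le> n"
      have "norm (S m - S n) \<le> norm (S m - S M) + norm (S n - S M)"
        using norm_triangle_ineq4[of "S m - S M" "S n - S M"] by simp
      also have "\<dots> \<le> 4 * B / real (M + 1)"
        using S_diff[OF mn(1)] S_diff[OF mn(2)] by simp
      also have "\<dots> < e"
      proof -
        have "4 * B / e < real (M + 1)" using M by simp
        then show ?thesis using e by (simp add: field_simps)
      qed
      finally show "norm (S m - S n) < e" .
    qed
  qed
  then show ?thesis unfolding L_def by (simp add: Cauchy_convergent convergent_LIMSEQ_iff[symmetric])
qed

lemma S_L: "cmod (S x - L) \<le> 2 * B / real (x + 1)"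
proof -
  have "(\<lambda>y. cmod (S x - S y)) \<longlonglongrightarrow> cmod (S x - L)"
    by (intro tendsto_intros S_tendsto)
  moreover have "eventually (\<lambda>y. cmod (S x - S y) \<le> 2 * B / real (x + 1)) sequentially"
    using eventually_ge_at_top[of x] by eventually_elim (metis S_diff norm_minus_commute)
  ultimately show ?thesis by (rule tendsto_upperbound) simp
qed

lemma S_L_div: assumes "d \<in> {1..x}" shows "cmod (S (x div d) - L) \<le> 2 * B * real d / real x"
proof -
  have "real x / real d \<le> real (x div d + 1)"
    using real_div_ge[of x d] by simp
  then have "2 * B / real (x div d + 1) \<le> 2 * B / (real x / real d)"
    using assms B_nonneg by (intro divide_left_mono mult_pos_pos) auto
  then show ?thesis using S_L[of "x div d"] by simp
qed

lemma chi_div: assumes "d dvd k" "k > 0" shows "chi d / of_nat d * (chi (k div d) / of_nat (k div d)) = chi k / of_nat k"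
proof -
  obtain e where "k = d * e" using assms by blast
  then show ?thesis using assms by (simp add: mult)
qed

definition T where "T x = (\<Sum>n\<in>{1..x}. chi n * of_real (mangoldt n / real n))"

text \<open>Abel summation with the weight \<open>ln n / n\<close>, which decreases only beyond
  \<open>e\<close>; the terms 1 and 2 are therefore split off.\<close>

lemma log_sum_bounded: "\<exists>C. \<forall>x. cmod (\<Sum>n\<in>{1..x}. chi n * of_real (ln (real n) / real n)) \<le> C"
proof (intro exI allI)
  fix x
  define F where "F n = chi n * of_real (ln (real n) / real n)" for n
  have dec: "ln (real (Suc n)) / real (Suc n) \<le> ln (real n) / real n" if "n \<ge> 3" for n
  proof (rule DERIV_nonpos_imp_nonincreasing[where f = "\<lambda>x. ln x / x"])
    fix x assume x: "real n \<le> x" "x \<le> real (Suc n)"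
    have "exp 1 < (3::real)" using e_less_272 by simp
    then have "ln x \<ge> 1" using x that by (subst ln_ge_iff) auto
    moreover have "((\<lambda>x. ln x / x) has_real_derivative (1 - ln x) / x^2) (at x)"
      using x that by (auto intro!: derivative_eq_intros simp: field_simps power2_eq_square)
    ultimately show "\<exists>y. ((\<lambda>x. ln x / x) has_real_derivative y) (at x) \<and> y \<le> 0"
      using x that by (intro exI[of _ "(1 - ln x) / x^2"]) (auto intro!: divide_nonpos_nonneg)
  qed simp
  have "cmod (\<Sum>n\<in>{3..<x+1}. F n) \<le> 2 * B * (ln (real 3) / real 3)"
    unfolding F_def by (rule abel_bound[where c = chi and f = "\<lambda>n. ln (real n) / real n", OF psum]) (use dec in auto)
  moreover have "cmod (\<Sum>n\<in>{1..x}. F n) \<le> cmod (\<Sum>n\<in>{3..<x+1}. F n) + cmod (F 1) + cmod (F 2)"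
  proof (cases "x < 3")
    case True
    then have "x = 0 \<or> x = 1 \<or> x = 2" by auto
    moreover have "{1..2::nat} = {1,2}" by auto
    ultimately show ?thesis using norm_triangle_ineq[of "F 1" "F 2"] by auto
  next
    case False
    then have "{1..x} = {1,2} \<union> {3..<x+1}" by auto
    then have "(\<Sum>n\<in>{1..x}. F n) = (\<Sum>n\<in>{1,2}. F n) + (\<Sum>n\<in>{3..<x+1}. F n)"
      by (simp only:) (rule sum.union_disjoint, auto)
    then have "(\<Sum>n\<in>{1..x}. F n) = (\<Sum>n\<in>{3..<x+1}. F n) + (F 1 + F 2)" by simp
    then show ?thesis using norm_triangle_ineq[of "\<Sum>n\<in>{3..<x+1}. F n" "F 1 + F 2"] norm_triangle_ineq[of "F 1" "F 2"] by simp
  qed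
  ultimately show "cmod (\<Sum>n\<in>{1..x}. chi n * of_real (ln (real n) / real n)) \<le> 2 * B * (ln (real 3) / real 3) + cmod (F 1) + cmod (F 2)"
    unfolding F_def by linarith
qed

text \<open>Mertens' device: expanding \<open>ln n\<close> as a divisor sum of
  \<open>mangoldt\<close> turns a bounded sum into \<open>T x * L\<close> plus an error. Replacing
  the inner partial sum by \<open>L\<close> costs a multiple of \<open>d / x\<close>, so
  \<open>psi_le\<close> bounds the error, and division by \<open>L\<close> finishes.\<close>

lemma T_bounded: assumes "L \<noteq> 0" shows "\<exists>C. \<forall>x. cmod (T x) \<le> C"
proof -
  obtain C where C: "\<And>x. cmod (\<Sum>n\<in>{1..x}. chi n * of_real (ln (real n) / real n)) \<le> C" using log_sum_bounded by blast
  have "cmod (T x) \<le> (C + 8 * B) / cmod L" for x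
  proof -
    have "(\<Sum>n\<in>{1..x}. chi n * of_real (ln (real n) / real n)) = (\<Sum>n\<in>{1..x}. \<Sum>d | d dvd n. (chi d * of_real (mangoldt d / real d)) * (chi (n div d) / of_nat (n div d)))"
    proof (intro sum.cong refl)
      fix n assume n: "n \<in> {1..x}"
      have "chi n * of_real (ln (real n) / real n) = (chi n / of_nat n) * (\<Sum>d | d dvd n. mangoldt d)"
        using mangoldt_sum[of n, where ?'a = complex] n by simp
      also have "\<dots> = (\<Sum>d | d dvd n. (chi n / of_nat n) * mangoldt d)"
        by (simp only: sum_distrib_left)
      also have "\<dots> = (\<Sum>d | d dvd n. (chi d * of_real (mangoldt d / real d)) * (chi (n div d) / of_nat (n div d)))"
        using n by (intro sum.cong refl) (simp add: chi_div[symmetric])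
      finally show "chi n * of_real (ln (real n) / real n) = \<dots>" .
    qed
    also have "\<dots> = (\<Sum>d\<in>{1..x}. \<Sum>e\<in>{1..x div d}. (chi d * of_real (mangoldt d / real d)) * (chi e / of_nat e))"
      by (rule sum_divisor_swap)
    also have "\<dots> = (\<Sum>d\<in>{1..x}. (chi d * of_real (mangoldt d / real d)) * S (x div d))"
      by (simp only: S_def sum_distrib_left)
    also have "\<dots> = T x * L + (\<Sum>d\<in>{1..x}. (chi d * of_real (mangoldt d / real d)) * (S (x div d) - L))"
      unfolding T_def sum_distrib_right sum.distrib[symmetric]
      by (intro sum.cong) (simp_all only: right_diff_distrib add_diff_cancel_left' diff_add_cancel add.commute[of _ "_ - _"])
    finally have eq: "T x * L = (\<Sum>n\<in>{1..x}. chi n * of_real (ln (real n) / real n)) - (\<Sum>d\<in>{1..x}. (chi d * of_real (mangoldt d / real d)) * (S (x div d) - L))"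
      by simp
    have "cmod (\<Sum>d\<in>{1..x}. (chi d * of_real (mangoldt d / real d)) * (S (x div d) - L)) \<le> (\<Sum>d\<in>{1..x}. mangoldt d * (2 * B / real x))"
    proof (rule sum_norm_le)
      fix d assume d: "d \<in> {1..x}"
      have "cmod ((chi d * of_real (mangoldt d / real d)) * (S (x div d) - L)) = cmod (chi d) * (mangoldt d / real d) * cmod (S (x div d) - L)"
        by (simp add: norm_mult norm_divide mangoldt_nonneg del: of_real_mangoldt)
      also have "\<dots> \<le> 1 * (mangoldt d / real d) * (2 * B * real d / real x)"
        using S_L_div[OF d] bnd[of d] B_nonneg by (intro mult_mono mult_nonneg_nonneg divide_nonneg_nonneg mangoldt_nonneg) auto
      also have "\<dots> = mangoldt d * (2 * B / real x)" using d by simp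
      finally show "cmod ((chi d * of_real (mangoldt d / real d)) * (S (x div d) - L)) \<le> mangoldt d * (2 * B / real x)" .
    qed
    also have "\<dots> = (\<Sum>d\<in>{1..x}. mangoldt d) * (2 * B / real x)" by (simp only: sum_distrib_right)
    also have "\<dots> \<le> 4 * real x * (2 * B / real x)"
      using psi_le[of x] B_nonneg by (intro mult_right_mono) auto
    also have "\<dots> \<le> 8 * B" using B_nonneg by (cases "x = 0") auto
    finally have "cmod (T x * L) \<le> C + 8 * B"
      unfolding eq using C[of x] norm_triangle_ineq4 by (smt (verit))
    then show ?thesis using assms by (simp add: norm_mult field_simps)
  qed
  then show ?thesis by blast
qed

text \<open>A vanishing \<open>L\<close> would make \<open>T\<close> behave like minus the
  logarithm. Expand \<open>mangoldt\<close> through Moebius weights times \<open>ln (x / d)\<close>;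
  the term at \<open>k = 1\<close> produces \<open>ln x\<close>. Since \<open>L = 0\<close>, the
  inner sums are themselves of size \<open>d / x\<close>, and the sum of all
  \<open>ln (x / d)\<close> is at most \<open>x\<close>.\<close>

lemma T_L_zero: assumes "L = 0" shows "\<exists>C. \<forall>x>0. cmod (T x + of_real (ln (real x))) \<le> C"
proof -
  have "cmod (T x + of_real (ln (real x))) \<le> 2 * B" if x: "x > 0" for x
  proof -
    have main: "(\<Sum>d | d dvd k. moebius d * ln (real x / real d)) = (if k = 1 then ln (real x) else 0) + mangoldt k" if k: "k \<in> {1..x}" for k
    proof -
      have "(\<Sum>d | d dvd k. moebius d * ln (real x / real d)) = (\<Sum>d | d dvd k. moebius d * ln (real x / real k) + moebius d * ln (real (k div d)))"
      proof (intro sum.cong refl)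
        fix d assume "d \<in> {d. d dvd k}"
        then obtain e where e: "k = d * e" by auto
        then have "d > 0" "e > 0" using k by (auto intro: Nat.gr0I)
        then show "moebius d * ln (real x / real d) = moebius d * ln (real x / real k) + moebius d * ln (real (k div d))"
          using x by (simp add: e ln_div ln_mult algebra_simps)
      qed
      also have "\<dots> = (\<Sum>d | d dvd k. moebius d) * ln (real x / real k) + mangoldt k"
        using k by (simp add: sum.distrib sum_distrib_right sum_moebius_ln)
      finally show ?thesis using k sum_moebius[of k] by auto
    qed
    have "T x + of_real (ln (real x)) = (\<Sum>k\<in>{1..x}. chi k / of_nat k * of_real ((if k = 1 then ln (real x) else 0) + mangoldt k))"
    proof -
      have "(\<Sum>k\<in>{1..x}. chi k / of_nat k * of_real (if k = 1 then ln (real x) else 0)) = (\<Sum>k\<in>{1..x}. if k = 1 then of_real (ln (real x)) else 0)"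
        by (intro sum.cong) (auto simp: one[simplified])
      also have "\<dots> = of_real (ln (real x))" using x by (simp add: sum.delta)
      finally show ?thesis unfolding T_def by (simp add: algebra_simps sum.distrib)
    qed
    also have "\<dots> = (\<Sum>k\<in>{1..x}. \<Sum>d | d dvd k. (chi d / of_nat d * of_real (moebius d * ln (real x / real d))) * (chi (k div d) / of_nat (k div d)))"
    proof (intro sum.cong refl)
      fix k assume k: "k \<in> {1..x}"
      have "chi k / of_nat k * of_real ((if k = 1 then ln (real x) else 0) + mangoldt k) = chi k / of_nat k * of_real (\<Sum>d | d dvd k. moebius d * ln (real x / real d))"
        by (simp only: main[OF k])
      also have "\<dots> = (\<Sum>d | d dvd k. chi k / of_nat k * of_real (moebius d * ln (real x / real d)))"
        by (simp only: of_real_sum sum_distrib_left)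
      also have "\<dots> = (\<Sum>d | d dvd k. (chi d / of_nat d * of_real (moebius d * ln (real x / real d))) * (chi (k div d) / of_nat (k div d)))"
        using k by (intro sum.cong refl) (simp add: chi_div[symmetric])
      finally show "chi k / of_nat k * of_real ((if k = 1 then ln (real x) else 0) + mangoldt k) = \<dots>" .
    qed
    also have "\<dots> = (\<Sum>d\<in>{1..x}. \<Sum>e\<in>{1..x div d}. (chi d / of_nat d * of_real (moebius d * ln (real x / real d))) * (chi e / of_nat e))"
      by (rule sum_divisor_swap)
    also have "\<dots> = (\<Sum>d\<in>{1..x}. (chi d / of_nat d * of_real (moebius d * ln (real x / real d))) * S (x div d))"
      by (simp only: S_def sum_distrib_left)
    also have "cmod \<dots> \<le> (\<Sum>d\<in>{1..x}. ln (real x / real d) * (2 * B / real x))"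
    proof (rule sum_norm_le)
      fix d assume d: "d \<in> {1..x}"
      have ln0: "ln (real x / real d) \<ge> 0" using d by (intro ln_ge_zero) auto
      have "cmod ((chi d / of_nat d * of_real (moebius d * ln (real x / real d))) * S (x div d)) = cmod (chi d) * (\<bar>moebius d\<bar> * (ln (real x / real d) / real d)) * cmod (S (x div d))"
        using ln0 by (simp add: norm_mult norm_divide abs_mult)
      also have "\<dots> \<le> 1 * (1 * (ln (real x / real d) / real d)) * (2 * B * real d / real x)"
        using S_L_div[OF d] bnd[of d] B_nonneg assms ln0
        by (intro mult_mono mult_nonneg_nonneg divide_nonneg_nonneg abs_moebius_le) auto
      also have "\<dots> = ln (real x / real d) * (2 * B / real x)" using d by simp
      finally show "cmod ((chi d / of_nat d * of_real (moebius d * ln (real x / real d))) * S (x div d)) \<le> ln (real x / real d) * (2 * B / real x)" .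
    qed
    also have "\<dots> = (\<Sum>d\<in>{1..x}. ln (real x / real d)) * (2 * B / real x)" by (simp only: sum_distrib_right)
    also have "(\<Sum>d\<in>{1..x}. ln (real x / real d)) = real x * ln (real x) - (\<Sum>d\<in>{1..x}. ln (real d))"
      using x by (simp add: ln_div sum_subtractf)
    also have "(\<Sum>d\<in>{1..x}. ln (real d)) = ln (fact x)"
      by (induction x) (simp_all add: ln_mult add.commute)
    also have "(real x * ln (real x) - ln (fact x)) * (2 * B / real x) \<le> real x * (2 * B / real x)"
      using ln_fact_ge[of x] B_nonneg by (intro mult_right_mono) auto
    finally show ?thesis using x by simp
  qed
  then show ?thesis by blast
qed

end

lemma less_lnI: "exp y < x \<Longrightarrow> y < ln (x::real)"
  by (metis exp_gt_zero exp_less_cancel_iff exp_ln less_trans)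

lemma divide_le_inverse: "(Q::real) > 0 \<Longrightarrow> P > 0 \<Longrightarrow> Q * a \<le> P \<Longrightarrow> a / P \<le> 1 / Q"
  by (simp add: field_simps)

text \<open>Pairing the exponents \<open>i\<close> and \<open>n - 1 - i\<close>, the arithmetic mean
  of the two powers is at least their geometric mean \<open>u ^ (n - 1)\<close>.\<close>

lemma sum_powers_ge:
  fixes u :: real assumes "u > 0" "n > 0"
  shows "(\<Sum>i<n. (u^2) ^ i) \<ge> real n * u ^ (n - 1)"
proof -
  have "2 * (\<Sum>i<n. (u^2) ^ i) = (\<Sum>i<n. (u^2) ^ i) + (\<Sum>i<n. (u^2) ^ (n - Suc i))"
    by (simp only: sum.nat_diff_reindex[of "\<lambda>i. (u^2) ^ i" n])
  also have "\<dots> = (\<Sum>i<n. (u^2) ^ i + (u^2) ^ (n - Suc i))" by (simp only: sum.distrib)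
  also have "\<dots> \<ge> (\<Sum>i<n. 2 * u ^ (n - 1))"
  proof (rule sum_mono)
    fix i assume i: "i \<in> {..<n}"
    have "0 \<le> (u ^ i - u ^ (n - Suc i))^2" by simp
    also have "\<dots> = (u^2) ^ i + (u^2) ^ (n - Suc i) - 2 * (u ^ i * u ^ (n - Suc i))"
      unfolding power2_diff power_mult[symmetric] by (simp add: mult.commute)
    also have "u ^ i * u ^ (n - Suc i) = u ^ (n - 1)" using i by (simp flip: power_add)
    finally show "2 * u ^ (n - 1) \<le> (u^2) ^ i + (u^2) ^ (n - Suc i)" by simp
  qed
  finally show ?thesis by simp
qed

text \<open>The weights of Monsky's proof that \<open>L(1, \<chi>)\<close> does not vanish for real \<open>\<chi>\<close>.\<close>

definition monsky :: "real \<Rightarrow> nat \<Rightarrow> real" where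
  "monsky t n = 1 / (real n * (1 - t)) - t ^ n / (1 - t ^ n)"

lemma monsky_eq:
  assumes "0 < t" "t < 1" "n > 0"
  shows "monsky t n = (1 / real n - t ^ n / (\<Sum>i<n. t ^ i)) / (1 - t)"
  using assms by (simp add: monsky_def one_diff_power_eq diff_divide_distrib mult.commute)

lemma monsky_nonneg:
  assumes "0 < t" "t < 1" "n > 0" shows "monsky t n \<ge> 0"
proof -
  have "(\<Sum>i<n. t ^ i) \<ge> (\<Sum>i<n. t ^ n)"
    using assms by (intro sum_mono power_decreasing) auto
  then have le: "real n * t ^ n \<le> (\<Sum>i<n. t ^ i)" by simp
  have "real n * t ^ n > 0" using assms by simp
  then have "(\<Sum>i<n. t ^ i) > 0" using le by linarith
  then have "t ^ n / (\<Sum>i<n. t ^ i) \<le> 1 / real n"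
    using assms le by (intro divide_le_inverse) auto
  then show ?thesis unfolding monsky_eq[OF assms] using assms by simp
qed

text \<open>With geometric sums \<open>s n\<close>, the inequality amounts to
  \<open>n * (n + 1) * t ^ n \<le> s n * s (n + 1)\<close>. The choice \<open>u = sqrt t\<close>
  allows both factors to be bounded by \<open>sum_powers_ge\<close>, and half a power of
  \<open>t\<close> is left over.\<close>

lemma monsky_Suc_le:
  assumes t: "0 < t" "t < 1" and n: "n > 0" shows "monsky t (Suc n) \<le> monsky t n"
proof -
  define u where "u = sqrt t"
  have u: "u > 0" "u < 1" "t = u^2" using t by (auto simp: u_def)
  define s where "s n = (\<Sum>i<n. t ^ i)" for n
  have s1: "s n \<ge> real n * u ^ (n - 1)" and s2: "s (Suc n) \<ge> real (Suc n) * u ^ n"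
    using sum_powers_ge[OF u(1) n] sum_powers_ge[OF u(1), of "Suc n"] by (auto simp: s_def u(3))
  have pos: "s n > 0" "s (Suc n) > 0"
    using s1 s2 u n by (smt (verit) mult_pos_pos of_nat_0_less_iff zero_less_power zero_less_Suc)+
  have "real n * real (Suc n) * t ^ n \<le> real n * real (Suc n) * (u ^ (n - 1) * u ^ n)"
  proof (intro mult_left_mono)
    have "t ^ n = u ^ (2 * n)" by (simp add: u(3) power_mult)
    also have "\<dots> \<le> u ^ ((n - 1) + n)" using u by (intro power_decreasing) auto
    finally show "t ^ n \<le> u ^ (n - 1) * u ^ n" by (simp add: power_add)
  qed auto
  also have "\<dots> = (real n * u ^ (n - 1)) * (real (Suc n) * u ^ n)" by simp
  also have "\<dots> \<le> s n * s (Suc n)"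
    using s1 s2 u pos by (intro mult_mono) auto
  finally have *: "t ^ n / (s n * s (Suc n)) \<le> 1 / (real n * real (Suc n))"
    using n pos by (intro divide_le_inverse) auto
  have rec: "s (Suc n) = 1 + t * s n"
    by (simp only: s_def sum.lessThan_Suc_shift sum_distrib_left) simp
  have "t ^ n / s n - t ^ Suc n / s (Suc n) = t ^ n * (s (Suc n) - t * s n) / (s n * s (Suc n))"
    using pos by (simp add: field_simps)
  also have "\<dots> = t ^ n / (s n * s (Suc n))" using rec by simp
  finally have "t ^ n / s n - t ^ Suc n / s (Suc n) \<le> 1 / real n - 1 / real (Suc n)"
    using * n by (simp add: field_simps)
  then have "1 / real (Suc n) - t ^ Suc n / s (Suc n) \<le> 1 / real n - t ^ n / s n" by simp
  then show ?thesis
    unfolding monsky_eq[OF t n] monsky_eq[OF t zero_less_Suc] s_def[symmetric]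
    using t by (intro divide_right_mono) auto
qed

context nonprincipal
begin

context
  assumes real_valued: "chi n \<in> {0, 1, - 1}"
begin

definition rho where "rho n = Re (chi n)"
text \<open>The Dirichlet coefficients of the product of the zeta function and the L-function of the
  real character.\<close>

definition c where "c n = (\<Sum>d | d dvd n. rho d)"

lemma chi_rho: "chi n = of_real (rho n)"
  using real_valued[of n] by (auto simp: rho_def)

lemma rho_values: "rho n \<in> {0, 1, - 1}"
  using real_valued[of n] by (auto simp: rho_def)

lemma rho_mult: "rho (a * b) = rho a * rho b"
proof -
  have "complex_of_real (rho (a * b)) = of_real (rho a * rho b)"
    using mult[of a b] by (simp add: chi_rho)
  then show ?thesis by (simp only: of_real_eq_iff)
qed

lemma rho_1: "rho (Suc 0) = 1" using one by (simp add: rho_def)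

lemma rho_power: "rho (q ^ i) = rho q ^ i"
  by (induction i) (simp_all add: rho_mult rho_1)

lemma c_mult: assumes "coprime a b" shows "c (a * b) = c a * c b"
proof -
  have "c a * c b = (\<Sum>(x, y)\<in>{x. x dvd a} \<times> {y. y dvd b}. rho (x * y))"
    by (simp add: c_def sum_product sum.cartesian_product rho_mult)
  also have "\<dots> = (\<Sum>d\<in>(\<lambda>(x, y). x * y) ` ({x. x dvd a} \<times> {y. y dvd b}). rho d)"
  proof (subst sum.reindex)
    show "inj_on (\<lambda>(x, y). x * y) ({x. x dvd a} \<times> {y. y dvd b})"
    proof (rule inj_onI, clarify)
      fix x y x' y' assume d: "x dvd a" "y dvd b" "x' dvd a" "y' dvd b" and eq: "x * y = x' * y'"
      have cop: "coprime x y'" "coprime x' y" "coprime y x'" "coprime y' x"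
        using assms d by (meson coprime_commute coprime_divisors)+
      have "x dvd x' * y'" "x' dvd x * y" "y dvd x' * y'" "y' dvd x * y" using eq by (metis dvd_triv_left dvd_triv_right)+
      then have "x dvd x'" "x' dvd x" "y dvd y'" "y' dvd y"
        using cop by (simp_all add: coprime_dvd_mult_left_iff coprime_dvd_mult_right_iff)
      then show "x = x' \<and> y = y'" by (simp add: dvd_antisym)
    qed
  qed (simp add: case_prod_unfold comp_def)
  also have "(\<lambda>(x, y). x * y) ` ({x. x dvd a} \<times> {y. y dvd b}) = {d. d dvd a * b}"
  proof (intro equalityI subsetI)
    fix d assume "d \<in> {d. d dvd a * b}"
    then obtain x y where "d = x * y" "x dvd a" "y dvd b" using division_decomp[of d a b] by auto
    then show "d \<in> (\<lambda>(x, y). x * y) ` ({x. x dvd a} \<times> {y. y dvd b})" by force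
  qed (auto intro: mult_dvd_mono)
  finally show ?thesis by (simp add: c_def)
qed

lemma c_prime_power: assumes "Factorial_Ring.prime q" shows "c (q ^ e) = (\<Sum>i\<le>e. rho q ^ i)"
proof -
  have "{d. d dvd q ^ e} = (\<lambda>i. q ^ i) ` {..e}"
    using divides_primepow_nat[OF assms] by auto
  moreover have "inj_on (\<lambda>i. q ^ i) {..e}"
    using prime_gt_1_nat[OF assms] by (auto intro!: inj_onI simp: power_inject_exp)
  ultimately show ?thesis by (simp add: c_def sum.reindex rho_power)
qed

lemma c_prime_power_bounds: assumes "Factorial_Ring.prime q" shows "c (q ^ e) \<ge> 0" "c (q ^ (2 * e)) \<ge> 1"
proof -
  have *: "(\<Sum>i\<le>e. (-1::real) ^ i) = (if even e then 1 else 0)" for e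
    by (induction e) auto
  have "(\<Sum>i\<le>e. (0::real) ^ i) = 1" for e
    by (induction e) auto
  then show "c (q ^ e) \<ge> 0" "c (q ^ (2 * e)) \<ge> 1"
    using rho_values[of q] by (auto simp: c_prime_power[OF assms] *)
qed

text \<open>By multiplicativity only prime powers matter. There the value is a geometric sum with
  ratio 0, 1 or -1, which is nonnegative and at least 1 when the exponent is even.\<close>

lemma c_bounds: assumes "n > 0" shows "c n \<ge> 0 \<and> c (n^2) \<ge> 1"
  using assms
proof (induction n rule: less_induct)
  case (less n)
  show ?case
  proof (cases "n = 1")
    case False
    then obtain q where q: "Factorial_Ring.prime q" "q dvd n" using prime_factor_nat by blast
    obtain y where y: "n = q ^ multiplicity q n * y" "\<not> q dvd y"
      by (rule multiplicity_decompose'[of n q]) (use less.prems q(1) not_prime_unit in auto)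
    define e where "e = multiplicity q n"
    have e: "e > 0" using q less.prems by (simp add: e_def prime_multiplicity_gt_zero_iff)
    have y0: "y > 0" using y(1) less.prems by (cases y) auto
    have "q ^ e > 1" using one_less_power[OF prime_gt_1_nat[OF q(1)] e] .
    then have "1 * y < q ^ e * y" using y0 by (rule mult_strict_right_mono)
    moreover have ny: "n = q ^ e * y" using y(1) unfolding e_def .
    ultimately have "y < n" by simp
    then have IH: "c y \<ge> 0" "c (y^2) \<ge> 1" using less.IH y0 by auto
    have cop: "coprime (q ^ k) y" for k using q y(2) by (simp add: prime_imp_coprime)
    have "c n = c (q ^ e) * c y" unfolding ny by (rule c_mult[OF cop])
    moreover have "c (n^2) = c (q ^ (2 * e)) * c (y^2)"
    proof -
      have "n^2 = q ^ (2 * e) * y^2" unfolding ny by (simp add: power_mult_distrib power_mult[symmetric] mult.commute)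
      then show ?thesis using c_mult[of "q ^ (2*e)" "y^2"] cop[of "2 * e"] by simp
    qed
    moreover have "1 * 1 \<le> c (q ^ (2 * e)) * c (y^2)"
      using IH c_prime_power_bounds[OF q(1), of e] by (intro mult_mono) auto
    ultimately show ?thesis using IH c_prime_power_bounds[OF q(1), of e] by simp
  qed (simp add: c_def rho_1)
qed

text \<open>The power series with coefficients \<open>c\<close> is estimated near
  \<open>t = 1\<close> in two ways. Its terms at squares alone make it exceed every bound, while
  \<open>L = 0\<close> and Monsky's decreasing weights keep it below \<open>2 * B\<close>.\<close>

lemma L_nonzero_real: "L \<noteq> 0"
proof
  assume L: "L = 0"
  \<comment> \<open>Everything is truncated at \<open>N\<close>; the last two terms are the cost of
    truncation and tend to 0 for fixed \<open>t\<close>. The first of them comes from replacing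
    \<open>L\<close> by its partial sum, the second from cutting off geometric series.\<close>
  have key: "(\<Sum>l\<in>{1..N}. c l * t ^ l) \<le> 2 * B + 2 * B / (real (N + 1) * (1 - t)) + real N * t ^ N / (1 - t)"
    if t: "0 < t" "t < 1" for t N
  proof -
    define D where "D = (\<Sum>l\<in>{1..N}. c l * t ^ l)"
    define A where "A = (\<Sum>n\<in>{1..N}. rho n * (t ^ n / (1 - t ^ n)))"
    have "D = (\<Sum>l\<in>{1..N}. \<Sum>d | d dvd l. rho d * t ^ (d * (l div d)))"
      unfolding D_def c_def sum_distrib_right by (intro sum.cong refl) auto
    also have "\<dots> = (\<Sum>d\<in>{1..N}. \<Sum>e\<in>{1..N div d}. rho d * t ^ (d * e))"
      by (rule sum_divisor_swap)
    finally have D: "D = (\<Sum>d\<in>{1..N}. rho d * (\<Sum>e\<in>{1..N div d}. t ^ (d * e)))" by (simp only: sum_distrib_left)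
    have geo: "\<bar>rho d * (\<Sum>e\<in>{1..N div d}. t ^ (d * e)) - rho d * (t ^ d / (1 - t ^ d))\<bar> \<le> t ^ N / (1 - t)" if d: "d \<in> {1..N}" for d
    proof -
      define K where "K = N div d"
      have td: "0 < t ^ d" "t ^ d < 1" "t ^ d \<le> t"
        using t d power_decreasing[of 1 d t] by (auto simp: power_less_one_iff)
      have "(1 - t ^ d) * (\<Sum>e\<in>{1..K}. (t ^ d) ^ e) = t ^ d - (t ^ d) ^ Suc K"
      proof (induction K)
        case (Suc K)
        have "(1 - t ^ d) * (\<Sum>e\<in>{1..Suc K}. (t ^ d) ^ e) = (1 - t ^ d) * (\<Sum>e\<in>{1..K}. (t ^ d) ^ e) + (1 - t ^ d) * (t ^ d) ^ Suc K"
          by (simp add: distrib_left)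
        also have "\<dots> = t ^ d - (t ^ d) ^ Suc (Suc K)" by (simp only: Suc.IH) (simp add: algebra_simps)
        finally show ?case .
      qed simp
      then have "(\<Sum>e\<in>{1..K}. (t ^ d) ^ e) = (t ^ d - (t ^ d) ^ Suc K) / (1 - t ^ d)"
        using td by (simp add: field_simps)
      then have eq: "(\<Sum>e\<in>{1..K}. t ^ (d * e)) - t ^ d / (1 - t ^ d) = - ((t ^ d) ^ Suc K / (1 - t ^ d))"
        by (simp add: power_mult diff_divide_distrib)
      have "N \<le> d * Suc K" using d dividend_less_times_div[of d N] by (simp add: K_def)
      then have "(t ^ d) ^ Suc K \<le> t ^ N" unfolding power_mult[symmetric] using t by (intro power_decreasing) auto
      then have "(t ^ d) ^ Suc K / (1 - t ^ d) \<le> t ^ N / (1 - t)"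
        using td t by (intro frac_le) auto
      moreover have "\<bar>rho d\<bar> \<le> 1" using rho_values[of d] by auto
      moreover have "(t ^ d) ^ Suc K / (1 - t ^ d) \<ge> 0" using td by simp
      ultimately have "\<bar>rho d\<bar> * \<bar>(t ^ d) ^ Suc K / (1 - t ^ d)\<bar> \<le> 1 * (t ^ N / (1 - t))"
        by (intro mult_mono) (simp_all only: abs_of_nonneg abs_ge_zero zero_le_one)
      then have "\<bar>rho d * ((\<Sum>e\<in>{1..K}. t ^ (d * e)) - t ^ d / (1 - t ^ d))\<bar> \<le> t ^ N / (1 - t)"
        unfolding eq abs_mult by simp
      then show ?thesis by (simp only: K_def right_diff_distrib)
    qed
    have "\<bar>D - A\<bar> \<le> (\<Sum>d\<in>{1..N}. t ^ N / (1 - t))"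
      unfolding D A_def sum_subtractf[symmetric]
      by (rule order_trans[OF sum_abs sum_mono[OF geo]])
    then have DA: "D \<le> A + real N * (t ^ N / (1 - t))" by simp
    have "cmod (\<Sum>n\<in>{1..<N+1}. chi n * of_real (monsky t n)) \<le> 2 * B * monsky t 1"
      using t by (intro abel_bound psum monsky_Suc_le monsky_nonneg) auto
    moreover have "monsky t 1 = 1" using t by (simp add: monsky_def field_simps)
    moreover have "(\<Sum>n\<in>{1..<N+1}. chi n * of_real (monsky t n)) = of_real (\<Sum>n\<in>{1..N}. rho n * monsky t n)"
      by (simp add: chi_rho atLeastLessThanSuc_atLeastAtMost)
    ultimately have m1: "\<bar>\<Sum>n\<in>{1..N}. rho n * monsky t n\<bar> \<le> 2 * B" by (simp only: norm_of_real mult_1_right)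
    have "S N = of_real (\<Sum>n\<in>{1..N}. rho n / real n)" by (simp add: S_def chi_rho)
    then have m2: "\<bar>\<Sum>n\<in>{1..N}. rho n / real n\<bar> \<le> 2 * B / real (N + 1)"
      using S_L[of N] L by (simp only: diff_zero norm_of_real)
    have "A = (\<Sum>n\<in>{1..N}. rho n / real n) / (1 - t) - (\<Sum>n\<in>{1..N}. rho n * monsky t n)"
      unfolding A_def monsky_def sum_divide_distrib sum_subtractf[symmetric]
      by (intro sum.cong) (auto simp: algebra_simps)
    also have "\<dots> \<le> (2 * B / real (N + 1)) / (1 - t) + 2 * B"
    proof -
      have "(\<Sum>n\<in>{1..N}. rho n / real n) / (1 - t) \<le> (2 * B / real (N + 1)) / (1 - t)"
        using m2 t by (intro divide_right_mono) auto
      then show ?thesis using m1 by linarith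
    qed
    finally show ?thesis using DA by (simp add: D_def)
  qed
  have bound: "(\<Sum>k\<in>{1..K}. t ^ (k^2)) \<le> 2 * B" if t: "0 < t" "t < 1" for t :: real and K :: nat
  proof -
    have lower: "(\<Sum>k\<in>{1..K}. t ^ (k^2)) \<le> (\<Sum>l\<in>{1..N}. c l * t ^ l)" if N: "N \<ge> K^2" for N
    proof -
      have "(\<Sum>k\<in>{1..K}. t ^ (k^2)) = (\<Sum>l\<in>(\<lambda>k. k^2) ` {1..K}. t ^ l)"
        by (subst sum.reindex) (auto intro!: inj_onI)
      also have "\<dots> \<le> (\<Sum>l\<in>(\<lambda>k. k^2) ` {1..K}. c l * t ^ l)"
      proof (rule sum_mono)
        fix l assume "l \<in> (\<lambda>k. k^2) ` {1..K}"
        then have "c l \<ge> 1" using c_bounds by auto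
        then show "t ^ l \<le> c l * t ^ l" using t by simp
      qed
      also have "\<dots> \<le> (\<Sum>l\<in>{1..N}. c l * t ^ l)"
      proof (rule sum_mono2)
        show "(\<lambda>k. k^2) ` {1..K} \<subseteq> {1..N}"
        proof
          fix l assume "l \<in> (\<lambda>k. k^2) ` {1..K}"
          then obtain k where k: "l = k^2" "1 \<le> k" "k \<le> K" by auto
          then have "k^2 \<le> K^2" "k^2 > 0" by (auto intro: power_mono)
          then have "k^2 \<le> N" "k^2 > 0" using N le_trans by blast+
          then show "l \<in> {1..N}" using k by (simp add: Suc_le_eq)
        qed
      qed (use c_bounds t in auto)
      finally show ?thesis .
    qed
    have "(\<lambda>N. 2 * B + 2 * B / (real (N + 1) * (1 - t)) + real N * t ^ N / (1 - t)) \<longlonglongrightarrow> 2 * B + 0 + 0 / (1 - t)"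
    proof (intro tendsto_intros)
      show "(\<lambda>N. real N * t ^ N) \<longlonglongrightarrow> 0" using powser_times_n_limit_0[of t] t by simp
      have "(\<lambda>N. (2 * B / (1 - t)) * (1 / real (Suc N))) \<longlonglongrightarrow> (2 * B / (1 - t)) * 0"
        by (intro tendsto_intros LIMSEQ_Suc[OF lim_1_over_n])
      then show "(\<lambda>N. 2 * B / (real (N + 1) * (1 - t))) \<longlonglongrightarrow> 0"
        by (simp add: mult.commute)
    qed (use t in auto)
    moreover have "eventually (\<lambda>N. (\<Sum>k\<in>{1..K}. t ^ (k^2)) \<le> 2 * B + 2 * B / (real (N + 1) * (1 - t)) + real N * t ^ N / (1 - t)) sequentially"
      using eventually_ge_at_top[of "K^2"] by eventually_elim (rule order_trans[OF lower key[OF t]])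
    ultimately show ?thesis using tendsto_lowerbound by fastforce
  qed
  obtain K :: nat where K: "real K > 2 * B" using reals_Archimedean2 by blast
  have "((\<lambda>t. \<Sum>k\<in>{1..K}. t ^ (k^2)) \<longlongrightarrow> (\<Sum>k\<in>{1..K}. 1 ^ (k^2))) (at_left (1::real))"
    by (intro tendsto_intros)
  moreover have "eventually (\<lambda>t. (\<Sum>k\<in>{1..K}. t ^ (k^2)) \<le> 2 * B) (at_left (1::real))"
  proof (rule eventually_mono[OF eventually_at_left_real[of 0 "1::real"]])
    fix t :: real assume "t \<in> {0<..<1}"
    then show "(\<Sum>k\<in>{1..K}. t ^ (k^2)) \<le> 2 * B" by (intro bound) auto
  qed simp
  ultimately have "(\<Sum>k\<in>{1..K}. (1::real) ^ (k^2)) \<le> 2 * B"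
    by (rule tendsto_upperbound) simp
  then show False using K by simp
qed

end

end

section \<open>Characters modulo a prime and the nonvanishing of their L-values\<close>

locale prime_modulus =
  fixes p g :: nat
  assumes p: "Factorial_Ring.prime p" "p > 2" and g: "residue_primroot p g"
begin

definition m where "m = p - 1"
definition zeta :: complex where "zeta = exp (2 * of_real pi * \<i> / of_nat m)"
text \<open>The discrete logarithm to base \<open>g\<close> modulo \<open>p\<close>. Through it all
  characters modulo \<open>p\<close> are explicit: they are indexed by \<open>j < m\<close>, and
  \<open>j = 0\<close> is the principal one.\<close>

definition ind where "ind n = inv_into {..<m} (\<lambda>i. g ^ i mod p) (n mod p)"
definition chi where "chi j n = (if p dvd n then 0 else zeta ^ (j * ind n))"

lemma m_pos: "m > 0" "m > 1" "totient p = m" using p by (auto simp: m_def totient_prime)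

lemma bij: "bij_betw (\<lambda>i. g ^ i mod p) {..<m} (totatives p)"
  using residue_primroot_is_generator[of p g] p g m_pos by simp

lemma totatives_p: "n mod p \<in> totatives p \<longleftrightarrow> \<not> p dvd n"
proof -
  have "n mod p < p" using p by simp
  then have "coprime (n mod p) p \<longleftrightarrow> \<not> p dvd n"
    by (metis coprime_commute coprime_mod_left_iff p(1) prime_imp_coprime coprime_absorb_left not_prime_unit gr_implies_not_zero)
  then show ?thesis using p by (auto simp: in_totatives_iff mod_greater_zero_iff_not_dvd less_imp_le)
qed

lemma ind: assumes "\<not> p dvd n" shows "ind n < m" "[g ^ ind n = n] (mod p)"
proof -
  have *: "n mod p \<in> (\<lambda>i. g ^ i mod p) ` {..<m}"
    using bij totatives_p assms by (simp add: bij_betw_def)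
  then show "ind n < m" "[g ^ ind n = n] (mod p)"
    unfolding ind_def cong_def using inv_into_into[OF *] f_inv_into_f[OF *] by simp_all
qed

lemma coprime_g: "coprime p g" using g by (auto simp: residue_primroot_def)

lemma g_cong: "[g ^ a = g ^ b] (mod p) \<longleftrightarrow> [a = b] (mod m)"
  using order_divides_expdiff[OF coprime_g, of a b] g m_pos by (simp add: residue_primroot_def)

lemma zeta_eq_1: "zeta ^ a = 1 \<longleftrightarrow> m dvd a"
  using complex_root_unity_eq_1[of m a] m_pos by (simp add: zeta_def exp_of_nat_mult[symmetric] mult_ac)

lemma zeta_cong: assumes "[a = b] (mod m)" shows "zeta ^ a = zeta ^ b"
proof -
  have *: "zeta ^ a = zeta ^ (a mod m)" for a
  proof -
    have "zeta ^ a = zeta ^ (m * (a div m) + a mod m)" by simp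
    also have "\<dots> = zeta ^ (a mod m)" using zeta_eq_1[of m] by (simp only: power_add power_mult dvd_refl simp_thms power_one mult_1_left)
    finally show ?thesis .
  qed
  show ?thesis using *[of a] *[of b] assms by (simp add: cong_def)
qed

lemma norm_zeta: "norm zeta = 1"
  unfolding zeta_def by (simp add: norm_exp_eq_Re)

lemma ind_mult: assumes "\<not> p dvd a" "\<not> p dvd b" shows "[ind (a * b) = ind a + ind b] (mod m)"
proof -
  have ab: "\<not> p dvd a * b" using assms p(1) by (simp add: prime_dvd_mult_iff)
  have "[g ^ (ind a + ind b) = a * b] (mod p)"
    unfolding power_add using ind(2)[OF assms(1)] ind(2)[OF assms(2)] by (rule cong_mult)
  then have "[g ^ ind (a * b) = g ^ (ind a + ind b)] (mod p)"
    using ind(2)[OF ab] by (metis cong_sym cong_trans)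
  then show ?thesis by (simp only: g_cong)
qed

lemma chi_mult: "chi j (a * b) = chi j a * chi j b"
proof (cases "p dvd a \<or> p dvd b")
  case False
  then have "\<not> p dvd a * b" using p(1) by (simp add: prime_dvd_mult_iff)
  moreover have "[j * ind (a * b) = j * ind a + j * ind b] (mod m)"
    using cong_scalar_left[OF ind_mult, of a b j] False by (simp add: distrib_left)
  ultimately show ?thesis using False zeta_cong by (simp add: chi_def power_add[symmetric])
qed (auto simp: chi_def)

lemma chi_period: "chi j (p + n) = chi j n"
proof -
  have "p dvd p + n \<longleftrightarrow> p dvd n" by simp
  moreover have "ind (p + n) = ind n" by (simp add: ind_def)
  ultimately show ?thesis by (simp add: chi_def)
qed

lemma chi_one: "chi j 1 = 1"
proof -
  have "\<not> p dvd 1" using p by auto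
  moreover have "ind 1 = 0"
  proof -
    have "[g ^ ind 1 = g ^ 0] (mod p)" using ind(2)[of 1] p by auto
    then have "[ind 1 = 0] (mod m)" by (simp only: g_cong)
    moreover have "ind 1 < m" using ind(1)[of 1] p by auto
    ultimately show ?thesis by (simp add: cong_def)
  qed
  ultimately show ?thesis by (simp add: chi_def)
qed

lemma norm_chi: "cmod (chi j n) \<le> 1"
  by (simp add: chi_def norm_power norm_zeta)

lemma sum_period: assumes j: "\<not> m dvd j" shows "(\<Sum>n<p. chi j n) = 0"
proof -
  have "(\<Sum>n<p. chi j n) = (\<Sum>n\<in>totatives p. chi j n)"
  proof (rule sum.mono_neutral_right)
    show "totatives p \<subseteq> {..<p}" using totatives_less[of _ p] p by auto
    show "\<forall>i\<in>{..<p} - totatives p. chi j i = 0"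
    proof
      fix i assume "i \<in> {..<p} - totatives p"
      then show "chi j i = 0" using totatives_p[of i] by (auto simp: chi_def)
    qed
  qed auto
  also have "\<dots> = (\<Sum>i<m. chi j (g ^ i mod p))" using sum.reindex_bij_betw[OF bij] by metis
  also have "\<dots> = (\<Sum>i<m. (zeta ^ j) ^ i)"
  proof (intro sum.cong refl)
    fix i assume "i \<in> {..<m}"
    have nd: "\<not> p dvd g ^ i mod p"
      using coprime_g p(1) by (metis coprime_power_right_iff dvd_mod_iff dvd_refl coprime_absorb_left not_prime_unit)
    have "[g ^ ind (g ^ i mod p) = g ^ i] (mod p)" using ind(2)[OF nd] by (simp add: cong_def)
    then have "[ind (g ^ i mod p) = i] (mod m)" by (simp only: g_cong)
    then have "[j * ind (g ^ i mod p) = j * i] (mod m)" by (rule cong_scalar_left)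
    then have "zeta ^ (j * ind (g ^ i mod p)) = zeta ^ (j * i)" by (rule zeta_cong)
    then show "chi j (g ^ i mod p) = (zeta ^ j) ^ i" using nd by (simp only: chi_def if_False power_mult)
  qed
  also have "\<dots> = 0"
  proof -
    have "zeta ^ j \<noteq> 1" "(zeta ^ j) ^ m = 1" using j by (auto simp: zeta_eq_1 simp flip: power_mult)
    then show ?thesis by (simp add: geometric_sum)
  qed
  finally show ?thesis .
qed

lemma nonprincipal_chi: assumes j: "\<not> m dvd j" shows "nonprincipal (chi j) (real p)"
proof
  fix N
  have shift: "(\<Sum>n<p + r. chi j n) = (\<Sum>n<r. chi j n)" for r
    by (induction r) (simp_all add: sum_period[OF j] chi_period)
  have "cmod (\<Sum>n<r. chi j n) \<le> real p" for r
  proof (induction r rule: less_induct)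
    case (less r)
    show ?case
    proof (cases "r < p")
      case True
      have "cmod (\<Sum>n<r. chi j n) \<le> (\<Sum>n<r. 1)" by (rule sum_norm_le) (rule norm_chi)
      then show ?thesis using True by simp
    next
      case False
      then obtain r' where "r = p + r'" using le_Suc_ex not_less by blast
      moreover have "r' < r" using calculation p by simp
      ultimately show ?thesis using less.IH[of r'] shift by simp
    qed
  qed
  moreover have "(\<Sum>n<Suc N. chi j n) = (\<Sum>n\<in>{1..N}. chi j n)"
  proof (rule sum.mono_neutral_right)
    show "\<forall>i\<in>{..<Suc N} - {1..N}. chi j i = 0"
    proof
      fix i assume "i \<in> {..<Suc N} - {1..N}"
      then have "i = 0" by auto
      then show "chi j i = 0" by (simp add: chi_def)
    qed
  qed auto
  ultimately show "cmod (\<Sum>n\<in>{1..N}. chi j n) \<le> real p" by metis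
qed (use chi_mult chi_one norm_chi in auto)

definition TT where "TT j x = (\<Sum>n\<in>{1..x}. chi j n * of_real (mangoldt n / real n))"

lemma TT_eq: "\<not> m dvd j \<Longrightarrow> TT j = nonprincipal.T (chi j)"
  using nonprincipal.T_def[OF nonprincipal_chi] by (auto simp: TT_def fun_eq_iff)

text \<open>The exponent \<open>j * (m - a)\<close> is a natural number representing the inverse of
  the value of the character at \<open>g ^ a\<close>.\<close>

lemma orthogonality:
  assumes "a < m"
  shows "(\<Sum>j<m. zeta ^ (j * (m - a)) * chi j n) = (if [n = g ^ a] (mod p) then of_nat m else 0)"
proof (cases "p dvd n")
  case True
  have "\<not> [n = g ^ a] (mod p)"
    using True coprime_g p(1) by (metis cong_dvd_iff coprime_power_right_iff coprime_absorb_left not_prime_unit dvd_refl cong_0_iff cong_sym cong_trans)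
  then show ?thesis using True by (simp add: chi_def)
next
  case False
  define b where "b = (m - a) + ind n"
  have "(\<Sum>j<m. zeta ^ (j * (m - a)) * chi j n) = (\<Sum>j<m. (zeta ^ b) ^ j)"
    using False by (simp add: chi_def b_def power_add[symmetric] power_mult[symmetric] distrib_left mult.commute distrib_right)
  also have "\<dots> = (if m dvd b then of_nat m else 0)"
  proof (cases "m dvd b")
    case True
    then have "zeta ^ b = 1" by (simp add: zeta_eq_1)
    then show ?thesis using True by simp
  next
    case nd: False
    have "zeta ^ b \<noteq> 1" "(zeta ^ b) ^ m = 1" using nd by (auto simp: zeta_eq_1 simp flip: power_mult)
    then show ?thesis using nd by (simp add: geometric_sum)
  qed
  also have "m dvd b \<longleftrightarrow> ind n = a"
  proof
    assume "m dvd b"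
    moreover have "b > 0" "b < 2 * m" using assms ind(1)[OF False] by (auto simp: b_def)
    ultimately have "b = m" by (auto elim!: dvdE)
    then show "ind n = a" using assms by (simp add: b_def)
  qed (use assms in \<open>simp add: b_def\<close>)
  also have "ind n = a \<longleftrightarrow> [n = g ^ a] (mod p)"
  proof
    assume "[n = g ^ a] (mod p)"
    then have "[g ^ ind n = g ^ a] (mod p)" using ind(2)[OF False] cong_trans by blast
    then have "[ind n = a] (mod m)" by (simp only: g_cong)
    then show "ind n = a" using assms ind(1)[OF False] by (simp add: cong_def)
  qed (use ind(2)[OF False] cong_sym in auto)
  finally show ?thesis .
qed

lemma TT_sum:
  assumes "a < m"
  shows "(\<Sum>j<m. zeta ^ (j * (m - a)) * TT j x) = of_real (real m * (\<Sum>n | n \<in> {1..x} \<and> [n = g ^ a] (mod p). mangoldt n / real n))"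
proof -
  have "(\<Sum>j<m. zeta ^ (j * (m - a)) * TT j x) = (\<Sum>j<m. \<Sum>n\<in>{1..x}. (zeta ^ (j * (m - a)) * chi j n) * of_real (mangoldt n / real n))"
    by (simp only: TT_def sum_distrib_left mult.assoc)
  also have "\<dots> = (\<Sum>n\<in>{1..x}. (\<Sum>j<m. zeta ^ (j * (m - a)) * chi j n) * of_real (mangoldt n / real n))"
    unfolding sum_distrib_right by (rule sum.swap)
  also have "\<dots> = (\<Sum>n\<in>{1..x}. if [n = g ^ a] (mod p) then of_real (real m * (mangoldt n / real n)) else 0)"
    by (intro sum.cong refl) (simp add: orthogonality[OF assms] del: of_real_mangoldt)
  also have "\<dots> = (\<Sum>n\<in>{n. n \<in> {1..x} \<and> [n = g ^ a] (mod p)}. of_real (real m * (mangoldt n / real n)))"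
    by (simp add: sum.inter_filter[symmetric] del: of_real_mangoldt)
  finally show ?thesis by (simp add: sum_distrib_left)
qed

text \<open>The prime powers of \<open>p\<close> contribute only \<open>O(1)\<close>.\<close>

lemma TT_0: "\<exists>C. \<forall>x. \<exists>r. TT 0 x = of_real r \<and> r \<le> (\<Sum>n\<in>{1..x}. mangoldt n / real n) \<and> r \<ge> (\<Sum>n\<in>{1..x}. mangoldt n / real n) - C"
proof (rule exI[of _ "2 * ln (real p)"], rule allI)
  fix x
  define r where "r = (\<Sum>n\<in>{n\<in>{1..x}. \<not> p dvd n}. mangoldt n / real n)"
  have "TT 0 x = (\<Sum>n\<in>{1..x}. if \<not> p dvd n then of_real (mangoldt n / real n) else 0)"
    unfolding TT_def chi_def by (intro sum.cong) auto
  also have "\<dots> = of_real r" unfolding r_def of_real_sum by (intro sum.inter_filter[symmetric]) auto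
  finally have 1: "TT 0 x = of_real r" .
  have split: "(\<Sum>n\<in>{1..x}. mangoldt n / real n) = r + (\<Sum>n\<in>{n\<in>{1..x}. p dvd n}. mangoldt n / real n)"
    unfolding r_def by (subst sum.union_disjoint[symmetric]) (auto intro!: sum.cong)
  have nn: "(\<Sum>n\<in>{n\<in>{1..x}. p dvd n}. mangoldt n / real n) \<ge> 0"
    by (intro sum_nonneg divide_nonneg_nonneg mangoldt_nonneg) auto
  have "(\<Sum>n\<in>{n\<in>{1..x}. p dvd n}. mangoldt n / real n) \<le> (\<Sum>n\<in>(\<lambda>k. p ^ k) ` {1..x}. mangoldt n / real n)"
  proof -
    have "(\<Sum>n\<in>{n\<in>{1..x}. p dvd n}. mangoldt n / real n) = (\<Sum>n\<in>{n\<in>{1..x}. p dvd n \<and> primepow n}. mangoldt n / real n)"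
      by (intro sum.mono_neutral_right) (auto simp: mangoldt_def)
    also have "\<dots> \<le> (\<Sum>n\<in>(\<lambda>k. p ^ k) ` {1..x}. mangoldt n / real n)"
    proof (rule sum_mono2)
      show "{n \<in> {1..x}. p dvd n \<and> primepow n} \<subseteq> (\<lambda>k. p ^ k) ` {1..x}"
      proof
        fix n assume n: "n \<in> {n \<in> {1..x}. p dvd n \<and> primepow n}"
        then obtain q k where q: "Factorial_Ring.prime q" "k > 0" "n = q ^ k" by (auto simp: primepow_def)
        then have "p dvd q" using n p(1) prime_dvd_power by blast
        then have "p = q" using p(1) q(1) primes_dvd_imp_eq by blast
        moreover have "k \<le> q ^ k" using prime_gt_1_nat[OF q(1)] by (simp add: less_imp_le)
        ultimately show "n \<in> (\<lambda>k. p ^ k) ` {1..x}" using n q by auto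
      qed
    qed (auto intro!: divide_nonneg_nonneg mangoldt_nonneg)
    finally show ?thesis .
  qed
  also have "\<dots> = (\<Sum>k\<in>{1..x}. ln (real p) * (1 / real p) ^ k)"
    using p by (subst sum.reindex) (auto intro!: inj_onI sum.cong simp: power_one_over field_simps prime_gt_1_nat)
  also have "\<dots> = ln (real p) * (\<Sum>k\<in>{1..x}. (1 / real p) ^ k)" by (simp only: sum_distrib_left)
  also have "\<dots> \<le> ln (real p) * (1 / (1 - 1 / real p))"
    using p geometric_sum_less[of "1 / real p" "{1..x}"] by (intro mult_left_mono) auto
  also have "\<dots> \<le> ln (real p) * 2"
    using p by (intro mult_left_mono) (auto simp: field_simps)
  finally show "\<exists>r. TT 0 x = of_real r \<and> r \<le> (\<Sum>n\<in>{1..x}. mangoldt n / real n) \<and> r \<ge> (\<Sum>n\<in>{1..x}. mangoldt n / real n) - 2 * ln (real p)"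
    using 1 split nn by (intro exI[of _ r]) auto
qed

abbreviation "LL j \<equiv> nonprincipal.L (chi j)"

text \<open>Summed over all characters, \<open>TT\<close> is \<open>m\<close> times a sum of
  nonnegative terms over the class of 1. The principal character contributes at most 10/9 of the
  logarithm up to a constant, whereas each vanishing L-value contributes minus a full logarithm; two
  of them would make the total negative.\<close>

lemma at_most_one_zero:
  assumes ij: "i < m" "j < m" "i \<noteq> j" "i > 0" "j > 0" "LL i = 0" "LL j = 0"
  shows False
proof -
  define Z where "Z = {k\<in>{1..<m}. LL k = 0}"
  have nd: "\<not> m dvd k" if "k \<in> {1..<m}" for k using that by (auto dest: dvd_imp_le)
  have "\<exists>C. \<forall>x>0. cmod (TT k x + (if k \<in> Z then of_real (ln (real x)) else 0)) \<le> C" if "k \<in> {1..<m}" for k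
    using nonprincipal.T_bounded[OF nonprincipal_chi[OF nd[OF that]]] nonprincipal.T_L_zero[OF nonprincipal_chi[OF nd[OF that]]] that
    unfolding TT_eq[OF nd[OF that]] by (cases "LL k = 0") (auto simp: Z_def)
  then obtain C where C: "\<And>k x. k \<in> {1..<m} \<Longrightarrow> x > 0 \<Longrightarrow> cmod (TT k x + (if k \<in> Z then of_real (ln (real x)) else 0)) \<le> C k"
    by metis
  have bound: "real (card Z) * ln (real x) \<le> 10 / 9 * (ln (real x) + ln 10) + (\<Sum>k\<in>{1..<m}. C k)" if x: "x > 0" for x
  proof -
    obtain r where r: "TT 0 x = of_real r" "r \<le> (\<Sum>n\<in>{1..x}. mangoldt n / real n)"
      using TT_0 by blast
    have "(\<Sum>k<m. TT k x) = of_real (real m * (\<Sum>n | n \<in> {1..x} \<and> [n = g ^ 0] (mod p). mangoldt n / real n))"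
    proof -
      have "zeta ^ (k * m) = 1" for k by (simp add: zeta_eq_1)
      then show ?thesis using TT_sum[of 0 x] m_pos by simp
    qed
    then have a1: "Re (\<Sum>k<m. TT k x) \<ge> 0"
      by (simp only: Re_complex_of_real) (intro mult_nonneg_nonneg sum_nonneg divide_nonneg_nonneg mangoldt_nonneg, auto)
    have a2: "(\<Sum>k<m. TT k x) = TT 0 x + (\<Sum>k\<in>{1..<m}. TT k x)"
      using m_pos by (simp add: lessThan_atLeast0 sum.atLeast_Suc_lessThan)
    have a3: "Re (\<Sum>k\<in>{1..<m}. TT k x) = (\<Sum>k\<in>{1..<m}. Re (TT k x + (if k \<in> Z then of_real (ln (real x)) else 0))) - (\<Sum>k\<in>{1..<m}. if k \<in> Z then ln (real x) else 0)"
      unfolding Re_sum sum_subtractf[symmetric] by (intro sum.cong) auto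
    have a4: "(\<Sum>k\<in>{1..<m}. Re (TT k x + (if k \<in> Z then of_real (ln (real x)) else 0))) \<le> (\<Sum>k\<in>{1..<m}. C k)"
      by (rule sum_mono) (rule order_trans[OF complex_Re_le_cmod C[OF _ x]])
    have a5: "(\<Sum>k\<in>{1..<m}. if k \<in> Z then ln (real x) else 0) = real (card Z) * ln (real x)"
    proof -
      have "{1..<m} \<inter> Z = Z" by (auto simp: Z_def)
      then show ?thesis by (simp add: sum.If_cases)
    qed
    have "Re (\<Sum>k<m. TT k x) = r + Re (\<Sum>k\<in>{1..<m}. TT k x)" using a2 r(1) by simp
    then show ?thesis using r(2) mangoldt_over_n_upper[OF x] a1 a3 a4 a5 by linarith
  qed
  have "card {i, j} \<le> card Z" using ij by (intro card_mono) (auto simp: Z_def)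
  then have Z2: "2 \<le> real (card Z)" using ij by simp
  define D where "D = 10 / 9 * ln 10 + (\<Sum>k\<in>{1..<m}. C k)"
  \<comment> \<open>As \<open>2 - 10/9 = 8/9\<close>, the bound would force
    \<open>ln x \<le> 9/8 * D\<close>. The maximum with 1 keeps the logarithm positive.\<close>
  obtain x :: nat where x: "real x > exp (max 1 (9 / 8 * D + 1))" using reals_Archimedean2 by blast
  have x0: "x > 0" using x by (metis exp_gt_zero less_trans of_nat_0_less_iff)
  have lnx: "ln (real x) > max 1 (9 / 8 * D + 1)" using x by (intro less_lnI)
  have "2 * ln (real x) \<le> real (card Z) * ln (real x)" using Z2 lnx by (intro mult_right_mono) auto
  also have "\<dots> \<le> 10 / 9 * ln (real x) + D" using bound[OF x0] by (simp only: D_def distrib_left add.assoc)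
  finally show False using lnx by simp
qed

text \<open>The L-value at \<open>m - j\<close> is the complex conjugate of the one at
  \<open>j\<close>, so a zero of a nonreal character would produce two zeros. The case
  \<open>2 * j = m\<close> is the quadratic character, settled by
  \<open>L_nonzero_real\<close>.\<close>

lemma LL_nonzero: assumes "0 < j" "j < m" shows "LL j \<noteq> 0"
proof
  assume z: "LL j = 0"
  have nd: "\<not> m dvd j" "\<not> m dvd m - j" using assms by (auto dest: dvd_imp_le)
  interpret C1: nonprincipal "chi j" "real p" by (rule nonprincipal_chi[OF nd(1)])
  interpret C2: nonprincipal "chi (m - j)" "real p" by (rule nonprincipal_chi[OF nd(2)])
  show False
  proof (cases "2 * j = m")
    case True
    have "chi j n \<in> {0, 1, -1}" for n
    proof -
      have "(zeta ^ (j * ind n))^2 = 1" using True[symmetric] zeta_eq_1 by (simp flip: power_mult)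
      then show ?thesis by (auto simp: chi_def power2_eq_1_iff)
    qed
    then show False using C1.L_nonzero_real z by blast
  next
    case False
    have "chi (m - j) n = cnj (chi j n)" for n
    proof (cases "p dvd n")
      case nd: False
      have "zeta ^ ((m - j) * ind n) * zeta ^ (j * ind n) = 1"
        using assms zeta_eq_1 by (simp flip: power_add distrib_right)
      moreover have "cnj (zeta ^ (j * ind n)) * zeta ^ (j * ind n) = 1"
        using complex_norm_square[of "zeta ^ (j * ind n)"] by (simp add: norm_power norm_zeta mult.commute)
      ultimately show ?thesis using nd by (metis chi_def mult_cancel_right zero_neq_one mult_zero_right)
    qed (simp add: chi_def)
    then have "C2.S = (\<lambda>x. cnj (C1.S x))"
      by (simp add: fun_eq_iff C1.S_def C2.S_def)
    then have "C2.S \<longlonglongrightarrow> cnj C1.L" using C1.S_tendsto by (simp add: tendsto_cnj)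
    then have "C2.L = cnj C1.L" using C2.S_tendsto LIMSEQ_unique by blast
    moreover have "j \<noteq> m - j" using False assms by linarith
    ultimately show False using at_most_one_zero[of j "m - j"] assms z by simp
  qed
qed

text \<open>In the orthogonality sum for the class of \<open>g\<close>, only the principal character
  is unbounded, because all other L-values differ from 0.\<close>

lemma generator_class_diverges: "\<exists>C. \<forall>x>0. real m * (\<Sum>n | n \<in> {1..x} \<and> [n = g] (mod p). mangoldt n / real n) \<ge> ln (real x) - C"
proof -
  have nd: "\<not> m dvd k" if "k \<in> {1..<m}" for k using that by (auto dest: dvd_imp_le)
  have "\<exists>C. \<forall>x. cmod (TT k x) \<le> C" if "k \<in> {1..<m}" for k
    using nonprincipal.T_bounded[OF nonprincipal_chi[OF nd[OF that]]] LL_nonzero[of k] that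
    unfolding TT_eq[OF nd[OF that]] by auto
  then obtain C where C: "\<And>k x. k \<in> {1..<m} \<Longrightarrow> cmod (TT k x) \<le> C k" by metis
  obtain C0 where C0: "\<And>x. \<exists>r. TT 0 x = of_real r \<and> r \<ge> (\<Sum>n\<in>{1..x}. mangoldt n / real n) - C0"
    using TT_0 by metis
  show ?thesis
  proof (intro exI allI impI)
    fix x :: nat assume x: "x > 0"
    obtain r where r: "TT 0 x = of_real r" "r \<ge> (\<Sum>n\<in>{1..x}. mangoldt n / real n) - C0" using C0 by blast
    define s where "s = real m * (\<Sum>n | n \<in> {1..x} \<and> [n = g] (mod p). mangoldt n / real n)"
    have "of_real s = (\<Sum>k<m. zeta ^ (k * (m - 1)) * TT k x)"
      unfolding s_def using TT_sum[of 1 x] m_pos by simp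
    also have "\<dots> = TT 0 x + (\<Sum>k\<in>{1..<m}. zeta ^ (k * (m - 1)) * TT k x)"
      using m_pos by (simp add: lessThan_atLeast0 sum.atLeast_Suc_lessThan)
    finally have "of_real (s - r) = (\<Sum>k\<in>{1..<m}. zeta ^ (k * (m - 1)) * TT k x)" using r by simp
    then have "\<bar>s - r\<bar> = cmod (\<Sum>k\<in>{1..<m}. zeta ^ (k * (m - 1)) * TT k x)" by (metis norm_of_real)
    also have "\<dots> \<le> (\<Sum>k\<in>{1..<m}. C k)"
      by (rule sum_norm_le) (use C in \<open>simp add: norm_mult norm_power norm_zeta\<close>)
    finally show "ln (real x) - (1 + C0 + (\<Sum>k\<in>{1..<m}. C k)) \<le> real m * (\<Sum>n | n \<in> {1..x} \<and> [n = g] (mod p). mangoldt n / real n)"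
      using r mangoldt_over_n_lower[OF x] by (simp add: s_def)
  qed
qed

end

lemma ln_le_2_sqrt: "x > 0 \<Longrightarrow> ln x \<le> 2 * sqrt x"
  using ln_bound[of "sqrt x"] by (simp add: ln_sqrt)

text \<open>The powers of a prime \<open>q\<close> with exponent at least 2 contribute at most a
  constant times \<open>ln q / q ^ 2\<close>; the estimate of the logarithm by twice the square root
  leaves a convergent series with exponent -3/2.\<close>

lemma mangoldt_proper_powers_bounded:
  "\<exists>C. \<forall>x. (\<Sum>n\<in>{n\<in>{1..x}. \<not> Factorial_Ring.prime n}. mangoldt n / real n) \<le> C"
proof -
  have sm: "summable (\<lambda>n. 4 * real n powr (-3/2))"
    by (intro summable_mult) (simp add: summable_real_powr_iff)
  have "(\<Sum>n\<in>{n\<in>{1..x}. \<not> Factorial_Ring.prime n}. mangoldt n / real n) \<le> (\<Sum>n. 4 * real n powr (-3/2))" for x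
  proof -
    define I where "I = {q\<in>{1..x}. Factorial_Ring.prime q} \<times> {2..x}"
    have "(\<Sum>n\<in>{n\<in>{1..x}. \<not> Factorial_Ring.prime n}. mangoldt n / real n) = (\<Sum>n\<in>{n\<in>{1..x}. \<not> Factorial_Ring.prime n \<and> primepow n}. mangoldt n / real n)"
      by (intro sum.mono_neutral_right) (auto simp: mangoldt_def)
    also have "\<dots> \<le> (\<Sum>n\<in>(\<lambda>(q, k). q ^ k) ` I. mangoldt n / real n)"
    proof (rule sum_mono2)
      show "{n\<in>{1..x}. \<not> Factorial_Ring.prime n \<and> primepow n} \<subseteq> (\<lambda>(q, k). q ^ k) ` I"
      proof
        fix n assume n: "n \<in> {n\<in>{1..x}. \<not> Factorial_Ring.prime n \<and> primepow n}"
        then obtain q k where q: "Factorial_Ring.prime q" "k > 0" "n = q ^ k" by (auto simp: primepow_def)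
        have "k \<noteq> 1" using n q by auto
        moreover have "k \<le> q ^ k" using prime_gt_1_nat[OF q(1)] by (simp add: less_imp_le)
        moreover have "q \<le> q ^ k" using prime_gt_1_nat[OF q(1)] q(2) by (simp add: self_le_power)
        moreover have "q ^ k \<le> x" using n q by simp
        ultimately have "k \<noteq> 1" "k \<le> x" "q \<le> x" by linarith+
        then have "(q, k) \<in> I" using q prime_gt_1_nat[OF q(1)] by (simp add: I_def)
        then show "n \<in> (\<lambda>(q, k). q ^ k) ` I" using q by force
      qed
    qed (auto simp: I_def intro!: divide_nonneg_nonneg mangoldt_nonneg)
    also have "\<dots> \<le> (\<Sum>(q, k)\<in>I. mangoldt (q ^ k) / real (q ^ k))"
      using sum_image_le[of I "\<lambda>n. mangoldt n / real n" "\<lambda>(q, k). q ^ k"]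
      by (auto simp: I_def case_prod_unfold comp_def intro!: divide_nonneg_nonneg mangoldt_nonneg)
    also have "\<dots> = (\<Sum>q\<in>{q\<in>{1..x}. Factorial_Ring.prime q}. \<Sum>k\<in>{2..x}. mangoldt (q ^ k) / real (q ^ k))"
      unfolding I_def by (rule sum.cartesian_product[symmetric])
    also have "\<dots> \<le> (\<Sum>q\<in>{q\<in>{1..x}. Factorial_Ring.prime q}. 4 * real q powr (-3/2))"
    proof (rule sum_mono)
      fix q assume "q \<in> {q\<in>{1..x}. Factorial_Ring.prime q}"
      then have "Factorial_Ring.prime q" by simp
      then have q: "Factorial_Ring.prime q" "q > 1" using prime_gt_1_nat by blast+
      have "(\<Sum>k\<in>{2..x}. mangoldt (q ^ k) / real (q ^ k)) = (\<Sum>k\<in>{2..x}. ln (real q) * (1 / real q) ^ k)"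
        using q by (intro sum.cong) (auto simp: power_one_over)
      also have "\<dots> \<le> (\<Sum>k\<in>(\<lambda>i. i + 2) ` {..<x}. ln (real q) * (1 / real q) ^ k)"
      proof (rule sum_mono2)
        show "{2..x} \<subseteq> (\<lambda>i. i + 2) ` {..<x}"
        proof
          fix k assume "k \<in> {2..x}"
          then show "k \<in> (\<lambda>i. i + 2) ` {..<x}" by (intro image_eqI[of _ _ "k - 2"]) auto
        qed
      qed (use q in auto)
      also have "\<dots> = (\<Sum>i<x. ln (real q) * (1 / real q) ^ (i + 2))"
        by (subst sum.reindex) (auto intro!: inj_onI)
      also have "\<dots> = ln (real q) / (real q)^2 * (\<Sum>i<x. (1 / real q) ^ i)"
        unfolding sum_distrib_left by (intro sum.cong refl) (simp add: power_add power2_eq_square)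
      also have "\<dots> \<le> ln (real q) / (real q)^2 * (1 / (1 - 1 / real q))"
        using q geometric_sum_less[of "1 / real q" "{..<x}"] by (intro mult_left_mono) auto
      also have "\<dots> \<le> ln (real q) / (real q)^2 * 2"
        using q by (intro mult_left_mono) (auto simp: field_simps)
      also have "\<dots> \<le> (2 * sqrt (real q)) / (real q)^2 * 2"
        using q by (intro mult_right_mono divide_right_mono ln_le_2_sqrt) auto
      also have "(2 * sqrt (real q)) / (real q)^2 * 2 = 4 * real q powr (-3/2)"
      proof -
        have "sqrt (real q) / (real q)^2 = real q powr (1/2) / real q powr 2"
          using q by (simp add: powr_half_sqrt)
        also have "\<dots> = real q powr (1/2 - 2)" by (simp only: powr_diff)
        finally show ?thesis by simp
      qed
      finally show "(\<Sum>k\<in>{2..x}. mangoldt (q ^ k) / real (q ^ k)) \<le> 4 * real q powr (-3/2)" .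
    qed
    also have "\<dots> \<le> (\<Sum>n. 4 * real n powr (-3/2))"
      by (rule sum_le_suminf[OF sm]) auto
    finally show ?thesis .
  qed
  then show ?thesis by blast
qed

text \<open>Every prime congruent to \<open>g\<close> modulo \<open>p\<close> is a primitive root.
  If all of them divided \<open>N\<close>, the sum over the class of \<open>g\<close> would be
  bounded by the divisors of \<open>N\<close> and the proper prime powers, against its logarithmic
  growth.\<close>

theorem exists_prime_primroot:
  assumes p: "Factorial_Ring.prime p" "p > 2" and N: "N > 0"
  shows "\<exists>l. Factorial_Ring.prime l \<and> residue_primroot p l \<and> \<not> l dvd N"
proof (rule ccontr)
  assume contr: "\<not> ?thesis"
  have "odd p" using p by (simp add: prime_odd_nat)
  with p(1) obtain g where pg: "\<forall>k>0. residue_primroot (p ^ k) g"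
    by (rule residue_primroot_odd_prime_power_exists)
  have g: "residue_primroot p g" using pg[rule_format, of 1] by simp
  interpret prime_modulus p g using p g by unfold_locales
  obtain C where C: "\<And>x. x > 0 \<Longrightarrow> real m * (\<Sum>n | n \<in> {1..x} \<and> [n = g] (mod p). mangoldt n / real n) \<ge> ln (real x) - C"
    using generator_class_diverges by blast
  obtain C' where C': "\<And>x. (\<Sum>n\<in>{n\<in>{1..x}. \<not> Factorial_Ring.prime n}. mangoldt n / real n) \<le> C'"
    using mangoldt_proper_powers_bounded by blast
  define D where "D = (\<Sum>n\<in>{n. n dvd N}. mangoldt n / real n)"
  have dvdN: "n dvd N" if "Factorial_Ring.prime n" "[n = g] (mod p)" for n
  proof -
    have "residue_primroot p n" using residue_primroot_cong[OF that(2)] g by simp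
    then show ?thesis using contr that(1) by blast
  qed
  have bd: "ln (real x) \<le> real m * (D + C') + C" if x: "x > 0" for x
  proof -
    have "(\<Sum>n | n \<in> {1..x} \<and> [n = g] (mod p). mangoldt n / real n) \<le> (\<Sum>n\<in>{n. n dvd N} \<union> {n\<in>{1..x}. \<not> Factorial_Ring.prime n}. mangoldt n / real n)"
      using N dvdN by (intro sum_mono2) (auto intro!: divide_nonneg_nonneg mangoldt_nonneg)
    also have "\<dots> \<le> D + (\<Sum>n\<in>{n\<in>{1..x}. \<not> Factorial_Ring.prime n}. mangoldt n / real n)"
    proof -
      have "finite {n. n dvd N}" using N by simp
      moreover have "(\<Sum>n\<in>{n. n dvd N} \<inter> {n\<in>{1..x}. \<not> Factorial_Ring.prime n}. mangoldt n / real n) \<ge> 0"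
        by (intro sum_nonneg divide_nonneg_nonneg mangoldt_nonneg) auto
      ultimately show ?thesis unfolding D_def
        using sum_Un[of "{n. n dvd N}" "{n\<in>{1..x}. \<not> Factorial_Ring.prime n}" "\<lambda>n. mangoldt n / real n"] by simp
    qed
    also have "\<dots> \<le> D + C'" using C' by simp
    finally have "real m * (\<Sum>n | n \<in> {1..x} \<and> [n = g] (mod p). mangoldt n / real n) \<le> real m * (D + C')"
      by (intro mult_left_mono) auto
    then show ?thesis using C[OF x] by simp
  qed
  obtain x :: nat where x: "real x > exp (real m * (D + C') + C)" using reals_Archimedean2 by blast
  have x0: "x > 0" using x by (metis exp_gt_zero less_trans of_nat_0_less_iff)
  have "ln (real x) > real m * (D + C') + C" using x by (intro less_lnI)
  then show False using bd[OF x0] by simp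
qed

section \<open>Forms of level one\<close>

lemma pi_ge_3: "pi \<ge> 3"
proof -
  have "sin (pi / 6) \<le> pi / 6" by (rule sin_x_le_x) simp
  then show ?thesis by (simp add: sin_30)
qed

definition mat2 :: "int \<Rightarrow> int \<Rightarrow> int \<Rightarrow> int \<Rightarrow> int^2^2" where
  "mat2 a b c d = vector [vector [a, b], vector [c, d]]"

lemma mat2_nth [simp]: "mat2 a b c d $ 1 $ 1 = a" "mat2 a b c d $ 1 $ 2 = b"
    "mat2 a b c d $ 2 $ 1 = c" "mat2 a b c d $ 2 $ 2 = d"
  by (simp_all add: mat2_def vector_2)

lemma SL2Z_iff: "A \<in> carrier SL2Z \<longleftrightarrow> A$1$1 * A$2$2 - A$1$2 * A$2$1 = 1"
  by (simp add: SL2Z_def det_2)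

lemma matrix_mult_2: "((A::int^2^2) ** B) $ i $ j = A$i$1 * B$1$j + A$i$2 * B$2$j"
  by (simp add: matrix_matrix_mult_def sum_2)

lemma mat_1_nth [simp]: "(mat 1 :: int^2^2) $ 1 $ 1 = 1" "(mat 1 :: int^2^2) $ 1 $ 2 = 0"
    "(mat 1 :: int^2^2) $ 2 $ 1 = 0" "(mat 1 :: int^2^2) $ 2 $ 2 = 1"
  by (simp_all add: mat_def)

lemma mat_1_SL2Z: "mat 1 \<in> carrier SL2Z"
  by (simp add: SL2Z_iff)

lemma SL2Z_mult: "A \<in> carrier SL2Z \<Longrightarrow> B \<in> carrier SL2Z \<Longrightarrow> A ** B \<in> carrier SL2Z"
  by (simp add: SL2Z_def det_mul)

lemma upper_half_plane_iff: "z \<in> upper_half_plane \<longleftrightarrow> Im z > 0"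
  by (simp add: upper_half_plane_def)

lemma open_upper_half_plane: "open upper_half_plane"
  unfolding upper_half_plane_def by (rule open_halfspace_Im_gt)

lemma convex_upper_half_plane: "convex upper_half_plane"
  unfolding upper_half_plane_def by (rule convex_halfspace_Im_gt)

lemma automorphy_factor_nonzero:
  assumes "A \<in> carrier SL2Z" "z \<in> upper_half_plane" shows "automorphy_factor A z \<noteq> 0"
proof
  assume e: "automorphy_factor A z = 0"
  have "Im (automorphy_factor A z) = of_int (A$2$1) * Im z" "Re (automorphy_factor A z) = of_int (A$2$1) * Re z + of_int (A$2$2)"
    by (simp_all add: automorphy_factor_def)
  then have "A$2$1 = 0" using assms e by (simp add: upper_half_plane_iff)
  moreover from this have "A$2$2 = 0" using e by (simp add: automorphy_factor_def)
  ultimately show False using assms by (simp add: SL2Z_iff)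
qed

lemma Im_mobius:
  assumes "A \<in> carrier SL2Z"
  shows "Im (mobius A z) = Im z / (cmod (automorphy_factor A z))^2"
proof -
  define a b c d where "a = real_of_int (A$1$1)" and "b = real_of_int (A$1$2)"
    and "c = real_of_int (A$2$1)" and "d = real_of_int (A$2$2)"
  have det: "a * d - b * c = 1"
    using arg_cong[OF assms[unfolded SL2Z_iff], of real_of_int] by (simp add: a_def b_def c_def d_def)
  have num: "Re (of_int (A$1$1) * z + of_int (A$1$2)) = a * Re z + b" "Im (of_int (A$1$1) * z + of_int (A$1$2)) = a * Im z"
    and den: "Re (automorphy_factor A z) = c * Re z + d" "Im (automorphy_factor A z) = c * Im z"
    by (simp_all add: a_def b_def c_def d_def automorphy_factor_def)
  have "Im (mobius A z) = (a * Im z * (c * Re z + d) - (a * Re z + b) * (c * Im z)) / (cmod (automorphy_factor A z))^2"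
    unfolding mobius_def automorphy_factor_def[symmetric] Im_divide cmod_power2 num den ..
  also have "a * Im z * (c * Re z + d) - (a * Re z + b) * (c * Im z) = Im z * (a * d - b * c)"
    by (simp add: algebra_simps)
  finally show ?thesis by (simp add: det)
qed

lemma mobius_upper_half_plane:
  assumes "A \<in> carrier SL2Z" "z \<in> upper_half_plane" shows "mobius A z \<in> upper_half_plane"
  using assms automorphy_factor_nonzero[OF assms] by (simp add: upper_half_plane_iff Im_mobius)

lemma mobius_mult:
  assumes "A \<in> carrier SL2Z" "B \<in> carrier SL2Z" "z \<in> upper_half_plane"
  shows "mobius (A ** B) z = mobius A (mobius B z)"
    and "automorphy_factor (A ** B) z = automorphy_factor A (mobius B z) * automorphy_factor B z"
proof -
  have nz: "of_int (B$2$1) * z + of_int (B$2$2) \<noteq> 0"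
    using automorphy_factor_nonzero[OF assms(2,3)] by (simp add: automorphy_factor_def)
  then show 1: "automorphy_factor (A ** B) z = automorphy_factor A (mobius B z) * automorphy_factor B z"
    by (simp add: automorphy_factor_def mobius_def matrix_mult_2 field_simps)
  have "automorphy_factor (A ** B) z \<noteq> 0"
    using automorphy_factor_nonzero[OF SL2Z_mult] assms by blast
  then have nz2: "automorphy_factor A (mobius B z) \<noteq> 0" using 1 by auto
  have "(of_int ((A ** B)$1$1) * z + of_int ((A ** B)$1$2)) = (of_int (A$1$1) * mobius B z + of_int (A$1$2)) * automorphy_factor B z"
    using nz by (simp add: automorphy_factor_def mobius_def matrix_mult_2 field_simps)
  then have "mobius (A ** B) z = (of_int (A$1$1) * mobius B z + of_int (A$1$2)) * automorphy_factor B z / (automorphy_factor A (mobius B z) * automorphy_factor B z)"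
    using 1 by (simp add: mobius_def[of "A ** B"] automorphy_factor_def[symmetric])
  also have "\<dots> = mobius A (mobius B z)"
    using nz by (simp add: mobius_def[of A] automorphy_factor_def)
  finally show "mobius (A ** B) z = mobius A (mobius B z)" .
qed

lemma translation_SL2Z: "mat2 1 n 0 1 \<in> carrier SL2Z"
  and mobius_translation: "mobius (mat2 1 n 0 1) z = z + of_int n"
  and automorphy_factor_translation: "automorphy_factor (mat2 1 n 0 1) z = 1"
  by (simp_all add: SL2Z_iff mobius_def automorphy_factor_def)

lemma finite_lattice_points:
  assumes "z \<in> upper_half_plane"
  shows "finite {v::int \<times> int. cmod (of_int (fst v) * z + of_int (snd v)) \<le> 1}"
proof -
  have y: "Im z > 0" using assms by (simp add: upper_half_plane_iff)
  define K where "K = \<lceil>1 + (1 + cmod z) / Im z\<rceil>"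
  have K: "1 + (1 + cmod z) / Im z \<le> real_of_int K" by (simp add: K_def)
  have "{v::int \<times> int. cmod (of_int (fst v) * z + of_int (snd v)) \<le> 1} \<subseteq> {-K..K} \<times> {-K..K}"
  proof
    fix v :: "int \<times> int" assume "v \<in> {v. cmod (of_int (fst v) * z + of_int (snd v)) \<le> 1}"
    then obtain c d where v: "v = (c, d)" "cmod (of_int c * z + of_int d) \<le> 1" by (cases v) auto
    have "\<bar>of_int c * Im z\<bar> \<le> 1" using v(2) abs_Im_le_cmod[of "of_int c * z + of_int d"] by simp
    then have c: "\<bar>of_int c\<bar> \<le> 1 / Im z" using y by (simp add: abs_mult field_simps)
    have "cmod (of_int d) \<le> cmod (of_int c * z + of_int d) + cmod (of_int c * z)"
      using norm_triangle_ineq4[of "of_int c * z + of_int d" "of_int c * z"] by simp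
    also have "\<dots> \<le> 1 + \<bar>of_int c\<bar> * cmod z" using v(2) by (simp add: norm_mult)
    also have "\<dots> \<le> 1 + 1 / Im z * cmod z" using c by (intro add_left_mono mult_right_mono) auto
    finally have d: "\<bar>of_int d\<bar> \<le> 1 + cmod z / Im z" by simp
    have "1 / Im z \<ge> 0" "cmod z / Im z \<ge> 0" using y by auto
    then have "\<bar>real_of_int c\<bar> \<le> real_of_int K" "\<bar>real_of_int d\<bar> \<le> real_of_int K"
      using c d K unfolding add_divide_distrib by linarith+
    then show "v \<in> {-K..K} \<times> {-K..K}" using v(1) by (simp add: abs_le_iff)
  qed
  then show ?thesis by (rule finite_subset) auto
qed

text \<open>A matrix with the least value of \<open>|c z + d|\<close> gives the highest point of the
  orbit. After a translation to \<open>|Re| \<le> 1/2\<close>, one more inversion cannot raise the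
  point, so its modulus is at least 1 and the bound 3/4 follows.\<close>

lemma reduction_to_fundamental_domain:
  assumes z: "z \<in> upper_half_plane"
  obtains A where "A \<in> carrier SL2Z" "\<bar>Re (mobius A z)\<bar> \<le> 1/2" "(Im (mobius A z))^2 \<ge> 3/4"
proof -
  \<comment> \<open>Bottom rows with \<open>|c z + d| \<le> 1\<close> form a finite set. It contains
    the row of the identity matrix, so the minimum over it is the minimum over the whole
    group.\<close>
  define L where "L = (\<lambda>A. (A$2$1, A$2$2)) ` carrier SL2Z \<inter> {v::int \<times> int. cmod (of_int (fst v) * z + of_int (snd v)) \<le> 1}"
  have finL: "finite L" unfolding L_def using finite_lattice_points[OF z] by blast
  have "(0, 1) \<in> L" unfolding L_def using mat_1_SL2Z by (auto intro!: image_eqI[of _ _ "mat 1"])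
  then have neL: "L \<noteq> {}" by blast
  define nv where "nv v = cmod (of_int (fst v) * z + of_int (snd v))" for v :: "int \<times> int"
  have "Min (nv ` L) \<in> nv ` L" using finL neL by simp
  then obtain v where v: "v \<in> L" "nv v = Min (nv ` L)" by auto
  then have vmin: "nv v \<le> nv u" if "u \<in> L" for u using that finL by simp
  obtain A :: "int^2^2" where A: "A \<in> carrier SL2Z" "v = (A$2$1, A$2$2)" using v(1) by (auto simp: L_def)
  have nvA: "nv v = cmod (automorphy_factor A z)" by (simp add: A(2) nv_def automorphy_factor_def)
  have minA: "cmod (automorphy_factor A z) \<le> cmod (automorphy_factor B z)" if B: "B \<in> carrier SL2Z" for B
  proof (cases "cmod (automorphy_factor B z) \<le> 1")
    case True
    then have "(B$2$1, B$2$2) \<in> L" using B by (auto simp: L_def automorphy_factor_def)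
    then show ?thesis using vmin nvA by (force simp: nv_def automorphy_factor_def)
  next
    case False
    have "nv v \<le> 1" using v(1) by (simp add: L_def nv_def)
    then show ?thesis using False nvA by simp
  qed
  define w where "w = mobius A z"
  define n where "n = - round (Re w)"
  define w' where "w' = w + of_int n"
  have wH: "w \<in> upper_half_plane" unfolding w_def using A z by (simp add: mobius_upper_half_plane)
  have re: "\<bar>Re w'\<bar> \<le> 1/2" using of_int_round_abs_le[of "Re w"] by (simp add: w'_def n_def abs_minus_commute)
  \<comment> \<open>Translation by \<open>n\<close> followed by the inversion; its automorphy factor
    at \<open>w\<close> is exactly \<open>w'\<close>.\<close>
  define S where "S = mat2 0 (-1) 1 n"
  have S: "S \<in> carrier SL2Z" by (simp add: S_def SL2Z_iff)
  have "automorphy_factor (S ** A) z = automorphy_factor S w * automorphy_factor A z"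
    unfolding w_def by (rule mobius_mult(2)[OF S A(1) z])
  also have "automorphy_factor S w = w'" by (simp add: S_def automorphy_factor_def w'_def)
  finally have "cmod (automorphy_factor A z) \<le> cmod w' * cmod (automorphy_factor A z)"
    using minA[OF SL2Z_mult[OF S A(1)]] by (simp add: norm_mult)
  then have "cmod w' \<ge> 1" using automorphy_factor_nonzero[OF A(1) z] by simp
  then have "1 \<le> (cmod w')^2" by (simp add: one_le_power)
  also have "(cmod w')^2 = (Re w')^2 + (Im w')^2" by (rule cmod_power2)
  also have "(Re w')^2 \<le> (1/2)^2" using re by (metis abs_ge_zero power2_abs power_mono)
  finally have im: "(Im w')^2 \<ge> 3/4" by (simp add: power2_eq_square)
  have w': "mobius (mat2 1 n 0 1 ** A) z = w'"
    using mobius_mult(1)[OF translation_SL2Z A(1) z] by (simp add: mobius_translation w'_def w_def)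
  show ?thesis
    by (rule that[of "mat2 1 n 0 1 ** A"]) (use re im w' SL2Z_mult[OF translation_SL2Z A(1)] in auto)
qed

section \<open>Expansions in the variable q\<close>

definition nome :: "complex \<Rightarrow> complex" where
  "nome z = exp (2 * of_real pi * \<i> * z)"

lemma norm_nome: "norm (nome z) = exp (- 2 * pi * Im z)"
  by (simp add: nome_def norm_exp_eq_Re)

lemma nome_nonzero [simp]: "nome z \<noteq> 0"
  by (simp add: nome_def)

lemma norm_nome_less_1: "z \<in> upper_half_plane \<Longrightarrow> norm (nome z) < 1"
  by (simp add: norm_nome upper_half_plane_iff)

lemma nome_add_int: "nome (z + of_int n) = nome z"
proof -
  have "nome (z + of_int n) = nome z * exp (2 * of_real pi * \<i> * of_int n)"
    by (simp add: nome_def distrib_left exp_add)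
  also have "exp (2 * of_real pi * \<i> * of_int n) = 1"
    using exp_integer_2pi[of "of_int n"] by (simp add: mult_ac)
  finally show ?thesis by simp
qed

lemma nome_surj:
  assumes "q \<noteq> 0" "norm q < 1"
  obtains z where "z \<in> upper_half_plane" "nome z = q" "z = Ln q / (2 * of_real pi * \<i>)"
proof -
  define z where "z = Ln q / (2 * of_real pi * \<i>)"
  have "nome z = q" using assms by (simp add: nome_def z_def)
  moreover have "z \<in> upper_half_plane"
  proof -
    have "exp (- 2 * pi * Im z) < 1" using assms(2) \<open>nome z = q\<close> norm_nome by metis
    then show ?thesis by (simp add: upper_half_plane_iff zero_less_mult_iff)
  qed
  ultimately show ?thesis using that z_def by blast
qed

lemma nome_eq_imp:
  assumes "nome z = nome w" shows "\<exists>n::int. z = w + of_int n"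
proof -
  obtain n :: int where "2 * of_real pi * \<i> * z = 2 * of_real pi * \<i> * w + (of_int (2 * n) * pi) * \<i>"
    using assms unfolding nome_def exp_eq by blast
  then have "2 * of_real pi * \<i> * z = 2 * of_real pi * \<i> * (w + of_int n)" by (simp add: algebra_simps)
  then show ?thesis by (intro exI[of _ n]) simp
qed

lemma less_conv_radius: "r < 1 \<Longrightarrow> R \<ge> 1 \<Longrightarrow> ereal r < R"
  by (rule less_le_trans[of _ 1]) (simp_all add: one_ereal_def)

text \<open>Equivalent to \<open>has_q_expansion 1\<close>, but as a formal power series, so that
  sums, products and derivatives of functions become operations on \<open>fps\<close>. The radius is
  recorded because evaluation respects these operations only inside the disc of convergence.\<close>

definition qexp :: "(complex \<Rightarrow> complex) \<Rightarrow> complex fps \<Rightarrow> bool" where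
  "qexp f F \<longleftrightarrow> fps_conv_radius F \<ge> 1 \<and> (\<forall>z\<in>upper_half_plane. f z = eval_fps F (nome z))"

lemma has_q_expansion_conv_radius:
  assumes "has_q_expansion h f a" "h > 0"
  shows "fps_conv_radius (Abs_fps a) \<ge> 1"
    and "z \<in> upper_half_plane \<Longrightarrow> f z = eval_fps (Abs_fps a) (nome (z / of_nat h))"
proof -
  have e: "exp (2 * of_real pi * \<i> * of_nat n * z / of_nat h) = nome (z / of_nat h) ^ n" for n z
    by (simp add: nome_def exp_of_nat_mult[symmetric] mult_ac)
  have s: "(\<lambda>n. a n * nome (z / of_nat h) ^ n) sums f z" if "z \<in> upper_half_plane" for z
    using assms(1) that unfolding has_q_expansion_def e by blast
  then show "z \<in> upper_half_plane \<Longrightarrow> f z = eval_fps (Abs_fps a) (nome (z / of_nat h))"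
    by (simp add: eval_fps_def sums_iff)
  show "fps_conv_radius (Abs_fps a) \<ge> 1"
    unfolding fps_conv_radius_def
  proof (rule conv_radius_geI_ex')
    fix r :: real assume "0 < r" "ereal r < 1"
    then obtain z where z: "z \<in> upper_half_plane" "nome z = of_real r"
      using nome_surj[of "of_real r"] by auto
    define w where "w = of_nat h * z"
    have "w \<in> upper_half_plane" "w / of_nat h = z" using z assms(2) by (auto simp: w_def upper_half_plane_iff)
    then show "summable (\<lambda>n. fps_nth (Abs_fps a) n * of_real r ^ n)"
      using s[of w] z by (auto simp: sums_iff)
  qed
qed

lemma sums_qexp: "qexp f F \<Longrightarrow> z \<in> upper_half_plane \<Longrightarrow> (\<lambda>n. fps_nth F n * nome z ^ n) sums f z"
  unfolding qexp_def
proof -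
  assume a: "1 \<le> fps_conv_radius F \<and> (\<forall>z\<in>upper_half_plane. f z = eval_fps F (nome z))" and z: "z \<in> upper_half_plane"
  have "ereal (norm (nome z)) < fps_conv_radius F" using less_conv_radius[OF norm_nome_less_1[OF z]] a by blast
  then show ?thesis using sums_eval_fps[of "nome z" F] a z by simp
qed

lemma has_q_expansion_1_iff: "has_q_expansion 1 f a \<longleftrightarrow> qexp f (Abs_fps a)"
proof
  assume "has_q_expansion 1 f a"
  then show "qexp f (Abs_fps a)"
    using has_q_expansion_conv_radius[of 1 f a] by (simp add: qexp_def)
next
  assume "qexp f (Abs_fps a)"
  moreover have e: "exp (2 * of_real pi * \<i> * of_nat n * z / of_nat 1) = nome z ^ n" for n z
    by (simp add: nome_def exp_of_nat_mult[symmetric] mult_ac)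
  ultimately show "has_q_expansion 1 f a"
    unfolding has_q_expansion_def e using sums_qexp by fastforce
qed

text \<open>The half plane \<open>Im z \<ge> 1\<close> is mapped into a compact disc inside the disc
  of convergence. Later arguments use holomorphy at the cusps through this bound.\<close>

lemma has_q_expansion_bounded:
  assumes "has_q_expansion h f a" "h > 0"
  obtains B where "\<And>z. Im z \<ge> 1 \<Longrightarrow> cmod (f z) \<le> B"
proof -
  define r where "r = exp (- 2 * pi / real h)"
  have r: "r < 1" using assms(2) by (simp add: r_def)
  have "cball (0::complex) r \<subseteq> eball 0 (fps_conv_radius (Abs_fps a))"
  proof
    fix x :: complex assume "x \<in> cball 0 r"
    then have "norm x < 1" using r by simp
    then show "x \<in> eball 0 (fps_conv_radius (Abs_fps a))"
      using less_conv_radius[OF _ has_q_expansion_conv_radius(1)[OF assms]] by simp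
  qed
  then have "continuous_on (cball 0 r) (eval_fps (Abs_fps a))" by (intro continuous_on_eval_fps')
      (auto intro: continuous_intros)
  then have "compact (eval_fps (Abs_fps a) ` cball 0 r)" by (intro compact_continuous_image) auto
  then have "bounded (eval_fps (Abs_fps a) ` cball 0 r)" by (rule compact_imp_bounded)
  then obtain B where B': "\<forall>x \<in> eval_fps (Abs_fps a) ` cball 0 r. norm x \<le> B"
    unfolding bounded_iff by blast
  have B: "cmod (eval_fps (Abs_fps a) q) \<le> B" if "q \<in> cball 0 r" for q
    using B' that by (simp only: ball_simps)
  show ?thesis
  proof (rule that[of B])
    fix z :: complex assume z: "Im z \<ge> 1"
    have "norm (nome (z / of_nat h)) = exp (- 2 * pi * (Im z / real h))"
      by (simp add: norm_nome)
    also have "\<dots> \<le> exp (- 2 * pi * (1 / real h))"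
    proof -
      have "1 / real h \<le> Im z / real h" using z by (intro divide_right_mono) auto
      then have "- 2 * pi * (Im z / real h) \<le> - 2 * pi * (1 / real h)" by (intro mult_left_mono_neg) auto
      then show ?thesis by (simp only: exp_le_cancel_iff)
    qed
    also have "\<dots> = r" by (simp add: r_def)
    finally have "cmod (eval_fps (Abs_fps a) (nome (z / of_nat h))) \<le> B" by (intro B) simp
    moreover have "z \<in> upper_half_plane" using z by (simp add: upper_half_plane_iff)
    ultimately show "cmod (f z) \<le> B" using has_q_expansion_conv_radius(2)[OF assms] by simp
  qed
qed

lemma qexp_in_eball:
  assumes "qexp f F" "z \<in> upper_half_plane" shows "ereal (norm (nome z)) < fps_conv_radius F"
  using less_conv_radius[OF norm_nome_less_1[OF assms(2)]] assms(1) by (simp add: qexp_def)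

lemma qexp_add: assumes "qexp f F" "qexp g G" shows "qexp (\<lambda>z. f z + g z) (F + G)"
proof -
  have "1 \<le> min (fps_conv_radius F) (fps_conv_radius G)" using assms by (simp add: qexp_def)
  also have "\<dots> \<le> fps_conv_radius (F + G)" by (rule fps_conv_radius_add)
  finally show ?thesis
    using assms qexp_in_eball[OF assms(1)] qexp_in_eball[OF assms(2)] by (simp add: qexp_def eval_fps_add)
qed

lemma qexp_diff: assumes "qexp f F" "qexp g G" shows "qexp (\<lambda>z. f z - g z) (F - G)"
proof -
  have "1 \<le> min (fps_conv_radius F) (fps_conv_radius G)" using assms by (simp add: qexp_def)
  also have "\<dots> \<le> fps_conv_radius (F - G)" by (rule fps_conv_radius_diff)
  finally show ?thesis
    using assms qexp_in_eball[OF assms(1)] qexp_in_eball[OF assms(2)] by (simp add: qexp_def eval_fps_diff)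
qed

lemma qexp_mult: assumes "qexp f F" "qexp g G" shows "qexp (\<lambda>z. f z * g z) (F * G)"
proof -
  have "1 \<le> min (fps_conv_radius F) (fps_conv_radius G)" using assms by (simp add: qexp_def)
  also have "\<dots> \<le> fps_conv_radius (F * G)" by (rule fps_conv_radius_mult)
  finally show ?thesis
    using assms qexp_in_eball[OF assms(1)] qexp_in_eball[OF assms(2)] by (simp add: qexp_def eval_fps_mult)
qed

lemma qexp_const: "qexp (\<lambda>z. c) (fps_const c)"
  by (simp add: qexp_def)

lemma qexp_cmult: "qexp f F \<Longrightarrow> qexp (\<lambda>z. c * f z) (fps_const c * F)"
  using qexp_mult[OF qexp_const] .

lemma qexp_power: "qexp f F \<Longrightarrow> qexp (\<lambda>z. f z ^ n) (F ^ n)"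
proof (induction n)
  case 0 show ?case using qexp_const[of 1] by simp
next
  case (Suc n)
  then have "qexp (\<lambda>z. f z * f z ^ n) (F * F ^ n)" by (intro qexp_mult) auto
  then show ?case by simp
qed

lemma qexp_sum: "(\<And>i. i \<in> A \<Longrightarrow> qexp (f i) (F i)) \<Longrightarrow> qexp (\<lambda>z. \<Sum>i\<in>A. f i z) (\<Sum>i\<in>A. F i)"
proof (induction A rule: infinite_finite_induct)
  case (insert x A)
  then have "qexp (\<lambda>z. f x z + (\<Sum>i\<in>A. f i z)) (F x + (\<Sum>i\<in>A. F i))" by (intro qexp_add) auto
  then show ?case using insert by simp
qed (use qexp_const[of 0] in simp_all)

lemma qexp_unique: assumes "qexp f F" "qexp f G" shows "F = G"
proof -
  have "has_q_expansion 1 f (fps_nth F)" "has_q_expansion 1 f (fps_nth G)"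
    using assms by (simp_all only: has_q_expansion_1_iff fps_nth_inverse)
  then have "fps_nth F = fps_nth G" by (rule has_q_expansion_unique)
  then show ?thesis by (simp add: fps_nth_inject)
qed

lemma qexp_cong: "qexp f F \<Longrightarrow> (\<And>z. z \<in> upper_half_plane \<Longrightarrow> f z = g z) \<Longrightarrow> qexp g F"
  by (simp add: qexp_def)

lemma qexp_fourier_coeff: assumes "qexp f F" shows "fourier_coeff f = fps_nth F"
  unfolding fourier_coeff_def
proof (rule the_equality)
  show "has_q_expansion 1 f (fps_nth F)" using assms unfolding has_q_expansion_1_iff fps_nth_inverse .
  show "a = fps_nth F" if "has_q_expansion 1 f a" for a
    using that qexp_unique[OF assms] unfolding has_q_expansion_1_iff by fastforce
qed

lemma qexp_holomorphic: "qexp f F \<Longrightarrow> f holomorphic_on upper_half_plane"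
proof -
  assume q: "qexp f F"
  have "(\<lambda>z. eval_fps F (nome z)) holomorphic_on upper_half_plane"
    unfolding nome_def
    by (intro holomorphic_on_compose_gen[OF _ holomorphic_on_eval_fps, unfolded o_def] holomorphic_intros)
      (use qexp_in_eball[OF q] in \<open>auto simp: nome_def\<close>)
  then show ?thesis by (rule holomorphic_transform) (use q in \<open>simp add: qexp_def\<close>)
qed

text \<open>Periodicity makes the function one of \<open>q\<close> in the punctured disc,
  boundedness makes the singularity at 0 removable, and the Taylor series there is the
  expansion.\<close>

lemma periodic_bounded_qexp:
  assumes hol: "f holomorphic_on upper_half_plane"
    and per: "\<And>z. z \<in> upper_half_plane \<Longrightarrow> f (z + 1) = f z"
    and bdd: "\<And>z. Im z \<ge> 1 \<Longrightarrow> cmod (f z) \<le> B"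
  obtains F where "qexp f F"
proof -
  have per_nat: "f (z + of_nat n) = f z" if "z \<in> upper_half_plane" for z and n :: nat
  proof (induction n)
    case (Suc n)
    have "z + of_nat n \<in> upper_half_plane" using that by (simp add: upper_half_plane_iff)
    from per[OF this] show ?case using Suc by (simp add: algebra_simps)
  qed simp
  have per_int: "f (z + of_int n) = f z" if z: "z \<in> upper_half_plane" for z and n :: int
  proof (cases n rule: int_cases2)
    case (nonneg k) then show ?thesis using per_nat[OF z, of k] by simp
  next
    case (nonpos k)
    have "z + of_int n \<in> upper_half_plane" using z by (simp add: upper_half_plane_iff)
    from per_nat[OF this, of k] show ?thesis using nonpos by simp
  qed
  define g where "g q = f (Ln q / (2 * of_real pi * \<i>))" for q
  have g_nome: "g (nome z) = f z" if z: "z \<in> upper_half_plane" for z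
  proof -
    obtain w where w: "w \<in> upper_half_plane" "nome w = nome z" "w = Ln (nome z) / (2 * of_real pi * \<i>)"
      using nome_surj[of "nome z"] norm_nome_less_1[OF z] by auto
    then obtain n :: int where "z = w + of_int n" using nome_eq_imp by metis
    then have "f z = f w" using per_int[OF w(1)] by simp
    then show ?thesis by (simp add: g_def w(3)[symmetric])
  qed
  have g_hol: "g holomorphic_on ball 0 1 - {0}"
    unfolding holomorphic_on_def
  proof
    fix q0 :: complex assume q0: "q0 \<in> ball 0 1 - {0}"
    define S where "S = ball q0 (norm q0) \<inter> ball 0 1"
    have opS: "open S" unfolding S_def by (intro open_Int open_ball)
    have q0S: "q0 \<in> S" using q0 by (simp add: S_def)
    \<comment> \<open>The principal logarithm in the definition of \<open>g\<close> jumps across the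
      negative axis. Near \<open>q0\<close> it is replaced by a holomorphic branch, which by
      periodicity leads to the same values of \<open>f\<close>.\<close>
    define l where "l q = (Ln (q / q0) + Ln q0) / (2 * of_real pi * \<i>)" for q
    have nz: "q / q0 \<notin> \<real>\<^sub>\<le>\<^sub>0" if "q \<in> S" for q
    proof
      assume "q / q0 \<in> \<real>\<^sub>\<le>\<^sub>0"
      then obtain t :: real where t: "q / q0 = of_real t" "t \<le> 0" by (elim nonpos_Reals_cases)
      then have "q = of_real t * q0" using q0 by (simp add: field_simps)
      then have e: "q0 - q = of_real (1 - t) * q0" by (simp add: algebra_simps)
      have "norm (complex_of_real (1 - t)) = 1 - t" using t unfolding norm_of_real by simp
      then have "norm (q0 - q) = (1 - t) * norm q0" by (simp only: e norm_mult)
      also have "\<dots> \<ge> 1 * norm q0" using t by (intro mult_right_mono) auto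
      finally show False using that by (simp add: S_def dist_norm)
    qed
    have l_nome: "nome (l q) = q" if "q \<in> S" for q
    proof -
      have "q / q0 \<noteq> 0" using nz[OF that] by auto
      then show ?thesis using q0 by (simp add: nome_def l_def exp_add)
    qed
    have l_H: "l q \<in> upper_half_plane" if "q \<in> S" for q
    proof -
      have "norm (nome (l q)) < 1" using l_nome[OF that] that by (simp add: S_def)
      then show ?thesis by (simp add: norm_nome upper_half_plane_iff zero_less_mult_iff)
    qed
    have "l holomorphic_on S" unfolding l_def using nz q0 by (intro holomorphic_intros) auto
    then have "(f \<circ> l) holomorphic_on S"
      by (rule holomorphic_on_compose_gen[OF _ hol]) (use l_H in auto)
    moreover have "(f \<circ> l) q = g q" if "q \<in> S" for q
      using g_nome[OF l_H[OF that]] l_nome[OF that] by simp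
    ultimately have "g holomorphic_on S" by (rule holomorphic_transform) auto
    then have "g field_differentiable at q0"
      using opS q0S by (simp add: holomorphic_on_imp_differentiable_at)
    then show "g field_differentiable at q0 within ball 0 1 - {0}"
      by (rule field_differentiable_at_within)
  qed
  have "\<exists>B. eventually (\<lambda>q. norm (g q) \<le> B) (at 0)"
  proof (intro exI)
    have "eventually (\<lambda>q. q \<in> ball 0 (exp (- 2 * pi)) - {0}) (at (0::complex))"
      by (rule eventually_at_in_open) auto
    then show "eventually (\<lambda>q. norm (g q) \<le> B) (at 0)"
    proof eventually_elim
      case (elim q)
      have "exp (- 2 * pi) < (1::real)" by simp
      moreover have "norm q < exp (- 2 * pi)" using elim by simp
      ultimately have "norm q < 1" by (rule less_trans[rotated])
      then obtain z where z: "z \<in> upper_half_plane" "nome z = q" using nome_surj elim by blast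
      have "exp (- 2 * pi * Im z) < exp (- 2 * pi)" using elim z(2) norm_nome[of z] by simp
      then have "Im z \<ge> 1" using exp_less_cancel_iff by simp
      then show ?case using bdd[of z] g_nome[OF z(1)] z(2) by simp
    qed
  qed
  then obtain h where h: "h holomorphic_on ball 0 1" "\<And>q. q \<in> ball 0 1 - {0} \<Longrightarrow> h q = g q"
    using holomorphic_on_extend_bounded[OF g_hol] by auto
  define a where "a n = (deriv ^^ n) h 0 / fact n" for n
  have "has_q_expansion 1 f a"
    unfolding has_q_expansion_def
  proof
    fix z assume z: "z \<in> upper_half_plane"
    then have q: "nome z \<in> ball 0 1" using norm_nome_less_1 by simp
    have "(\<lambda>n. a n * (nome z - 0) ^ n) sums h (nome z)"
      unfolding a_def by (rule holomorphic_power_series[OF h(1) q])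
    moreover have "h (nome z) = f z" using h(2)[of "nome z"] q g_nome[OF z] by simp
    moreover have "exp (2 * of_real pi * \<i> * of_nat n * z / of_nat 1) = nome z ^ n" for n
      by (simp add: nome_def exp_of_nat_mult[symmetric] mult_ac)
    ultimately show "(\<lambda>n. a n * exp (2 * of_real pi * \<i> * of_nat n * z / of_nat 1)) sums f z" by simp
  qed
  then show ?thesis using that unfolding has_q_expansion_1_iff by blast
qed

text \<open>Modularity for the full group bundled with the expansion itself; an expansion in
  nonnegative powers of \<open>q\<close> already contains holomorphy on the half plane and at
  infinity.\<close>

definition level_one :: "nat \<Rightarrow> (complex \<Rightarrow> complex) \<Rightarrow> complex fps \<Rightarrow> bool" where
  "level_one w f F \<longleftrightarrow> qexp f F \<and>
     (\<forall>A\<in>carrier SL2Z. \<forall>z\<in>upper_half_plane. f (mobius A z) = automorphy_factor A z ^ w * f z)"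

lemma level_one_diff: "level_one w f F \<Longrightarrow> level_one w g G \<Longrightarrow> level_one w (\<lambda>z. f z - g z) (F - G)"
  using qexp_diff[of f F g G] by (simp add: level_one_def right_diff_distrib)

lemma level_one_cmult: "level_one w f F \<Longrightarrow> level_one w (\<lambda>z. c * f z) (fps_const c * F)"
  using qexp_cmult[of f F c] by (simp add: level_one_def mult.left_commute)

lemma level_one_mult: "level_one w f F \<Longrightarrow> level_one v g G \<Longrightarrow> level_one (w + v) (\<lambda>z. f z * g z) (F * G)"
  using qexp_mult[of f F g G] by (simp add: level_one_def power_add mult_ac)

lemma level_one_const: "level_one 0 (\<lambda>_. c) (fps_const c)"
  using qexp_const[of c] by (simp add: level_one_def)

lemma level_one_power: "level_one w f F \<Longrightarrow> level_one (w * n) (\<lambda>z. f z ^ n) (F ^ n)"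
  using qexp_power[of f F n] by (simp add: level_one_def power_mult_distrib power_mult)

text \<open>Siegel's argument: compare \<open>|f| y\<^bsup>w/2\<^esup>\<close> at its maximum with the maximum modulus principle
  for \<open>f / q\<^sup>n\<close>. The constant 10 replaces \<open>2 \<pi> \<surd>3 = 10.88\<dots>\<close>.\<close>

lemma level_one_vanishing:
  assumes f: "level_one w f F" and n: "n > 0" and ord: "\<And>i. i < n \<Longrightarrow> fps_nth F i = 0" and wn: "w < 10 * n"
  shows "F = 0"
proof (rule ccontr)
  assume F0: "F \<noteq> 0"
  have q: "qexp f F" using f by (simp add: level_one_def)
  have tr: "f (mobius A z) = automorphy_factor A z ^ w * f z" if "A \<in> carrier SL2Z" "z \<in> upper_half_plane" for A z
    using f that by (simp add: level_one_def)
  \<comment> \<open>The square of Siegel's invariant function, which avoids half-integral powers of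
    the imaginary part.\<close>
  define \<phi> where "\<phi> z = (cmod (f z))^2 * Im z ^ w" for z
  have inv: "\<phi> (mobius A z) = \<phi> z" if A: "A \<in> carrier SL2Z" and z: "z \<in> upper_half_plane" for A z
  proof -
    define r where "r = cmod (automorphy_factor A z)"
    have "r \<noteq> 0" unfolding r_def using automorphy_factor_nonzero[OF A z] by simp
    have "\<phi> (mobius A z) = (r ^ w * cmod (f z))^2 * (Im z / r^2) ^ w"
      by (simp add: \<phi>_def tr[OF A z] Im_mobius[OF A] norm_mult norm_power r_def)
    also have "\<dots> = \<phi> z" using \<open>r \<noteq> 0\<close>
      by (simp add: \<phi>_def power_mult_distrib power_divide power_mult[symmetric] mult.commute)
    finally show ?thesis .
  qed
  define G where "G = fps_shift n F"
  have FG: "F = fps_X ^ n * G"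
    using ord by (intro fps_ext) (simp add: G_def fps_X_power_mult_nth)
  have radG: "fps_conv_radius G \<ge> 1" using q by (simp add: G_def qexp_def)
  have inball: "ball (0::complex) 1 \<subseteq> eball 0 (fps_conv_radius G)"
  proof
    fix x :: complex assume "x \<in> ball 0 1"
    then show "x \<in> eball 0 (fps_conv_radius G)" using less_conv_radius[OF _ radG] by simp
  qed
  have fG: "f z = nome z ^ n * eval_fps G (nome z)" if "z \<in> upper_half_plane" for z
  proof -
    have "ereal (norm (nome z)) < fps_conv_radius G"
      using norm_nome_less_1[OF that] inball by (auto simp: subset_iff)
    then have "eval_fps (fps_X ^ n * G) (nome z) = eval_fps (fps_X ^ n) (nome z) * eval_fps G (nome z)"
      by (intro eval_fps_mult) auto
    then show ?thesis using q that by (simp add: qexp_def FG)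
  qed
  have holG: "eval_fps G holomorphic_on ball 0 1" using inball by (intro holomorphic_on_eval_fps)
  have contf: "continuous_on upper_half_plane f"
    using qexp_holomorphic[OF q] by (rule holomorphic_on_imp_continuous_on)
  have "\<exists>z\<in>upper_half_plane. f z \<noteq> 0"
  proof (rule ccontr)
    assume "\<not> ?thesis"
    then have "qexp f 0" using qexp_cong[OF qexp_const[of 0], of f] by (auto simp: fps_const_0_eq_0)
    then show False using qexp_unique[OF q] F0 by blast
  qed
  then obtain z' where z': "z' \<in> upper_half_plane" "f z' \<noteq> 0" by blast
  obtain A1 where A1: "A1 \<in> carrier SL2Z" "\<bar>Re (mobius A1 z')\<bar> \<le> 1/2" "(Im (mobius A1 z'))^2 \<ge> 3/4"
    using reduction_to_fundamental_domain[OF z'(1)] by blast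
  define z1 where "z1 = mobius A1 z'"
  have z1H: "z1 \<in> upper_half_plane" unfolding z1_def using mobius_upper_half_plane A1(1) z'(1) by blast
  have "f z1 \<noteq> 0" using tr[OF A1(1) z'(1)] automorphy_factor_nonzero[OF A1(1) z'(1)] z'(2) by (simp add: z1_def)
  then have \<phi>z1: "\<phi> z1 > 0" using z1H by (simp add: \<phi>_def upper_half_plane_iff)
  \<comment> \<open>As \<open>F\<close> has no constant term, the invariant function tends to 0 at
    infinity; its supremum is thus attained in a compact part of the fundamental domain.\<close>
  have high: "\<exists>Y. \<forall>z. Im z \<ge> Y \<longrightarrow> \<phi> z < \<phi> z1"
  proof -
    have "compact (eval_fps G ` cball 0 (exp (- 2 * pi)))"
    proof (intro compact_continuous_image continuous_on_subset[OF holomorphic_on_imp_continuous_on[OF holG]])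
      have "exp (- 2 * pi) < (1::real)" by simp
      then show "cball (0::complex) (exp (- 2 * pi)) \<subseteq> ball 0 1" by (intro subsetI) (simp only: mem_cball mem_ball)
    qed auto
    then have "bounded (eval_fps G ` cball 0 (exp (- 2 * pi)))" by (rule compact_imp_bounded)
    then obtain C where C': "\<forall>x \<in> eval_fps G ` cball 0 (exp (- 2 * pi)). norm x \<le> C"
      unfolding bounded_iff by blast
    have C: "cmod (eval_fps G x) \<le> C" if "x \<in> cball 0 (exp (- 2 * pi))" for x
      using C' that by (simp only: ball_simps)
    have "((\<lambda>y. C^2 * (y ^ w / exp y)) \<longlongrightarrow> C^2 * 0) at_top"
      by (intro tendsto_intros tendsto_power_div_exp_0)
    then have "eventually (\<lambda>y. C^2 * (y ^ w / exp y) < \<phi> z1) at_top"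
      using \<phi>z1 by (intro order_tendstoD) auto
    then have "eventually (\<lambda>y. y \<ge> 1 \<and> C^2 * (y ^ w / exp y) < \<phi> z1) at_top"
      by (intro eventually_conj eventually_ge_at_top)
    then obtain Y where Y: "\<And>y. y \<ge> Y \<Longrightarrow> y \<ge> 1 \<and> C^2 * (y ^ w / exp y) < \<phi> z1"
      unfolding eventually_at_top_linorder by blast
    show ?thesis
    proof (intro exI[of _ Y] allI impI)
      fix z :: complex assume z: "Im z \<ge> Y"
      then have y: "Im z \<ge> 1" using Y by blast
      then have zH: "z \<in> upper_half_plane" by (simp add: upper_half_plane_iff)
      have nz: "norm (nome z) \<le> exp (- 2 * pi)" using y by (simp add: norm_nome)
      have "cmod (f z) = norm (nome z) ^ n * cmod (eval_fps G (nome z))"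
        by (simp add: fG[OF zH] norm_mult norm_power)
      also have "\<dots> \<le> norm (nome z) ^ 1 * C"
        using nz C[of "nome z"] norm_nome_less_1[OF zH] n by (intro mult_mono power_decreasing) auto
      finally have "(cmod (f z))^2 \<le> (norm (nome z) * C)^2" by (intro power_mono) auto
      also have "\<dots> = C^2 * (norm (nome z))^2" by (simp add: power_mult_distrib mult.commute)
      also have "(norm (nome z))^2 = exp (- (4 * pi * Im z))"
        by (simp add: norm_nome power2_eq_square exp_add[symmetric])
      also have "exp (- (4 * pi * Im z)) \<le> exp (- Im z)" using y pi_ge_3 by simp
      finally have "(cmod (f z))^2 \<le> C^2 * exp (- Im z)" by (simp add: mult_left_mono)
      then have "\<phi> z \<le> C^2 * exp (- Im z) * Im z ^ w"
        unfolding \<phi>_def using y by (intro mult_right_mono) auto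
      also have "\<dots> = C^2 * (Im z ^ w / exp (Im z))" by (simp add: exp_minus field_simps)
      also have "\<dots> < \<phi> z1" using Y z by blast
      finally show "\<phi> z < \<phi> z1" .
    qed
  qed
  then obtain Y where Y: "\<And>z. Im z \<ge> Y \<Longrightarrow> \<phi> z < \<phi> z1" by blast
  define y0 where "y0 = sqrt (3/4)"
  have y0: "y0 > 43/50" unfolding y0_def by (rule real_less_rsqrt) (simp add: power2_eq_square)
  define K where "K = cbox (Complex (-1/2) y0) (Complex (1/2) Y)"
  have KH: "K \<subseteq> upper_half_plane"
    using y0 by (auto simp: K_def upper_half_plane_iff in_cbox_complex_iff)
  have dom: "z \<in> K \<or> \<phi> z < \<phi> z1" if "\<bar>Re z\<bar> \<le> 1/2" "(Im z)^2 \<ge> 3/4" "z \<in> upper_half_plane" for z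
  proof -
    have "Im z \<ge> y0" unfolding y0_def using that by (intro real_le_lsqrt) (auto simp: upper_half_plane_iff)
    then show ?thesis using that(1) Y[of z] by (cases "Im z \<ge> Y") (auto simp: K_def in_cbox_complex_iff)
  qed
  have z1K: "z1 \<in> K" using dom[of z1] A1 z1H by (auto simp: z1_def)
  have "continuous_on K \<phi>"
    unfolding \<phi>_def by (intro continuous_intros continuous_on_subset[OF contf KH])
  then obtain z0 where z0: "z0 \<in> K" "\<And>z. z \<in> K \<Longrightarrow> \<phi> z \<le> \<phi> z0"
    using continuous_attains_sup[of K \<phi>] z1K by (auto simp: K_def)
  have max: "\<phi> z \<le> \<phi> z0" if z: "z \<in> upper_half_plane" for z
  proof -
    obtain A where A: "A \<in> carrier SL2Z" "\<bar>Re (mobius A z)\<bar> \<le> 1/2" "(Im (mobius A z))^2 \<ge> 3/4"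
      using reduction_to_fundamental_domain[OF z] by blast
    have "\<phi> (mobius A z) \<le> \<phi> z0"
      using dom[OF A(2,3) mobius_upper_half_plane[OF A(1) z]] z0 z1K by fastforce
    then show ?thesis using inv[OF A(1) z] by simp
  qed
  have z0H: "z0 \<in> upper_half_plane" using z0(1) KH by blast
  define t where "t = Im z0"
  have t: "t > 43/50" using z0(1) y0 by (simp add: K_def in_cbox_complex_iff t_def)
  have fz0: "cmod (f z0) > 0"
    using z0(2)[OF z1K] \<phi>z1 t by (auto simp: \<phi>_def)
  \<comment> \<open>A rational number just below half the square root of 3, so \<open>z0\<close>
    lies strictly above height \<open>y1\<close>. With \<open>pi_ge_3\<close>,
    \<open>4 * pi * y1\<close> is at least 10.32, which is where the constant 10 comes from.\<close>
  define y1 where "y1 = (43/50 :: real)"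
  have y1: "y1 > 0" by (simp add: y1_def)
  define r1 where "r1 = exp (- 2 * pi * y1)"
  have r1: "r1 > 0" "r1 < 1" by (auto simp: r1_def y1_def)
  define M where "M = cmod (f z0) * sqrt ((t / y1) ^ w) / r1 ^ n"
  have "norm (eval_fps G (nome z0)) \<le> M"
  proof (rule maximum_modulus_frontier[of "eval_fps G" "ball 0 r1"])
    show "eval_fps G holomorphic_on interior (ball 0 r1)"
      using r1 by (intro holomorphic_on_subset[OF holG]) (auto simp: interior_open)
    show "continuous_on (closure (ball 0 r1)) (eval_fps G)"
      using r1 by (intro continuous_on_subset[OF holomorphic_on_imp_continuous_on[OF holG]]) auto
    show "nome z0 \<in> ball 0 r1" using t pi_ge_3 by (simp add: norm_nome r1_def y1_def t_def)
    fix x :: complex assume "x \<in> frontier (ball 0 r1)"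
    then have x: "norm x = r1" using r1 by simp
    then have "x \<noteq> 0" "norm x < 1" using r1 by auto
    then obtain z where z: "z \<in> upper_half_plane" "nome z = x" by (rule nome_surj)
    have "exp (- 2 * pi * Im z) = exp (- 2 * pi * y1)" using x z(2) norm_nome[of z] by (simp add: r1_def)
    then have imz: "Im z = y1" using pi_ge_3 by simp
    have "\<phi> z \<le> \<phi> z0" using max[OF z(1)] .
    then have "(cmod (f z))^2 * y1 ^ w \<le> (cmod (f z0))^2 * t ^ w" by (simp add: \<phi>_def imz t_def)
    then have "(cmod (f z))^2 \<le> (cmod (f z0))^2 * (t / y1) ^ w"
      using y1 by (simp add: power_divide pos_le_divide_eq)
    then have "sqrt ((cmod (f z))^2) \<le> sqrt ((cmod (f z0))^2 * (t / y1) ^ w)" by (rule real_sqrt_le_mono)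
    then have "cmod (f z) \<le> cmod (f z0) * sqrt ((t / y1) ^ w)" by (simp add: real_sqrt_mult)
    moreover have "cmod (f z) = r1 ^ n * cmod (eval_fps G x)"
      using fG[OF z(1)] z(2) x by (simp add: norm_mult norm_power)
    ultimately show "cmod (eval_fps G x) \<le> M"
      using r1 by (simp add: M_def pos_le_divide_eq mult.commute)
  qed auto
  then have "cmod (f z0) \<le> norm (nome z0) ^ n * M"
    using fG[OF z0H] by (simp add: norm_mult norm_power mult_left_mono)
  then have "cmod (f z0) * 1 \<le> cmod (f z0) * (norm (nome z0) ^ n * sqrt ((t / y1) ^ w) / r1 ^ n)"
    by (simp add: M_def mult_ac)
  then have "1 \<le> norm (nome z0) ^ n * sqrt ((t / y1) ^ w) / r1 ^ n" by (simp only: mult_le_cancel_left_pos[OF fz0])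
  then have "r1 ^ n \<le> norm (nome z0) ^ n * sqrt ((t / y1) ^ w)" using r1 by (simp add: pos_le_divide_eq)
  then have "(r1 ^ n)^2 \<le> (norm (nome z0) ^ n * sqrt ((t / y1) ^ w))^2" using r1 by (intro power_mono) auto
  then have "(r1^2) ^ n \<le> ((norm (nome z0))^2) ^ n * (t / y1) ^ w"
    using t y1 by (simp add: power_mult_distrib power_mult[symmetric] mult.commute)
  also have "r1^2 = exp (- 4 * pi * y1)" by (simp add: r1_def power2_eq_square exp_add[symmetric])
  also have "(norm (nome z0))^2 = exp (- 4 * pi * t)" by (simp add: norm_nome t_def power2_eq_square exp_add[symmetric])
  finally have "exp (real n * (- 4 * pi * y1)) \<le> exp (real n * (- 4 * pi * t)) * (t / y1) ^ w"
    by (simp only: exp_of_nat_mult)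
  \<comment> \<open>The inequality \<open>s \<le> exp (s - 1)\<close> makes both sides exponentials
    of expressions linear in \<open>t - y1\<close>, a positive factor that can then be
    cancelled.\<close>
  also have "(t / y1) ^ w \<le> exp (t / y1 - 1) ^ w"
    using t exp_ge_add_one_self[of "t / y1 - 1"] by (intro power_mono) (auto simp: y1_def)
  also have "\<dots> = exp (real w * (t / y1 - 1))" by (simp only: exp_of_nat_mult)
  finally have "exp (real n * (- 4 * pi * y1)) \<le> exp (real n * (- 4 * pi * t) + real w * (t / y1 - 1))"
    using t by (simp only: exp_add mult_left_mono exp_ge_zero)
  then have "real n * (- 4 * pi * y1) \<le> real n * (- 4 * pi * t) + real w * (t / y1 - 1)" by (simp only: exp_le_cancel_iff)
  then have "real n * (4 * pi) * (t - y1) \<le> real w / y1 * (t - y1)"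
  proof -
    have "real w * (t / y1 - 1) = real w / y1 * (t - y1)" using y1 by (simp add: diff_divide_distrib right_diff_distrib)
    then show ?thesis using \<open>real n * (- 4 * pi * y1) \<le> _\<close> by (simp add: right_diff_distrib)
  qed
  moreover have ty: "t - y1 > 0" using t by (simp add: y1_def)
  ultimately have "real n * (4 * pi) \<le> real w / y1" by (simp only: mult_le_cancel_right_pos)
  then have "real n * (4 * pi * y1) \<le> real w" using y1 by (simp add: pos_le_divide_eq mult.assoc)
  moreover have "real n * 10 < real n * (4 * pi * y1)" using n pi_ge_3 by (intro mult_strict_left_mono) (auto simp: y1_def)
  ultimately have "real n * 10 < real w" by linarith
  then show False using wn by simp
qed

section \<open>Eisenstein series\<close>

lemma has_sum_of_sums:
  fixes f :: "nat \<Rightarrow> 'a::{topological_comm_monoid_add,t2_space}"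
  assumes "f summable_on UNIV" "f sums s" shows "(f has_sum s) UNIV"
proof -
  have "(f has_sum infsum f UNIV) UNIV" using assms(1) by simp
  moreover from has_sum_imp_sums[OF this] have "infsum f UNIV = s" using assms(2) by (rule sums_unique2)
  ultimately show ?thesis by simp
qed

lemma UNIV_int_split: "(UNIV :: int set) = range int \<union> range (\<lambda>k. - 1 - int k)"
proof -
  have "j \<in> range int \<union> range (\<lambda>k. - 1 - int k)" for j
  proof (cases "j \<ge> 0")
    case True then have "j = int (nat j)" by simp
    then show ?thesis by blast
  next
    case False then have "j = - 1 - int (nat (- 1 - j))" by simp
    then show ?thesis by blast
  qed
  then show ?thesis by blast
qed

lemma has_sum_int_iff:
  fixes f :: "int \<Rightarrow> complex"
  assumes "((\<lambda>k. f (int k)) has_sum a) UNIV" "((\<lambda>k. f (- 1 - int k)) has_sum b) UNIV"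
  shows "(f has_sum (a + b)) UNIV"
  unfolding UNIV_int_split
proof (rule has_sum_Un_disjoint)
  show "(f has_sum a) (range int)" using assms(1) by (subst has_sum_reindex) (auto simp: o_def)
  show "(f has_sum b) (range (\<lambda>k. - 1 - int k))" using assms(2) by (subst has_sum_reindex) (auto simp: o_def inj_def)
qed auto

lemma summable_on_int_halves:
  fixes f :: "int \<Rightarrow> complex"
  assumes "f summable_on UNIV"
  shows "(\<lambda>k. f (int k)) summable_on UNIV" "(\<lambda>k. f (- 1 - int k)) summable_on UNIV"
proof -
  have "f summable_on range int" "f summable_on range (\<lambda>k. - 1 - int k)"
    using summable_on_subset_banach[OF assms] by auto
  then show "(\<lambda>k. f (int k)) summable_on UNIV" "(\<lambda>k. f (- 1 - int k)) summable_on UNIV"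
    using summable_on_reindex[of int UNIV f] summable_on_reindex[of "\<lambda>k. - 1 - int k" UNIV f]
    by (simp_all add: o_def inj_def)
qed

lemma summable_on_int_inverse_square: "(\<lambda>j::int. 1 / (1 + real_of_int \<bar>j\<bar>)^2) summable_on UNIV"
proof -
  have "summable (\<lambda>k. 1 / (1 + real k)^2)"
    using inverse_squares_sums by (simp add: sums_iff add.commute)
  then have s: "(\<lambda>k. 1 / (1 + real k)^2) summable_on UNIV"
    by (intro summable_nonneg_imp_summable_on) auto
  have "(\<lambda>j::int. 1 / (1 + real_of_int \<bar>j\<bar>)^2) summable_on range int"
    using s by (subst summable_on_reindex) (auto simp: o_def)
  moreover have "(\<lambda>j::int. 1 / (1 + real_of_int \<bar>j\<bar>)^2) summable_on range (\<lambda>k. - 1 - int k)"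
  proof (subst summable_on_reindex)
    show "(\<lambda>j. 1 / (1 + real_of_int \<bar>j\<bar>)\<^sup>2) \<circ> (\<lambda>k. - 1 - int k) summable_on UNIV"
    proof (rule summable_on_comparison_test[OF s])
      fix k :: nat
      have "real_of_int \<bar>- 1 - int k\<bar> = 1 + real k" by simp
      then show "((\<lambda>j. 1 / (1 + real_of_int \<bar>j\<bar>)\<^sup>2) \<circ> (\<lambda>k. - 1 - int k)) k \<le> 1 / (1 + real k)^2"
        by (simp add: frac_le power_mono)
    qed simp
  qed (auto simp: inj_def)
  ultimately show ?thesis unfolding UNIV_int_split by (rule summable_on_Un_disjoint) auto
qed

text \<open>For \<open>k > 0\<close> the origin contributes \<open>inverse 0 = 0\<close>, so lattice
  sums can run over all pairs of integers.\<close>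

definition lattice_term :: "nat \<Rightarrow> complex \<Rightarrow> int \<times> int \<Rightarrow> complex" where
  "lattice_term k z = (\<lambda>(m, n). inverse ((of_int m * z + of_int n) ^ k))"

text \<open>The size \<open>s = |m| + |n|\<close> is at most a constant times
  \<open>|m z + n|\<close>. Since \<open>s ^ k\<close> dominates \<open>s ^ 4\<close> for
  \<open>s \<ge> 1\<close>, comparison with a product of two inverse squares is possible; the factor
  16 comes from bounding each of \<open>1 + |m|\<close> and \<open>1 + |n|\<close> by
  \<open>2 * s\<close> and squaring the product.\<close>

lemma lattice_term_summable:
  assumes z: "z \<in> upper_half_plane" and k: "k \<ge> 4"
  shows "lattice_term k z summable_on UNIV"
proof -
  have y: "Im z > 0" using z by (simp add: upper_half_plane_iff)
  define C where "C = 1 / Im z + (1 + cmod z / Im z)"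
  have C1: "C \<ge> 1" using y by (simp add: C_def)
  have bound: "real_of_int \<bar>m\<bar> + real_of_int \<bar>n\<bar> \<le> C * cmod (of_int m * z + of_int n)" for m n
  proof -
    define w where "w = of_int m * z + of_int n"
    have "\<bar>of_int m * Im z\<bar> \<le> cmod w" using abs_Im_le_cmod[of w] by (simp add: w_def)
    then have 1: "real_of_int \<bar>m\<bar> \<le> cmod w / Im z" using y by (simp add: abs_mult pos_le_divide_eq)
    have "cmod (of_int n) \<le> cmod w + cmod (of_int m * z)"
      using norm_triangle_ineq4[of w "of_int m * z"] by (simp add: w_def)
    also have "cmod (of_int m * z) = real_of_int \<bar>m\<bar> * cmod z" by (simp add: norm_mult)
    also have "\<dots> \<le> cmod w / Im z * cmod z" using 1 by (intro mult_right_mono) auto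
    finally have "real_of_int \<bar>n\<bar> \<le> cmod w + cmod w / Im z * cmod z" by simp
    then have "real_of_int \<bar>m\<bar> + real_of_int \<bar>n\<bar> \<le> cmod w / Im z + (cmod w + cmod w / Im z * cmod z)" using 1 by simp
    also have "\<dots> = C * cmod w" by (simp add: C_def algebra_simps)
    finally show ?thesis by (simp add: w_def)
  qed
  define B where "B = (\<lambda>v :: int \<times> int. (16 * C ^ k) * ((1 / (1 + real_of_int \<bar>fst v\<bar>)^2) * (1 / (1 + real_of_int \<bar>snd v\<bar>)^2)))"
  have sB: "B summable_on UNIV"
  proof -
    have "(\<lambda>v. (1 / (1 + real_of_int \<bar>fst v\<bar>)^2) * (1 / (1 + real_of_int \<bar>snd v\<bar>)^2)) summable_on Sigma (UNIV::int set) (\<lambda>_. UNIV :: int set)"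
    proof (rule summable_on_SigmaI)
      fix x :: int
      show "((\<lambda>y. 1 / (1 + real_of_int \<bar>fst (x, y)\<bar>)\<^sup>2 * (1 / (1 + real_of_int \<bar>snd (x, y)\<bar>)\<^sup>2)) has_sum
          (1 / (1 + real_of_int \<bar>x\<bar>)\<^sup>2 * infsum (\<lambda>y. 1 / (1 + real_of_int \<bar>y\<bar>)\<^sup>2) UNIV)) UNIV"
        unfolding fst_conv snd_conv by (intro has_sum_cmult_right has_sum_infsum summable_on_int_inverse_square)
      show "(\<lambda>x. 1 / (1 + real_of_int \<bar>x\<bar>)\<^sup>2 * infsum (\<lambda>y. 1 / (1 + real_of_int \<bar>y\<bar>)\<^sup>2) UNIV) summable_on UNIV"
        by (intro summable_on_cmult_left summable_on_int_inverse_square)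
    qed auto
    then have "B summable_on Sigma (UNIV::int set) (\<lambda>_. UNIV :: int set)"
      unfolding B_def by (rule summable_on_cmult_right)
    then show ?thesis by simp
  qed
  have "(\<lambda>v. norm (lattice_term k z v)) summable_on UNIV"
  proof (rule summable_on_comparison_test[OF sB])
    fix v :: "int \<times> int"
    obtain m n where v: "v = (m, n)" by (cases v)
    define s where "s = real_of_int \<bar>m\<bar> + real_of_int \<bar>n\<bar>"
    show "norm (lattice_term k z v) \<le> B v"
    proof (cases "m = 0 \<and> n = 0")
      case True
      have "C ^ k \<ge> 0" using C1 by simp
      then show ?thesis using True k by (simp add: v lattice_term_def B_def zero_power)
    next
      case False
      then have "\<bar>m\<bar> + \<bar>n\<bar> \<ge> 1" by linarith
      then have s1: "s \<ge> 1" unfolding s_def by linarith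
      define w where "w = cmod (of_int m * z + of_int n)"
      have sw: "s \<le> C * w" using bound[of m n] by (simp add: s_def w_def)
      have w0: "w > 0"
      proof (rule ccontr)
        assume "\<not> w > 0"
        then have "w = 0" by (simp add: w_def)
        then show False using sw s1 by simp
      qed
      have "(1 + real_of_int \<bar>m\<bar>) * (1 + real_of_int \<bar>n\<bar>) \<le> (2 * s) * (2 * s)"
        using s1 unfolding s_def by (intro mult_mono) auto
      then have "((1 + real_of_int \<bar>m\<bar>) * (1 + real_of_int \<bar>n\<bar>))^2 \<le> ((2 * s) * (2 * s))^2"
        by (intro power_mono) auto
      also have "\<dots> = 16 * s ^ 4" by (simp add: power2_eq_square power4_eq_xxxx)
      also have "s ^ 4 \<le> s ^ k" using s1 k by (intro power_increasing) auto
      also have "s ^ k \<le> (C * w) ^ k" using sw s1 by (intro power_mono) auto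
      finally have le: "((1 + real_of_int \<bar>m\<bar>) * (1 + real_of_int \<bar>n\<bar>))^2 \<le> 16 * C ^ k * w ^ k"
        by (simp add: power_mult_distrib)
      define D where "D = ((1 + real_of_int \<bar>m\<bar>) * (1 + real_of_int \<bar>n\<bar>))^2"
      have "D > 0" unfolding D_def by (intro zero_less_power mult_pos_pos) auto
      have "w ^ k > 0" using w0 by simp
      then have "D / w ^ k \<le> 16 * C ^ k" using le by (simp add: pos_divide_le_eq D_def)
      then have "D / w ^ k * (1 / D) \<le> (16 * C ^ k) * (1 / D)"
        using \<open>D > 0\<close> by (intro mult_right_mono) auto
      moreover have "D / x * (1 / D) = inverse x" for x
        using \<open>D > 0\<close> by (cases "x = 0") (simp_all add: field_simps)
      ultimately have "inverse (w ^ k) \<le> (16 * C ^ k) * (1 / D)" by simp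
      then show ?thesis
        by (simp add: v lattice_term_def B_def norm_inverse norm_power w_def D_def power_mult_distrib)
    qed
  qed simp
  then show ?thesis by (rule abs_summable_summable)
qed

lemma lattice_row_summable:
  assumes "z \<in> upper_half_plane" "k \<ge> 4"
  shows "(\<lambda>n. lattice_term k z (m, n)) summable_on UNIV"
proof -
  have "lattice_term k z summable_on range (Pair m)"
    using summable_on_subset_banach[OF lattice_term_summable[OF assms]] by simp
  then show ?thesis by (subst (asm) summable_on_reindex) (auto simp: o_def inj_def)
qed

definition eisenstein_G :: "nat \<Rightarrow> complex \<Rightarrow> complex" where
  "eisenstein_G k z = infsum (lattice_term k z) UNIV"

text \<open>Right multiplication by \<open>A\<close> permutes the lattice of integer pairs; absolute
  summability permits the reindexing.\<close>

lemma eisenstein_G_transform: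
  assumes A: "A \<in> carrier SL2Z" and z: "z \<in> upper_half_plane" and k: "k \<ge> 4"
  shows "eisenstein_G k (mobius A z) = automorphy_factor A z ^ k * eisenstein_G k z"
proof -
  define g where "g = (\<lambda>(m, n). (m * (A$1$1) + n * (A$2$1), m * (A$1$2) + n * (A$2$2)))"
  define h where "h = (\<lambda>(m, n). (m * (A$2$2) - n * (A$2$1), n * (A$1$1) - m * (A$1$2)))"
  have d: "A$1$1 * A$2$2 - A$1$2 * A$2$1 = 1" using A by (simp add: SL2Z_iff)
  have e1: "x * (A$1$1 * A$2$2 - A$1$2 * A$2$1) = x" for x using d by simp
  have bij: "bij_betw g UNIV UNIV"
  proof (rule bij_betw_byWitness[where f' = h])
    show "\<forall>a\<in>UNIV. h (g a) = a"
    proof (clarify)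
      fix m n
      have "(m * A$1$1 + n * A$2$1) * A$2$2 - (m * A$1$2 + n * A$2$2) * A$2$1 = m"
        using e1[of m] by (simp add: algebra_simps)
      moreover have "(m * A$1$2 + n * A$2$2) * A$1$1 - (m * A$1$1 + n * A$2$1) * A$1$2 = n"
        using e1[of n] by (simp add: algebra_simps)
      ultimately show "h (g (m, n)) = (m, n)" by (simp add: g_def h_def)
    qed
    show "\<forall>a\<in>UNIV. g (h a) = a"
    proof (clarify)
      fix m n
      have "(m * A$2$2 - n * A$2$1) * A$1$1 + (n * A$1$1 - m * A$1$2) * A$2$1 = m"
        using e1[of m] by (simp add: algebra_simps)
      moreover have "(m * A$2$2 - n * A$2$1) * A$1$2 + (n * A$1$1 - m * A$1$2) * A$2$2 = n"
        using e1[of n] by (simp add: algebra_simps)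
      ultimately show "g (h (m, n)) = (m, n)" by (simp add: g_def h_def)
    qed
  qed auto
  have nz: "of_int (A$2$1) * z + of_int (A$2$2) \<noteq> 0"
    using automorphy_factor_nonzero[OF A z] by (simp add: automorphy_factor_def)
  have "lattice_term k (mobius A z) v = automorphy_factor A z ^ k * lattice_term k z (g v)" for v
  proof -
    obtain m n where v: "v = (m, n)" by (cases v)
    have "of_int m * mobius A z + of_int n = (of_int (fst (g v)) * z + of_int (snd (g v))) / automorphy_factor A z"
      using nz by (simp add: v g_def mobius_def automorphy_factor_def field_simps)
    then show ?thesis by (simp add: v lattice_term_def case_prod_unfold power_divide field_simps)
  qed
  then have "lattice_term k (mobius A z) = (\<lambda>v. automorphy_factor A z ^ k * lattice_term k z (g v))" by (rule ext)
  then have "eisenstein_G k (mobius A z) = infsum (\<lambda>v. automorphy_factor A z ^ k * lattice_term k z (g v)) UNIV"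
    by (simp only: eisenstein_G_def)
  also have "\<dots> = automorphy_factor A z ^ k * infsum (\<lambda>v. lattice_term k z (g v)) UNIV"
    by (rule infsum_cmult_right')
  also have "infsum (\<lambda>v. lattice_term k z (g v)) UNIV = eisenstein_G k z"
    unfolding eisenstein_G_def by (rule infsum_reindex_bij_betw[OF bij])
  finally show ?thesis .
qed

text \<open>For \<open>n = 0\<close> the convention \<open>0 ^ 0 = 1\<close> makes this the full
  geometric series. The others arise from it by iterating \<open>q d/dq\<close>.\<close>

definition pow_fps :: "nat \<Rightarrow> complex fps" where
  "pow_fps n = Abs_fps (\<lambda>r. of_nat r ^ n)"

lemma pow_fps_Suc: "pow_fps (Suc n) = fps_X * fps_deriv (pow_fps n)"
proof (rule fps_ext)
  fix i show "fps_nth (pow_fps (Suc n)) i = fps_nth (fps_X * fps_deriv (pow_fps n)) i"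
    by (cases i) (simp_all add: pow_fps_def)
qed

lemma pow_fps_conv_radius: "fps_conv_radius (pow_fps n) \<ge> 1"
proof (induction n)
  case 0
  show ?case unfolding fps_conv_radius_def
  proof (rule conv_radius_geI_ex')
    fix r :: real assume "0 < r" "ereal r < 1"
    then show "summable (\<lambda>i. fps_nth (pow_fps 0) i * of_real r ^ i)"
      by (simp add: pow_fps_def summable_geometric)
  qed
next
  case (Suc n)
  have "fps_conv_radius (fps_deriv (pow_fps n)) \<ge> 1"
    using Suc fps_conv_radius_deriv[of "pow_fps n"] by (rule order_trans)
  then have "1 \<le> min (fps_conv_radius (fps_X :: complex fps)) (fps_conv_radius (fps_deriv (pow_fps n)))" by simp
  also have "\<dots> \<le> fps_conv_radius (pow_fps (Suc n))" unfolding pow_fps_Suc by (rule fps_conv_radius_mult)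
  finally show ?case .
qed

lemma eval_pow_fps_0: assumes "norm q < 1" shows "eval_fps (pow_fps 0) q = 1 / (1 - q)"
  using geometric_sums[OF assms] by (simp add: eval_fps_def pow_fps_def sums_iff)

lemma eval_pow_fps_deriv:
  assumes "norm q < 1"
  shows "(eval_fps (pow_fps n) has_field_derivative eval_fps (fps_deriv (pow_fps n)) q) (at q)"
    and "eval_fps (pow_fps (Suc n)) q = q * eval_fps (fps_deriv (pow_fps n)) q"
proof -
  have r: "ereal (norm q) < fps_conv_radius (pow_fps n)"
    by (rule less_conv_radius[OF assms pow_fps_conv_radius])
  then show "(eval_fps (pow_fps n) has_field_derivative eval_fps (fps_deriv (pow_fps n)) q) (at q)"
    by (intro has_field_derivative_eval_fps) auto
  have "ereal (norm q) < fps_conv_radius (fps_deriv (pow_fps n))"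
    by (rule less_le_trans[OF r fps_conv_radius_deriv])
  then show "eval_fps (pow_fps (Suc n)) q = q * eval_fps (fps_deriv (pow_fps n)) q"
    unfolding pow_fps_Suc by (subst eval_fps_mult) auto
qed

text \<open>The \<open>n\<close>-th derivative of \<open>pi * cot (pi * w)\<close>. The polygamma
  functions supply its partial fraction series, separately for the nonnegative and the negative
  integers.\<close>

definition cot_deriv :: "nat \<Rightarrow> complex \<Rightarrow> complex" where
  "cot_deriv n w = (-1) ^ n * Polygamma n (1 - w) - Polygamma n w"

lemma not_int_upper_half_plane: "w \<in> upper_half_plane \<Longrightarrow> w \<notin> \<int>"
  by (auto simp: upper_half_plane_iff elim!: Ints_cases)

lemma cot_deriv_has_derivative:
  assumes "w \<notin> \<int>"
  shows "(cot_deriv n has_field_derivative cot_deriv (Suc n) w) (at w)"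
proof -
  have 1: "w \<notin> \<int>\<^sub>\<le>\<^sub>0" using assms nonpos_Ints_Int by blast
  have 2: "1 - w \<notin> \<int>\<^sub>\<le>\<^sub>0"
  proof
    assume "1 - w \<in> \<int>\<^sub>\<le>\<^sub>0"
    then have "1 - (1 - w) \<in> \<int>" using nonpos_Ints_Int by (intro Ints_diff) auto
    then show False using assms by simp
  qed
  show ?thesis unfolding cot_deriv_def[abs_def]
    using 1 2 by (auto intro!: derivative_eq_intros)
qed

text \<open>The derivative of the reflection formula of the Gamma function identifies the difference
  of digamma values with the cotangent, which is rational in \<open>nome w\<close>.\<close>

lemma cot_deriv_0:
  assumes w: "w \<notin> \<int>"
  shows "cot_deriv 0 w = of_real pi * \<i> - 2 * of_real pi * \<i> / (1 - nome w)"
proof -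
  define s c where "s = sin (of_real pi * w)" and "c = cos (of_real pi * w)"
  have s0: "s \<noteq> 0"
  proof
    assume "s = 0"
    then obtain n :: int where "of_real pi * w = of_real (of_int n * pi)"
      unfolding s_def Complex_Transcendental.sin_eq_0 by auto
    then have "w = of_int n" by simp
    then show False using w by simp
  qed
  have 1: "w \<notin> \<int>\<^sub>\<le>\<^sub>0" using assms nonpos_Ints_Int by blast
  have 2: "1 - w \<notin> \<int>\<^sub>\<le>\<^sub>0"
  proof
    assume "1 - w \<in> \<int>\<^sub>\<le>\<^sub>0"
    then have "1 - (1 - w) \<in> \<int>" using nonpos_Ints_Int by (intro Ints_diff) auto
    then show False using assms by simp
  qed
  have "((\<lambda>z. Gamma z * Gamma (1 - z)) has_field_derivative Gamma w * Gamma (1 - w) * (Digamma w - Digamma (1 - w))) (at w)"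
    using 1 2 by (auto intro!: derivative_eq_intros simp: algebra_simps)
  moreover have "((\<lambda>z. of_real pi / sin (of_real pi * z)) has_field_derivative (- ((of_real pi)^2 * c / s^2))) (at w)"
    using s0 unfolding s_def c_def
    by (auto intro!: derivative_eq_intros simp: power2_eq_square)
  ultimately have "Gamma w * Gamma (1 - w) * (Digamma w - Digamma (1 - w)) = - ((of_real pi)^2 * c / s^2)"
    unfolding Gamma_reflection_complex by (rule DERIV_unique)
  then have "of_real pi / s * (Digamma (1 - w) - Digamma w) = (of_real pi)^2 * c / s^2"
    unfolding Gamma_reflection_complex s_def[symmetric] by (simp add: algebra_simps)
  then have "of_real pi / s * (Digamma (1 - w) - Digamma w) = of_real pi / s * (of_real pi * c / s)"
    by (simp add: power2_eq_square)
  moreover have "of_real pi / s \<noteq> 0" using s0 by simp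
  ultimately have "Digamma (1 - w) - Digamma w = of_real pi * c / s"
    by (simp only: mult_cancel_left) simp
  then have eq: "cot_deriv 0 w = of_real pi * c / s" by (simp add: cot_deriv_def)
  define e where "e = exp (\<i> * (of_real pi * w))"
  have e0: "e \<noteq> 0" by (simp add: e_def)
  have nome: "nome w = e^2"
    by (simp add: nome_def e_def power2_eq_square exp_add[symmetric] algebra_simps)
  have s: "s = (e - inverse e) / (2 * \<i>)" and c: "c = (e + inverse e) / 2"
    by (simp_all add: s_def c_def e_def sin_exp_eq cos_exp_eq exp_minus)
  have "e^2 \<noteq> 1" using s0 e0 unfolding s by (auto simp: power2_eq_square field_simps)
  then have e1: "1 - e^2 \<noteq> 0" "e^2 - 1 \<noteq> 0" by auto
  have "c / s = \<i> * ((e + inverse e) / (e - inverse e))"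
  proof -
    have "x / 2 / (y / (2 * \<i>)) = \<i> * (x / y)" for x y :: complex
      by (cases "y = 0") (simp_all add: field_simps)
    then show ?thesis unfolding s c by blast
  qed
  also have "(e + inverse e) / (e - inverse e) = (e^2 + 1) / (e^2 - 1)"
  proof -
    have "e * (e + inverse e) = e^2 + 1" "e * (e - inverse e) = e^2 - 1"
      using e0 by (simp_all add: power2_eq_square right_diff_distrib distrib_left)
    moreover have "(e + inverse e) / (e - inverse e) = (e * (e + inverse e)) / (e * (e - inverse e))" using e0 by simp
    ultimately show ?thesis by simp
  qed
  also have "\<dots> = 1 - 2 / (1 - e^2)"
  proof -
    have "(x + 1) / (x - 1) = 1 - 2 / (1 - x)" if "x - 1 \<noteq> 0" "1 - x \<noteq> 0" for x :: complex
      using that by (simp add: field_simps)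
    then show ?thesis using e1 by blast
  qed
  finally have cs: "c / s = \<i> * (1 - 2 / (1 - e^2))" .
  have "of_real pi * c / s = of_real pi * (c / s)" by simp
  also have "\<dots> = of_real pi * \<i> - of_real pi * (\<i> * (2 / (1 - e^2)))"
    unfolding cs by (simp only: right_diff_distrib mult_1_right)
  also have "of_real pi * (\<i> * (2 / (1 - e^2))) = 2 * of_real pi * \<i> / (1 - e^2)" by simp
  finally show ?thesis unfolding eq nome .
qed

lemma cot_deriv_nome:
  "\<forall>w\<in>upper_half_plane. cot_deriv n w = (if n = 0 then of_real pi * \<i> else 0) - (2 * of_real pi * \<i>) ^ Suc n * eval_fps (pow_fps n) (nome w)"
proof (induction n)
  case 0
  show ?case
    using cot_deriv_0 not_int_upper_half_plane eval_pow_fps_0 norm_nome_less_1 by (simp add: divide_inverse)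
next
  case (Suc n)
  show ?case
  proof
    fix w assume w: "w \<in> upper_half_plane"
    define g where "g w = (if n = 0 then of_real pi * \<i> else 0) - (2 * of_real pi * \<i>) ^ Suc n * eval_fps (pow_fps n) (nome w)" for w
    have d: "(nome has_field_derivative nome w * (2 * of_real pi * \<i>)) (at w)"
      unfolding nome_def[abs_def] by (auto intro!: derivative_eq_intros)
    have "((\<lambda>w. eval_fps (pow_fps n) (nome w)) has_field_derivative eval_fps (fps_deriv (pow_fps n)) (nome w) * (nome w * (2 * of_real pi * \<i>))) (at w)"
      by (rule DERIV_chain2[OF eval_pow_fps_deriv(1)[OF norm_nome_less_1[OF w]] d])
    then have "(g has_field_derivative 0 - (2 * of_real pi * \<i>) ^ Suc n * (eval_fps (fps_deriv (pow_fps n)) (nome w) * (nome w * (2 * of_real pi * \<i>)))) (at w)"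
      unfolding g_def by (intro DERIV_diff DERIV_const DERIV_cmult)
    then have "(cot_deriv n has_field_derivative 0 - (2 * of_real pi * \<i>) ^ Suc n * (eval_fps (fps_deriv (pow_fps n)) (nome w) * (nome w * (2 * of_real pi * \<i>)))) (at w)"
      by (rule has_field_derivative_transform_within_open[OF _ open_upper_half_plane w]) (use Suc in \<open>simp add: g_def\<close>)
    then have "cot_deriv (Suc n) w = 0 - (2 * of_real pi * \<i>) ^ Suc n * (eval_fps (fps_deriv (pow_fps n)) (nome w) * (nome w * (2 * of_real pi * \<i>)))"
      using cot_deriv_has_derivative[OF not_int_upper_half_plane[OF w]] DERIV_unique by blast
    then show "cot_deriv (Suc n) w = (if Suc n = 0 then of_real pi * \<i> else 0) - (2 * of_real pi * \<i>) ^ Suc (Suc n) * eval_fps (pow_fps (Suc n)) (nome w)"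
      by (simp add: eval_pow_fps_deriv(2)[OF norm_nome_less_1[OF w]] mult_ac)
  qed
qed

text \<open>Lipschitz's formula: the same derivative of the cotangent is evaluated once by partial
  fractions and once by its expansion in \<open>q\<close>.\<close>

lemma lipschitz_formula:
  assumes w: "w \<in> upper_half_plane" and k: "k \<ge> 4" "even k"
  shows "((\<lambda>j. inverse ((w + of_int j) ^ k)) has_sum ((2 * of_real pi * \<i>) ^ k / fact (k - 1) * eval_fps (pow_fps (k - 1)) (nome w))) UNIV"
proof -
  define n where "n = k - 1"
  have kn: "k = Suc n" "n > 0" "odd n" using k by (auto simp: n_def)
  have nz: "w \<notin> \<int>" by (rule not_int_upper_half_plane[OF w])
  have row: "(\<lambda>j. inverse ((w + of_int j) ^ k)) summable_on UNIV"
    using lattice_row_summable[OF w k(1), of 1] by (simp add: lattice_term_def)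
  note halves = summable_on_int_halves[OF row]
  have w0: "w \<noteq> 0" "1 - w \<noteq> 0" using nz by auto
  have "(\<lambda>j. inverse ((w + of_nat j) ^ Suc n)) sums ((-1) ^ Suc n * Polygamma n w / fact n)"
    using w0 kn by (intro Polygamma_LIMSEQ) auto
  then have 1: "((\<lambda>j. inverse ((w + of_int (int j)) ^ k)) has_sum ((-1) ^ Suc n * Polygamma n w / fact n)) UNIV"
    using halves(1) kn(1) by (intro has_sum_of_sums) simp_all
  have "(\<lambda>j. inverse (((1 - w) + of_nat j) ^ Suc n)) sums ((-1) ^ Suc n * Polygamma n (1 - w) / fact n)"
    using w0 kn by (intro Polygamma_LIMSEQ) auto
  moreover have "inverse (((1 - w) + of_nat j) ^ Suc n) = inverse ((w + of_int (- 1 - int j)) ^ k)" for j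
  proof -
    have "(1 - w) + of_nat j = - (w + of_int (- 1 - int j))" by simp
    then have "((1 - w) + of_nat j) ^ k = (- (w + of_int (- 1 - int j))) ^ k" by (rule arg_cong)
    also have "\<dots> = (w + of_int (- 1 - int j)) ^ k" using k(2) by (rule power_minus_even)
    finally show ?thesis using kn(1) by simp
  qed
  ultimately have "(\<lambda>j. inverse ((w + of_int (- 1 - int j)) ^ k)) sums ((-1) ^ Suc n * Polygamma n (1 - w) / fact n)"
    by simp
  then have 2: "((\<lambda>j. inverse ((w + of_int (- 1 - int j)) ^ k)) has_sum ((-1) ^ Suc n * Polygamma n (1 - w) / fact n)) UNIV"
    using halves(2) by (intro has_sum_of_sums)
  have "((\<lambda>j. inverse ((w + of_int j) ^ k)) has_sum ((-1) ^ Suc n * Polygamma n w / fact n + (-1) ^ Suc n * Polygamma n (1 - w) / fact n)) UNIV"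
    by (rule has_sum_int_iff[OF 1 2])
  also have "(-1) ^ Suc n * Polygamma n w / fact n + (-1) ^ Suc n * Polygamma n (1 - w) / fact n = - cot_deriv n w / fact n"
    using kn(3) by (simp add: cot_deriv_def field_simps)
  also have "\<dots> = (2 * of_real pi * \<i>) ^ k / fact (k - 1) * eval_fps (pow_fps (k - 1)) (nome w)"
    using cot_deriv_nome[of n] w kn by simp
  finally show ?thesis .
qed

text \<open>For \<open>n = 0\<close> the sum ranges over an infinite set, so \<open>divisor_sum k 0 = 0\<close>.\<close>

definition divisor_sum :: "nat \<Rightarrow> nat \<Rightarrow> nat" where
  "divisor_sum k n = (\<Sum>d | d dvd n. d ^ k)"

text \<open>Terms are collected by \<open>n = Suc m * r\<close>, with \<open>Suc m\<close> running
  through the positive integers. The terms with \<open>r = 0\<close> vanish because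
  \<open>k > 0\<close>, which makes the map to pairs of an integer and a divisor a bijection on the
  rest.\<close>

lemma lambert_series:
  fixes q :: complex
  assumes q: "norm q < 1" and k: "k > 0"
  shows "(\<lambda>(m, r). of_nat r ^ k * q ^ (Suc m * r)) summable_on UNIV"
    and "((\<lambda>n. of_nat (divisor_sum k n) * q ^ n) has_sum infsum (\<lambda>(m, r). of_nat r ^ k * q ^ (Suc m * r)) UNIV) UNIV"
proof -
  define \<rho> where "\<rho> = norm q"
  have \<rho>: "0 \<le> \<rho>" "\<rho> < 1" using q by (auto simp: \<rho>_def)
  define T where "T = (\<lambda>(m, r). of_nat r ^ k * q ^ (Suc m * r))"
  have "summable (\<lambda>r. norm (of_nat r ^ k * complex_of_real \<rho> ^ r))"
  proof -
    have "ereal (norm (complex_of_real \<rho>)) < fps_conv_radius (pow_fps k)"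
      using less_conv_radius[OF _ pow_fps_conv_radius] \<rho> by simp
    from norm_summable_fps[OF this] show ?thesis by (simp add: pow_fps_def)
  qed
  then have s1: "(\<lambda>r. real r ^ k * \<rho> ^ r) summable_on UNIV"
    using \<rho> by (intro summable_nonneg_imp_summable_on) (auto simp: norm_mult norm_power)
  have s2: "(\<lambda>m. \<rho> ^ m) summable_on UNIV"
    using \<rho> by (intro summable_nonneg_imp_summable_on) auto
  have s3: "(\<lambda>v. \<rho> ^ fst v * (real (snd v) ^ k * \<rho> ^ snd v)) summable_on Sigma (UNIV :: nat set) (\<lambda>_. UNIV :: nat set)"
  proof (rule summable_on_SigmaI)
    fix m :: nat
    show "((\<lambda>r. \<rho> ^ fst (m, r) * (real (snd (m, r)) ^ k * \<rho> ^ snd (m, r))) has_sum (\<rho> ^ m * infsum (\<lambda>r. real r ^ k * \<rho> ^ r) UNIV)) UNIV"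
      unfolding fst_conv snd_conv by (intro has_sum_cmult_right has_sum_infsum s1)
  qed (use \<rho> in \<open>auto intro!: summable_on_cmult_left s2\<close>)
  have "(\<lambda>v. norm (T v)) summable_on Sigma (UNIV :: nat set) (\<lambda>_. UNIV :: nat set)"
  proof (rule summable_on_comparison_test[OF s3])
    fix v :: "nat \<times> nat"
    obtain m r where v: "v = (m, r)" by (cases v)
    show "norm (T v) \<le> \<rho> ^ fst v * (real (snd v) ^ k * \<rho> ^ snd v)"
    proof (cases "r = 0")
      case False
      then have "m + r \<le> Suc m * r" by (cases r) auto
      then have "\<rho> ^ (Suc m * r) \<le> \<rho> ^ (m + r)" using \<rho> by (intro power_decreasing) auto
      then have "real r ^ k * \<rho> ^ (Suc m * r) \<le> real r ^ k * \<rho> ^ (m + r)" by (intro mult_left_mono) auto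
      moreover have "norm (T v) = real r ^ k * \<rho> ^ (Suc m * r)"
        by (simp add: T_def v norm_mult norm_power \<rho>_def)
      ultimately show ?thesis by (simp add: v power_add mult_ac)
    qed (use k \<rho> in \<open>simp add: T_def v zero_power\<close>)
  qed simp
  then have sT: "T summable_on UNIV" using abs_summable_summable[of T UNIV] by simp
  then show "(\<lambda>(m, r). of_nat r ^ k * q ^ (Suc m * r)) summable_on UNIV" by (simp add: T_def)
  have "(T has_sum infsum T UNIV) UNIV" using sT by simp
  then have h1: "(T has_sum infsum T UNIV) (UNIV \<times> {0<..})"
  proof (subst (asm) has_sum_cong_neutral[where T = "UNIV \<times> {0<..}" and g = T])
    fix x :: "nat \<times> nat" assume "x \<in> UNIV - UNIV \<times> {0<..}"
    then have "snd x = 0" by (simp add: mem_Times_iff)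
    then show "T x = 0" using k by (simp add: T_def case_prod_unfold)
  qed auto
  have bij: "bij_betw (\<lambda>(m, r). (Suc m * r, r)) (UNIV \<times> {0<..}) (Sigma {0<..} (\<lambda>n. {d. d dvd n}))"
  proof (rule bij_betw_byWitness[where f' = "\<lambda>(n, d). (n div d - 1, d)"])
    show "\<forall>a\<in>UNIV \<times> {0<..}. (case case a of (m, r) \<Rightarrow> (Suc m * r, r) of (n, d) \<Rightarrow> (n div d - 1, d)) = a"
      by (auto simp del: mult_Suc)
    show "\<forall>a\<in>Sigma {0<..} (\<lambda>n. {d. d dvd n}). (case case a of (n, d) \<Rightarrow> (n div d - 1, d) of (m, r) \<Rightarrow> (Suc m * r, r)) = a"
    proof
      fix a :: "nat \<times> nat" assume "a \<in> Sigma {0<..} (\<lambda>n. {d. d dvd n})"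
      then obtain d e where "a = (d * e, d)" "d * e > 0" by (auto elim!: dvdE)
      moreover then obtain e' where "e = Suc e'" by (cases e) auto
      ultimately show "(case case a of (n, d) \<Rightarrow> (n div d - 1, d) of (m, r) \<Rightarrow> (Suc m * r, r)) = a"
        by simp
    qed
    show "(\<lambda>(m, r). (Suc m * r, r)) ` (UNIV \<times> {0<..}) \<subseteq> Sigma {0<..} (\<lambda>n. {d. d dvd n})"
      by (auto simp del: mult_Suc)
    show "(\<lambda>(n, d). (n div d - (1::nat), d)) ` Sigma {0<..} (\<lambda>n. {d. d dvd n}) \<subseteq> UNIV \<times> {0<..}"
      by (auto elim!: dvdE)
  qed
  define U where "U = (\<lambda>(n, d). of_nat d ^ k * q ^ n)"
  have "T = (\<lambda>v. U ((\<lambda>(m, r). (Suc m * r, r)) v))" by (simp add: fun_eq_iff T_def U_def case_prod_unfold)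
  then have "(T has_sum infsum T UNIV) (UNIV \<times> {0<..}) = (U has_sum infsum T UNIV) (Sigma {0<..} (\<lambda>n. {d. d dvd n}))"
    using has_sum_reindex_bij_betw[OF bij, of U "infsum T UNIV"] by metis
  then have "(U has_sum infsum T UNIV) (Sigma {0<..} (\<lambda>n. {d. d dvd n}))"
    using h1 by blast
  then have "((\<lambda>n. \<Sum>d | d dvd n. U (n, d)) has_sum infsum T UNIV) {0<..}"
    by (rule has_sum_SigmaD) (auto intro!: has_sum_finite)
  then have "((\<lambda>n. of_nat (divisor_sum k n) * q ^ n) has_sum infsum T UNIV) {0<..}"
    by (simp add: U_def divisor_sum_def sum_distrib_right)
  then show "((\<lambda>n. of_nat (divisor_sum k n) * q ^ n) has_sum infsum (\<lambda>(m, r). of_nat r ^ k * q ^ (Suc m * r)) UNIV) UNIV"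
    unfolding T_def[symmetric]
  proof (subst has_sum_cong_neutral[where T = "{0<..}" and g = "\<lambda>n. of_nat (divisor_sum k n) * q ^ n"])
    fix n :: nat assume "n \<in> UNIV - {0<..}"
    then show "of_nat (divisor_sum k n) * q ^ n = 0" by (simp add: divisor_sum_def)
  qed auto
qed

text \<open>For even \<open>k \<ge> 4\<close> this is \<open>2 * zeta(k)\<close>: both signs are
  summed, and the term at 0 is \<open>inverse 0 = 0\<close>.\<close>

definition even_zeta :: "nat \<Rightarrow> complex" where
  "even_zeta k = infsum (\<lambda>n. inverse (of_int n ^ k)) (UNIV :: int set)"

text \<open>The lattice is summed row by row. Row 0 gives the constant term; rows \<open>m\<close>
  and \<open>- m\<close> agree since \<open>k\<close> is even, whence the factor 2; Lipschitz's
  formula for each positive row leads to a Lambert series.\<close>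

lemma eisenstein_G_qexp:
  assumes k: "k \<ge> 4" "even k"
  shows "qexp (eisenstein_G k) (Abs_fps (\<lambda>n. (if n = 0 then even_zeta k else 0) + 2 * (2 * of_real pi * \<i>) ^ k / fact (k - 1) * of_nat (divisor_sum (k - 1) n)))"
proof -
  define C where "C = (2 * of_real pi * \<i>) ^ k / fact (k - 1)"
  define a where "a n = (if n = 0 then even_zeta k else 0) + 2 * C * of_nat (divisor_sum (k - 1) n)" for n
  have main: "(\<lambda>n. a n * nome z ^ n) sums eisenstein_G k z" if z: "z \<in> upper_half_plane" for z
  proof -
    define q where "q = nome z"
    have q: "norm q < 1" unfolding q_def by (rule norm_nome_less_1[OF z])
    define S where "S m = infsum (\<lambda>n. lattice_term k z (m, n)) UNIV" for m
    have "(lattice_term k z has_sum eisenstein_G k z) (Sigma UNIV (\<lambda>_. UNIV))"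
      unfolding eisenstein_G_def using lattice_term_summable[OF z k(1)] by simp
    then have hS: "(S has_sum eisenstein_G k z) UNIV"
      by (rule has_sum_SigmaD) (unfold S_def, intro has_sum_infsum lattice_row_summable z k(1))
    have S0: "S 0 = even_zeta k" by (simp add: S_def lattice_term_def even_zeta_def)
    have Sneg: "S (- m) = S m" for m
    proof -
      have "bij_betw uminus (UNIV :: int set) UNIV" by (rule bij_betw_byWitness[where f' = uminus]) auto
      from infsum_reindex_bij_betw[OF this, of "\<lambda>n. lattice_term k z (- m, n)"]
      have "S (- m) = infsum (\<lambda>n. lattice_term k z (- m, - n)) UNIV" by (simp add: S_def)
      also have "(\<lambda>n. lattice_term k z (- m, - n)) = (\<lambda>n. lattice_term k z (m, n))"
      proof
        fix n
        have "(of_int (- m) * z + of_int (- n)) = - (of_int m * z + of_int n)" by simp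
        then show "lattice_term k z (- m, - n) = lattice_term k z (m, n)"
          unfolding lattice_term_def prod.case by (simp only: power_minus_even[OF k(2)])
      qed
      finally show ?thesis by (simp add: S_def)
    qed
    have Spos: "S (int (Suc m)) = C * eval_fps (pow_fps (k - 1)) (q ^ Suc m)" for m
    proof -
      have "of_nat (Suc m) * z \<in> upper_half_plane" using z by (simp add: upper_half_plane_iff)
      from lipschitz_formula[OF this k]
      have "((\<lambda>n. lattice_term k z (int (Suc m), n)) has_sum C * eval_fps (pow_fps (k - 1)) (nome (of_nat (Suc m) * z))) UNIV"
        by (simp add: lattice_term_def C_def)
      moreover have "nome (of_nat (Suc m) * z) = q ^ Suc m"
        unfolding q_def nome_def exp_of_nat_mult[symmetric] by (simp only: mult_ac)
      ultimately show ?thesis unfolding S_def by (simp add: infsumI)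
    qed
    have sums_S: "S summable_on UNIV" using hS by (rule has_sum_imp_summable)
    note halves = summable_on_int_halves[OF sums_S]
    define b where "b = infsum (\<lambda>m. S (- 1 - int m)) UNIV"
    have Sb: "(\<lambda>m. S (- 1 - int m)) = (\<lambda>m. S (int (Suc m)))"
    proof
      fix m
      have "- 1 - int m = - int (Suc m)" by simp
      then show "S (- 1 - int m) = S (int (Suc m))" by (simp only: Sneg)
    qed
    have hb: "((\<lambda>m. S (- 1 - int m)) has_sum b) UNIV" unfolding b_def using halves(2) by simp
    have hb': "((\<lambda>m. S (int (Suc m))) has_sum b) UNIV" using hb unfolding Sb .
    have "(\<lambda>m. S (int (Suc m))) sums b" using has_sum_imp_sums[OF hb'] .
    then have "(\<lambda>m. S (int m)) sums (b + S 0)" using sums_Suc[of "\<lambda>m. S (int m)" b] by simp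
    then have ha: "((\<lambda>m. S (int m)) has_sum (b + S 0)) UNIV" by (rule has_sum_of_sums[OF halves(1)])
    have G: "eisenstein_G k z = even_zeta k + 2 * b"
      using has_sum_unique[OF hS has_sum_int_iff[OF ha hb]] S0 by simp
    define D where "D = infsum (\<lambda>(m, r). of_nat r ^ (k - 1) * q ^ (Suc m * r)) (UNIV :: (nat \<times> nat) set)"
    have k1: "k - 1 > 0" using k by simp
    note lam = lambert_series[OF q k1]
    have "((\<lambda>(m, r). of_nat r ^ (k - 1) * q ^ (Suc m * r)) has_sum D) (Sigma (UNIV :: nat set) (\<lambda>_. UNIV :: nat set))"
      unfolding D_def using lam(1) by simp
    then have "((\<lambda>m. eval_fps (pow_fps (k - 1)) (q ^ Suc m)) has_sum D) UNIV"
    proof (rule has_sum_SigmaD)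
      fix m :: nat
      have nq: "norm (q ^ Suc m) < 1" using q power_less_one_iff[of "norm q" "Suc m"] by (simp add: norm_power del: power_Suc)
      have r: "ereal (norm (q ^ Suc m)) < fps_conv_radius (pow_fps (k - 1))" by (rule less_conv_radius[OF nq pow_fps_conv_radius])
      have "((\<lambda>r. fps_nth (pow_fps (k - 1)) r * (q ^ Suc m) ^ r) has_sum eval_fps (pow_fps (k - 1)) (q ^ Suc m)) UNIV"
        by (rule norm_summable_imp_has_sum[OF norm_summable_fps[OF r] sums_eval_fps[OF r]])
      moreover have "fps_nth (pow_fps (k - 1)) r * (q ^ Suc m) ^ r = of_nat r ^ (k - 1) * q ^ (Suc m * r)" for r
        by (simp only: pow_fps_def fps_nth_Abs_fps power_mult)
      ultimately show "((\<lambda>r. case (m, r) of (m, r) \<Rightarrow> of_nat r ^ (k - 1) * q ^ (Suc m * r)) has_sum eval_fps (pow_fps (k - 1)) (q ^ Suc m)) UNIV"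
        by simp
    qed
    then have "((\<lambda>m. S (int (Suc m))) has_sum C * D) UNIV"
      unfolding Spos by (rule has_sum_cmult_right)
    then have "b = C * D" using hb' has_sum_unique by blast
    moreover have "(\<lambda>n. of_nat (divisor_sum (k - 1) n) * q ^ n) sums D"
      using has_sum_imp_sums[OF lam(2)] unfolding D_def .
    then have "(\<lambda>n. 2 * C * (of_nat (divisor_sum (k - 1) n) * q ^ n)) sums (2 * C * D)" by (rule sums_mult)
    moreover have "(\<lambda>n. (if n = 0 then even_zeta k else 0)) sums even_zeta k"
      using sums_single[of 0 "\<lambda>_. even_zeta k"] by simp
    ultimately have "(\<lambda>n. (if n = 0 then even_zeta k else 0) + 2 * C * (of_nat (divisor_sum (k - 1) n) * q ^ n)) sums (even_zeta k + 2 * b)"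
      by (simp add: sums_add mult.assoc)
    moreover have "(if n = 0 then even_zeta k else 0) + 2 * C * (of_nat (divisor_sum (k - 1) n) * q ^ n) = a n * nome z ^ n" for n
      by (simp add: a_def q_def algebra_simps)
    ultimately show ?thesis unfolding G by simp
  qed
  have "has_q_expansion 1 (eisenstein_G k) a"
    unfolding has_q_expansion_def
  proof
    fix z assume z: "z \<in> upper_half_plane"
    have "exp (2 * of_real pi * \<i> * of_nat n * z / of_nat 1) = nome z ^ n" for n
      by (simp add: nome_def exp_of_nat_mult[symmetric] mult_ac)
    then show "(\<lambda>n. a n * exp (2 * of_real pi * \<i> * of_nat n * z / of_nat 1)) sums eisenstein_G k z"
      using main[OF z] by simp
  qed
  then show ?thesis unfolding has_q_expansion_1_iff a_def C_def by (simp add: mult.assoc)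
qed

text \<open>Bernoulli numbers in the convention with value -1/2 at index 1. The recursive form is
  the one from which integrality at \<open>p\<close> can be read off.\<close>

fun bern :: "nat \<Rightarrow> complex" where
  "bern 0 = 1"
| "bern (Suc n) = - (\<Sum>j\<le>n. of_nat (Suc (Suc n) choose j) * bern j) / of_nat (Suc (Suc n))"

lemma bern_sum: "(\<Sum>j\<le>n. of_nat (Suc n choose j) * bern j) = (if n = 0 then 1 else 0)"
proof (cases n)
  case (Suc m)
  have "(\<Sum>j\<le>n. of_nat (Suc n choose j) * bern j) = (\<Sum>j\<le>m. of_nat (Suc (Suc m) choose j) * bern j) + of_nat (Suc (Suc m)) * bern (Suc m)"
    unfolding Suc sum.atMost_Suc by (simp add: binomial_Suc_n del: bern.simps)
  also have "of_nat (Suc (Suc m)) * bern (Suc m) = - (\<Sum>j\<le>m. of_nat (Suc (Suc m) choose j) * bern j)"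
    by (simp del: of_nat_Suc binomial_Suc_Suc)
  finally show ?thesis using Suc by simp
qed simp

lemma bern_unique:
  assumes b: "\<And>n. (\<Sum>j\<le>n. of_nat (Suc n choose j) * b j) = (if n = 0 then 1 else 0)"
  shows "b n = bern n"
proof (induction n rule: less_induct)
  case (less n)
  have split: "(\<Sum>j\<le>n. of_nat (Suc n choose j) * x j) = (\<Sum>j<n. of_nat (Suc n choose j) * x j) + of_nat (Suc n) * x n" for x :: "nat \<Rightarrow> complex"
    by (simp add: lessThan_Suc_atMost[symmetric] binomial_Suc_n del: binomial_Suc_Suc of_nat_Suc)
  have "(\<Sum>j<n. of_nat (Suc n choose j) * b j) = (\<Sum>j<n. of_nat (Suc n choose j) * bern j)"
    using less by (intro sum.cong) auto
  then have "of_nat (Suc n) * b n = of_nat (Suc n) * bern n"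
    using trans[OF b[of n] bern_sum[of n, symmetric]] unfolding split by (simp del: of_nat_Suc mult_cancel_left)
  then show ?case by (simp del: of_nat_Suc)
qed

text \<open>Both halves of the integer sum are the polygamma series at 1. Nonvanishing holds because
  that series has positive terms, the first of which is 1.\<close>

lemma even_zeta_Polygamma:
  assumes k: "k \<ge> 4" "even k"
  shows "even_zeta k = 2 * Polygamma (k - 1) 1 / fact (k - 1)" and "even_zeta k \<noteq> 0"
proof -
  define n where "n = k - 1"
  have kn: "k = Suc n" "n > 0" "odd n" using k by (auto simp: n_def)
  define P where "P = Polygamma n (1 :: complex) / fact n"
  have "\<i> \<in> upper_half_plane" by (simp add: upper_half_plane_iff)
  from lattice_row_summable[OF this k(1), of 0]
  have row: "(\<lambda>j. inverse (of_int j ^ k) :: complex) summable_on UNIV" by (simp add: lattice_term_def)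
  note halves = summable_on_int_halves[OF row]
  have "(\<lambda>j. inverse ((1 + of_nat j) ^ Suc n) :: complex) sums ((-1) ^ Suc n * Polygamma n 1 / fact n)"
    using kn by (intro Polygamma_LIMSEQ) auto
  then have s: "(\<lambda>j. inverse ((1 + of_nat j) ^ k) :: complex) sums P"
    using kn by (simp add: P_def)
  have e: "inverse (of_int (- 1 - int j) ^ k) = inverse ((1 + of_nat j) ^ k :: complex)" for j
  proof -
    have "complex_of_int (- 1 - int j) = - (1 + of_nat j)" by simp
    then show ?thesis by (simp only: power_minus_even[OF k(2)])
  qed
  have h2: "((\<lambda>j. inverse (of_int (- 1 - int j) ^ k)) has_sum P) UNIV"
    by (rule has_sum_of_sums[OF halves(2)]) (use s in \<open>simp only: e\<close>)
  have "(\<lambda>j. inverse (of_nat (Suc j) ^ k) :: complex) sums P" using s by simp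
  then have "(\<lambda>j. inverse (of_nat j ^ k) :: complex) sums (P + inverse (of_nat 0 ^ k))"
    by (rule sums_Suc[of "\<lambda>j. inverse (of_nat j ^ k)"])
  then have h1: "((\<lambda>j. inverse (of_int (int j) ^ k)) has_sum P) UNIV"
    using kn(1) by (intro has_sum_of_sums[OF halves(1)]) simp
  have z: "even_zeta k = 2 * P"
    unfolding even_zeta_def using has_sum_int_iff[OF h1 h2] by (simp add: infsumI)
  then show "even_zeta k = 2 * Polygamma (k - 1) 1 / fact (k - 1)" by (simp add: P_def n_def)
  have "(\<lambda>j. Re (inverse ((1 + of_nat j) ^ k) :: complex)) sums Re P" by (rule sums_Re[OF s])
  moreover have "Re (inverse ((1 + of_nat j) ^ k) :: complex) = inverse ((1 + real j) ^ k)" for j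
  proof -
    have "(inverse ((1 + of_nat j) ^ k) :: complex) = of_real (inverse ((1 + real j) ^ k))" by simp
    then show ?thesis by (simp only: Re_complex_of_real)
  qed
  ultimately have rs: "(\<lambda>j. inverse ((1 + real j) ^ k)) sums Re P" by simp
  have "sum (\<lambda>j. inverse ((1 + real j) ^ k)) {0} \<le> suminf (\<lambda>j. inverse ((1 + real j) ^ k))"
    using rs by (intro sum_le_suminf) (auto simp: sums_iff)
  then have "Re P \<ge> 1" using rs by (simp add: sums_iff)
  then show "even_zeta k \<noteq> 0" using z by auto
qed

text \<open>At \<open>n = 0\<close> this is the cotangent with its pole at 0 removed, that is
  \<open>cot_deriv 0 z - 1 / z\<close>. It is holomorphic in the unit disc, and its Taylor
  coefficients are polygamma values at 1.\<close>

definition digamma_diff :: "nat \<Rightarrow> complex \<Rightarrow> complex" where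
  "digamma_diff n z = (-1) ^ n * Polygamma n (1 - z) - Polygamma n (1 + z)"

lemma digamma_diff_has_derivative:
  assumes "norm z < 1"
  shows "(digamma_diff n has_field_derivative digamma_diff (Suc n) z) (at z)"
proof -
  have "\<bar>Re z\<bar> < 1" using abs_Re_le_cmod[of z] assms by linarith
  then have "1 - z \<notin> \<int>\<^sub>\<le>\<^sub>0" "1 + z \<notin> \<int>\<^sub>\<le>\<^sub>0"
    by (auto elim!: nonpos_Ints_cases simp: complex_eq_iff)
  then show ?thesis unfolding digamma_diff_def[abs_def]
    by (auto intro!: derivative_eq_intros)
qed

lemma higher_deriv_digamma_diff:
  "\<forall>z\<in>ball 0 1. (deriv ^^ n) (digamma_diff 0) z = digamma_diff n z"
proof (induction n)
  case (Suc n)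
  show ?case
  proof
    fix z :: complex assume z: "z \<in> ball 0 1"
    have "(digamma_diff n has_field_derivative digamma_diff (Suc n) z) (at z)"
      using z by (intro digamma_diff_has_derivative) simp
    then have "((deriv ^^ n) (digamma_diff 0) has_field_derivative digamma_diff (Suc n) z) (at z)"
      by (rule has_field_derivative_transform_within_open[OF _ open_ball z]) (use Suc in simp)
    then show "(deriv ^^ Suc n) (digamma_diff 0) z = digamma_diff (Suc n) z" by (simp add: DERIV_imp_deriv)
  qed
qed simp

text \<open>The generating function of the Bernoulli numbers is read off from the two expressions for
  \<open>\<pi> z cot (\<pi> z)\<close>; this is Euler's formula for \<open>\<zeta>(k)\<close>, \<open>k\<close> even.\<close>

lemma even_zeta_bern:
  assumes k: "k \<ge> 4" "even k"
  shows "even_zeta k = - (bern k * (2 * of_real pi * \<i>) ^ k / fact k)"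
proof -
  define c :: complex where "c = 2 * of_real pi * \<i>"
  have c0: "c \<noteq> 0" by (simp add: c_def)
  define \<phi> where "\<phi> = fps_expansion (digamma_diff 0) 0"
  have hol: "digamma_diff 0 holomorphic_on ball 0 1"
    unfolding holomorphic_on_open[OF open_ball]
  proof (intro ballI exI)
    fix z :: complex assume "z \<in> ball 0 1"
    then show "(digamma_diff 0 has_field_derivative digamma_diff (Suc 0) z) (at z)"
      by (intro digamma_diff_has_derivative) simp
  qed
  have ex: "digamma_diff 0 has_fps_expansion \<phi>"
    unfolding \<phi>_def by (rule has_fps_expansion_fps_expansion[OF open_ball _ hol]) simp
  have \<phi>_nth: "fps_nth \<phi> n = ((-1) ^ n - 1) * Polygamma n 1 / fact n" for n
  proof -
    have "(deriv ^^ n) (digamma_diff 0) 0 = digamma_diff n 0" using higher_deriv_digamma_diff[of n] by simp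
    then show ?thesis by (simp add: \<phi>_def fps_expansion_def digamma_diff_def left_diff_distrib)
  qed
  \<comment> \<open>The expansion of \<open>pi * z * cot (pi * z) - pi * i * z\<close>, which equals
    \<open>c * z / (exp (c * z) - 1)\<close>. Multiplying by the denominator yields the recursion
    that characterises the Bernoulli numbers.\<close>
  define \<beta> where "\<beta> = 1 - fps_const (of_real pi * \<i>) * fps_X + fps_X * \<phi>"
  have "(\<lambda>z. (1 - of_real pi * \<i> * z + z * digamma_diff 0 z) * (exp (c * z) - 1)) has_fps_expansion \<beta> * (fps_exp c - 1)"
    unfolding \<beta>_def by (intro fps_expansion_intros ex)
  moreover have ev: "eventually (\<lambda>z. (1 - of_real pi * \<i> * z + z * digamma_diff 0 z) * (exp (c * z) - 1) = c * z) (nhds 0)"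
    unfolding eventually_nhds
  proof (intro exI[of _ "ball 0 1"] conjI ballI)
    fix z :: complex assume z: "z \<in> ball 0 1"
    show "(1 - of_real pi * \<i> * z + z * digamma_diff 0 z) * (exp (c * z) - 1) = c * z"
    proof (cases "z = 0")
      case False
      have ni: "z \<notin> \<int>"
      proof
        assume "z \<in> \<int>"
        then obtain n :: int where "z = of_int n" by (elim Ints_cases)
        then show False using z False by simp
      qed
      define q where "q = nome z"
      have q: "exp (c * z) = q" by (simp add: q_def nome_def c_def)
      have "q \<noteq> 1"
      proof
        assume "q = 1"
        then have "nome z = nome 0" by (simp add: q_def nome_def)
        then obtain n :: int where "z = 0 + of_int n" using nome_eq_imp by blast
        then show False using ni by simp
      qed
      have "Polygamma 0 (z + 1) = Polygamma 0 z + (-1) ^ 0 * fact 0 / (z ^ Suc 0)"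
        by (rule Polygamma_plus1) (use False in auto)
      then have "digamma_diff 0 z = cot_deriv 0 z - 1 / z"
        by (simp add: digamma_diff_def cot_deriv_def add.commute)
      also have "cot_deriv 0 z = of_real pi * \<i> - c / (1 - q)"
        using cot_deriv_0[OF ni] by (simp add: c_def q_def)
      finally have "z * digamma_diff 0 z = z * (of_real pi * \<i>) - z * c / (1 - q) - 1"
        using False by (simp add: right_diff_distrib)
      then have "1 - of_real pi * \<i> * z + z * digamma_diff 0 z = - (z * c / (1 - q))" by simp
      then show ?thesis unfolding q using \<open>q \<noteq> 1\<close> by (simp add: divide_simps) (simp add: algebra_simps)
    qed simp
  qed auto
  ultimately have "(\<lambda>z. c * z) has_fps_expansion \<beta> * (fps_exp c - 1)"
    using iffD1[OF has_fps_expansion_cong[OF ev refl]] by simp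
  moreover have "(\<lambda>z. c * z) has_fps_expansion fps_const c * fps_X"
    by (rule has_fps_expansion_cmult_left[OF has_fps_expansion_fps_X])
  ultimately have eq: "\<beta> * (fps_exp c - 1) = fps_const c * fps_X"
    by (rule fps_expansion_unique_complex)
  define b where "b j = fps_nth \<beta> j * fact j / c ^ j" for j
  have "(\<Sum>j\<le>n. of_nat (Suc n choose j) * b j) = (if n = 0 then 1 else 0)" for n
  proof -
    have "fps_nth (\<beta> * (fps_exp c - 1)) (Suc n) = (\<Sum>j\<le>n. fps_nth \<beta> j * (c ^ (Suc n - j) / fact (Suc n - j)))"
      unfolding fps_mult_nth atLeast0AtMost sum.atMost_Suc
      by simp
    then have "(\<Sum>j\<le>n. fps_nth \<beta> j * (c ^ (Suc n - j) / fact (Suc n - j))) = (if n = 0 then c else 0)"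
      unfolding eq by simp
    then have "(fact (Suc n) / c ^ Suc n) * (\<Sum>j\<le>n. fps_nth \<beta> j * (c ^ (Suc n - j) / fact (Suc n - j))) = (if n = 0 then 1 else 0)"
      using c0 by simp
    moreover have "(fact (Suc n) / c ^ Suc n) * (fps_nth \<beta> j * (c ^ (Suc n - j) / fact (Suc n - j))) = of_nat (Suc n choose j) * b j" if "j \<le> n" for j
    proof -
      have 1: "of_nat (Suc n choose j) = (fact (Suc n) / (fact j * fact (Suc n - j)) :: complex)"
        by (rule binomial_fact) (use that in simp)
      have 2: "c ^ Suc n = c ^ j * c ^ (Suc n - j)" using that by (simp flip: power_add)
      show ?thesis unfolding 1 2 b_def using c0 by simp
    qed
    ultimately show ?thesis by (simp add: sum_distrib_left)
  qed
  then have "b k = bern k" by (rule bern_unique)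
  moreover have "fps_nth \<beta> k = - even_zeta k"
  proof -
    obtain n where n: "k = Suc n" "odd n" "n \<noteq> 0" using k by (cases k) auto
    then have "fps_nth \<beta> k = fps_nth \<phi> n" by (simp add: \<beta>_def)
    moreover have "even_zeta k = 2 * Polygamma n 1 / fact n" using even_zeta_Polygamma(1)[OF k] n(1) by simp
    then have "fps_nth \<phi> n = - even_zeta k" using n(2) by (simp add: \<phi>_nth)
    ultimately show ?thesis by simp
  qed
  moreover have "fps_nth \<beta> k = b k * c ^ k / fact k" using c0 by (simp add: b_def)
  ultimately show ?thesis by (simp add: c_def[symmetric])
qed

definition eis :: "nat \<Rightarrow> complex \<Rightarrow> complex" where
  "eis k z = eisenstein_G k z / even_zeta k"

definition eis_fps :: "nat \<Rightarrow> complex fps" where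
  "eis_fps k = Abs_fps (\<lambda>n. (if n = 0 then 1 else 0) - 2 * of_nat k / bern k * of_nat (divisor_sum (k - 1) n))"

lemma level_one_eis:
  assumes k: "k \<ge> 4" "even k"
  shows "level_one k (eis k) (eis_fps k)" and "bern k \<noteq> 0"
proof -
  define c :: complex where "c = 2 * of_real pi * \<i>"
  have c0: "c \<noteq> 0" by (simp add: c_def)
  note z0 = even_zeta_Polygamma(2)[OF k]
  show b0: "bern k \<noteq> 0" using z0 even_zeta_bern[OF k] by auto
  define F where "F = Abs_fps (\<lambda>n. (if n = 0 then even_zeta k else 0) + 2 * c ^ k / fact (k - 1) * of_nat (divisor_sum (k - 1) n))"
  have "level_one k (eisenstein_G k) F"
    unfolding level_one_def F_def c_def using eisenstein_G_qexp[OF k] eisenstein_G_transform k by simp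
  then have "level_one k (\<lambda>z. inverse (even_zeta k) * eisenstein_G k z) (fps_const (inverse (even_zeta k)) * F)"
    by (rule level_one_cmult)
  moreover have "(\<lambda>z. inverse (even_zeta k) * eisenstein_G k z) = eis k"
    by (simp add: fun_eq_iff eis_def field_simps)
  moreover have "fps_const (inverse (even_zeta k)) * F = eis_fps k"
  proof (rule fps_ext)
    fix n
    obtain j where j: "k = Suc j" using k by (cases k) auto
    have Q: "inverse (even_zeta k) * (2 * c ^ k / fact (k - 1)) = - (2 * of_nat k / bern k)"
    proof -
      have ez: "even_zeta k = - (bern k * c ^ k / (of_nat k * fact (k - 1)))"
        using even_zeta_bern[OF k] j by (simp add: c_def)
      have "of_nat k \<noteq> (0::complex)" using j by (simp del: of_nat_Suc)
      moreover have "x \<noteq> 0 \<Longrightarrow> f \<noteq> 0 \<Longrightarrow> y \<noteq> 0 \<Longrightarrow> b \<noteq> 0 \<Longrightarrow> inverse (- (b * x / (y * f))) * (2 * x / f) = - (2 * y / b)" for x f y b :: complex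
        by (simp add: field_simps)
      ultimately show ?thesis unfolding ez using b0 c0 by simp
    qed
    have "fps_nth (fps_const (inverse (even_zeta k)) * F) n = inverse (even_zeta k) * (if n = 0 then even_zeta k else 0)
        + inverse (even_zeta k) * (2 * c ^ k / fact (k - 1)) * of_nat (divisor_sum (k - 1) n)"
      by (simp only: F_def fps_mult_left_const_nth fps_nth_Abs_fps distrib_left mult.assoc)
    then show "fps_nth (fps_const (inverse (even_zeta k)) * F) n = fps_nth (eis_fps k) n"
      unfolding Q using z0 by (simp add: eis_fps_def)
  qed
  ultimately show "level_one k (eis k) (eis_fps k)" by simp
qed

lemma bern_4: "bern 4 = - 1 / 30" and bern_6: "bern 6 = 1 / 42"
  by (simp_all add: numeral_eq_Suc)

lemma divisor_sum_0 [simp]: "divisor_sum k 0 = 0" and divisor_sum_1 [simp]: "divisor_sum k (Suc 0) = 1"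
  by (simp_all add: divisor_sum_def)

lemma eis_fps_nth: "fps_nth (eis_fps 4) n = (if n = 0 then 1 else 0) + 240 * of_nat (divisor_sum 3 n)"
  "fps_nth (eis_fps 6) n = (if n = 0 then 1 else 0) - 504 * of_nat (divisor_sum 5 n)"
  by (simp_all add: eis_fps_def bern_4 bern_6)

section \<open>The discriminant\<close>

text \<open>1728 times the usual discriminant form. Without the division its coefficients are
  visibly integers, at the price of the leading coefficient 1728.\<close>

definition delta :: "complex \<Rightarrow> complex" where
  "delta z = eis 4 z ^ 3 - eis 6 z ^ 2"

definition delta_fps :: "complex fps" where
  "delta_fps = eis_fps 4 ^ 3 - eis_fps 6 ^ 2"

lemma level_one_delta: "level_one 12 delta delta_fps"
proof -
  have "level_one (4 * 3) (\<lambda>z. eis 4 z ^ 3) (eis_fps 4 ^ 3)" "level_one (6 * 2) (\<lambda>z. eis 6 z ^ 2) (eis_fps 6 ^ 2)"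
    by (intro level_one_power level_one_eis; simp)+
  then show ?thesis using level_one_diff[of 12] by (simp add: delta_def[abs_def] delta_fps_def)
qed

lemma delta_fps_nth: "fps_nth delta_fps 0 = 0" "fps_nth delta_fps (Suc 0) = 1728"
  by (simp_all add: delta_fps_def power3_eq_cube power2_eq_square fps_mult_nth eis_fps_nth)

text \<open>Orders add and lowest coefficients multiply modulo an ideal. The zero ideal gives
  ordinary orders of vanishing, the maximal ideal of \<open>V\<close> gives orders after
  reduction.\<close>

lemma fps_mult_nth_ideal:
  fixes f g :: "'a::field fps"
  assumes S: "subring_set S" and I: "ideal_of_set I S"
    and f: "\<And>i. fps_nth f i \<in> S" "\<And>i. i < m \<Longrightarrow> fps_nth f i \<in> I"
    and g: "\<And>i. fps_nth g i \<in> S" "\<And>i. i < n \<Longrightarrow> fps_nth g i \<in> I"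
  shows "i < m + n \<Longrightarrow> fps_nth (f * g) i \<in> I"
    and "fps_nth (f * g) (m + n) - fps_nth f m * fps_nth g n \<in> I"
proof -
  have t: "fps_nth f j * fps_nth g k \<in> I" if "j < m \<or> k < n" for j k
    using that f g ideal_of_setD(4,5)[OF I] by blast
  show "fps_nth (f * g) i \<in> I" if "i < m + n"
    unfolding fps_mult_nth using that by (intro ideal_of_set_sum[OF I] t) auto
  have "fps_nth (f * g) (m + n) = fps_nth f m * fps_nth g n + (\<Sum>j\<in>{0..m+n} - {m}. fps_nth f j * fps_nth g (m + n - j))"
    unfolding fps_mult_nth by (subst sum.remove[of _ m]) auto
  moreover have "(\<Sum>j\<in>{0..m+n} - {m}. fps_nth f j * fps_nth g (m + n - j)) \<in> I"
    by (intro ideal_of_set_sum[OF I] t) auto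
  ultimately show "fps_nth (f * g) (m + n) - fps_nth f m * fps_nth g n \<in> I" by simp
qed

lemma fps_mult_nth_order:
  fixes f g :: "'a::field fps"
  assumes "\<And>i. i < m \<Longrightarrow> fps_nth f i = 0" "\<And>i. i < n \<Longrightarrow> fps_nth g i = 0"
  shows "i < m + n \<Longrightarrow> fps_nth (f * g) i = 0" and "fps_nth (f * g) (m + n) = fps_nth f m * fps_nth g n"
proof -
  have S: "subring_set (UNIV :: 'a set)" by (simp add: subring_set_def)
  have I: "ideal_of_set {0::'a} UNIV" by (simp add: ideal_of_set_def)
  show "i < m + n \<Longrightarrow> fps_nth (f * g) i = 0" "fps_nth (f * g) (m + n) = fps_nth f m * fps_nth g n"
    using fps_mult_nth_ideal[OF S I, of f m g n] assms by auto
qed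

lemma qexp_deriv:
  assumes q: "qexp f F"
  shows "qexp (deriv f) (fps_const (2 * of_real pi * \<i>) * (fps_X * fps_deriv F))"
proof -
  have r: "fps_conv_radius F \<ge> 1" using q by (simp add: qexp_def)
  then have rd: "fps_conv_radius (fps_deriv F) \<ge> 1" using fps_conv_radius_deriv[of F] by (rule order_trans)
  have "deriv f z = 2 * of_real pi * \<i> * (nome z * eval_fps (fps_deriv F) (nome z))" if z: "z \<in> upper_half_plane" for z
  proof -
    have d: "(nome has_field_derivative nome z * (2 * of_real pi * \<i>)) (at z)"
      unfolding nome_def[abs_def] by (auto intro!: derivative_eq_intros)
    have "(eval_fps F has_field_derivative eval_fps (fps_deriv F) (nome z)) (at (nome z))"
      using qexp_in_eball[OF q z] by (intro has_field_derivative_eval_fps) auto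
    from DERIV_chain2[OF this d]
    have "((\<lambda>z. eval_fps F (nome z)) has_field_derivative eval_fps (fps_deriv F) (nome z) * (nome z * (2 * of_real pi * \<i>))) (at z)" .
    then have "(f has_field_derivative eval_fps (fps_deriv F) (nome z) * (nome z * (2 * of_real pi * \<i>))) (at z)"
      by (rule has_field_derivative_transform_within_open[OF _ open_upper_half_plane z]) (use q in \<open>simp add: qexp_def\<close>)
    then show ?thesis by (simp add: DERIV_imp_deriv mult_ac)
  qed
  moreover have qm: "qexp (\<lambda>z. nome z * eval_fps (fps_deriv F) (nome z)) (fps_X * fps_deriv F)"
  proof (rule qexp_mult)
    show "qexp nome fps_X" by (simp add: qexp_def)
    show "qexp (\<lambda>z. eval_fps (fps_deriv F) (nome z)) (fps_deriv F)" using rd by (simp add: qexp_def)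
  qed
  ultimately show ?thesis by (intro qexp_cong[OF qexp_cmult[OF qm]]) simp
qed

lemma mobius_has_derivative:
  assumes A: "A \<in> carrier SL2Z" and z: "z \<in> upper_half_plane"
  shows "(mobius A has_field_derivative 1 / automorphy_factor A z ^ 2) (at z)"
    and "(automorphy_factor A has_field_derivative of_int (A$2$1)) (at z)"
proof -
  show "(automorphy_factor A has_field_derivative of_int (A$2$1)) (at z)"
    unfolding automorphy_factor_def[abs_def] by (auto intro!: derivative_eq_intros)
  define a b c d where "a = complex_of_int (A$1$1)" and "b = complex_of_int (A$1$2)"
    and "c = complex_of_int (A$2$1)" and "d = complex_of_int (A$2$2)"
  have det: "a * d - b * c = 1"
    using arg_cong[OF A[unfolded SL2Z_iff], of complex_of_int] by (simp add: a_def b_def c_def d_def)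
  have nz: "c * z + d \<noteq> 0" using automorphy_factor_nonzero[OF A z] by (simp add: automorphy_factor_def c_def d_def)
  have "((\<lambda>z. (a * z + b) / (c * z + d)) has_field_derivative (a * (c * z + d) - (a * z + b) * c) / ((c * z + d) * (c * z + d))) (at z)"
    using nz by (auto intro!: derivative_eq_intros)
  also have "a * (c * z + d) - (a * z + b) * c = a * d - b * c" by (simp add: algebra_simps)
  finally show "(mobius A has_field_derivative 1 / automorphy_factor A z ^ 2) (at z)"
    using det unfolding mobius_def[abs_def] automorphy_factor_def a_def b_def c_def d_def by (simp add: power2_eq_square)
qed

text \<open>The second Rankin--Cohen bracket of \<open>delta\<close> with itself. It is a form of weight 28 vanishing to
  order 2, hence a multiple of \<open>eis 4 * delta\<^sup>2\<close>; comparing orders at a zero of \<open>delta\<close> gives the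
  nonvanishing of \<open>delta\<close> without the valence formula.\<close>

definition bracket :: "complex \<Rightarrow> complex" where
  "bracket z = 13 * deriv delta z ^ 2 - 12 * (delta z * deriv (deriv delta) z)"

lemma qexp_delta: "qexp delta delta_fps"
  using level_one_delta by (simp add: level_one_def)

text \<open>Differentiating the transformation law twice produces extra terms in the lower left
  entry \<open>c\<close>. The coefficients 13 and 12, which are \<open>k + 1\<close> and
  \<open>k\<close> for the weight \<open>k = 12\<close>, are those for which these terms
  cancel.\<close>

lemma bracket_transform:
  assumes A: "A \<in> carrier SL2Z" and z: "z \<in> upper_half_plane"
  shows "bracket (mobius A z) = automorphy_factor A z ^ 28 * bracket z"
proof -
  define c where "c = complex_of_int (A$2$1)"
  define J where "J = automorphy_factor A"
  have hol: "delta holomorphic_on upper_half_plane" by (rule qexp_holomorphic[OF qexp_delta])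
  have hol': "deriv delta holomorphic_on upper_half_plane" by (rule holomorphic_deriv[OF hol open_upper_half_plane])
  have dd: "(delta has_field_derivative deriv delta w) (at w)" "(deriv delta has_field_derivative deriv (deriv delta) w) (at w)"
    if "w \<in> upper_half_plane" for w
    using holomorphic_derivI[OF hol open_upper_half_plane that] holomorphic_derivI[OF hol' open_upper_half_plane that] by auto
  have tr: "delta (mobius A w) = J w ^ 12 * delta w" if "w \<in> upper_half_plane" for w
    using level_one_delta A that by (simp add: level_one_def J_def)
  have Jnz: "J w \<noteq> 0" if "w \<in> upper_half_plane" for w using automorphy_factor_nonzero[OF A that] by (simp add: J_def)
  have dJ: "(J has_field_derivative c) (at w)" if "w \<in> upper_half_plane" for w
    using mobius_has_derivative(2)[OF A that] by (simp add: J_def c_def)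
  have dm: "(mobius A has_field_derivative 1 / J w ^ 2) (at w)" if "w \<in> upper_half_plane" for w
    using mobius_has_derivative(1)[OF A that] by (simp add: J_def)
  have mH: "mobius A w \<in> upper_half_plane" if "w \<in> upper_half_plane" for w using mobius_upper_half_plane[OF A that] .
  have pw: "J w ^ 14 = J w ^ 12 * J w ^ 2" "J w ^ 13 = J w ^ 11 * J w ^ 2" "J w ^ 16 = J w ^ 14 * J w ^ 2" "J w ^ 15 = J w ^ 13 * J w ^ 2" for w
    by (simp_all flip: power_add)
  have d1: "deriv delta (mobius A w) = 12 * c * J w ^ 13 * delta w + J w ^ 14 * deriv delta w" if w: "w \<in> upper_half_plane" for w
  proof -
    have "((\<lambda>w. delta (mobius A w)) has_field_derivative deriv delta (mobius A w) * (1 / J w ^ 2)) (at w)"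
      by (rule DERIV_chain2[OF dd(1)[OF mH[OF w]] dm[OF w]])
    then have "((\<lambda>w. J w ^ 12 * delta w) has_field_derivative deriv delta (mobius A w) * (1 / J w ^ 2)) (at w)"
      by (rule has_field_derivative_transform_within_open[OF _ open_upper_half_plane w]) (rule tr)
    moreover have "((\<lambda>w. J w ^ 12 * delta w) has_field_derivative 12 * J w ^ 11 * c * delta w + J w ^ 12 * deriv delta w) (at w)"
      using dJ[OF w] dd(1)[OF w] by (auto intro!: derivative_eq_intros)
    ultimately have "deriv delta (mobius A w) * (1 / J w ^ 2) = 12 * J w ^ 11 * c * delta w + J w ^ 12 * deriv delta w"
      by (rule DERIV_unique)
    then have "deriv delta (mobius A w) = (12 * J w ^ 11 * c * delta w + J w ^ 12 * deriv delta w) * J w ^ 2"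
      using Jnz[OF w] by (simp add: divide_eq_eq)
    then show ?thesis unfolding pw by (simp add: algebra_simps)
  qed
  have d2: "deriv (deriv delta) (mobius A z) = 156 * c^2 * J z ^ 14 * delta z + 26 * c * J z ^ 15 * deriv delta z + J z ^ 16 * deriv (deriv delta) z"
  proof -
    have "((\<lambda>w. deriv delta (mobius A w)) has_field_derivative deriv (deriv delta) (mobius A z) * (1 / J z ^ 2)) (at z)"
      by (rule DERIV_chain2[OF dd(2)[OF mH[OF z]] dm[OF z]])
    then have "((\<lambda>w. 12 * c * J w ^ 13 * delta w + J w ^ 14 * deriv delta w) has_field_derivative deriv (deriv delta) (mobius A z) * (1 / J z ^ 2)) (at z)"
      by (rule has_field_derivative_transform_within_open[OF _ open_upper_half_plane z]) (rule d1)
    moreover have "((\<lambda>w. 12 * c * J w ^ 13 * delta w + J w ^ 14 * deriv delta w) has_field_derivative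
        (12 * c * (13 * J z ^ 12 * c) * delta z + 12 * c * J z ^ 13 * deriv delta z) + (14 * J z ^ 13 * c * deriv delta z + J z ^ 14 * deriv (deriv delta) z)) (at z)"
      using dJ[OF z] dd[OF z] by (auto intro!: derivative_eq_intros simp: algebra_simps)
    ultimately have "deriv (deriv delta) (mobius A z) * (1 / J z ^ 2) = (12 * c * (13 * J z ^ 12 * c) * delta z + 12 * c * J z ^ 13 * deriv delta z) + (14 * J z ^ 13 * c * deriv delta z + J z ^ 14 * deriv (deriv delta) z)"
      by (rule DERIV_unique)
    then have "deriv (deriv delta) (mobius A z) = ((12 * c * (13 * J z ^ 12 * c) * delta z + 12 * c * J z ^ 13 * deriv delta z) + (14 * J z ^ 13 * c * deriv delta z + J z ^ 14 * deriv (deriv delta) z)) * J z ^ 2"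
      using Jnz[OF z] by (simp add: divide_eq_eq)
    then show ?thesis unfolding pw(3,4) pw(1) by (simp add: algebra_simps power2_eq_square)
  qed
  have "13 * (12 * c * j ^ 13 * x + j ^ 14 * y)^2 - 12 * ((j ^ 12 * x) * (156 * c^2 * j ^ 14 * x + 26 * c * j ^ 15 * y + j ^ 16 * u)) = j ^ 28 * (13 * y^2 - 12 * (x * u))"
    for j x y u :: complex
  proof -
    \<comment> \<open>Treating the twelfth power as one variable keeps the polynomial identity small
      enough to expand.\<close>
    define e where "e = j ^ 12"
    have "13 * (12 * c * (e * j) * x + (e * j^2) * y)^2 - 12 * ((e * x) * (156 * c^2 * (e * j^2) * x + 26 * c * (e * j^3) * y + (e * j^4) * u))
        = (e * e * j^4) * (13 * y^2 - 12 * (x * u))"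
      by (simp add: algebra_simps power2_eq_square power3_eq_cube power4_eq_xxxx)
    moreover have "j ^ 13 = e * j" "j ^ 14 = e * j^2" "j ^ 15 = e * j^3" "j ^ 16 = e * j^4" "j ^ 28 = e * e * j^4"
      by (simp_all add: e_def flip: power_add power_Suc2)
    ultimately show ?thesis by (simp only: e_def)
  qed
  then show ?thesis unfolding bracket_def d1[OF z] d2 tr[OF z] J_def[symmetric] by blast
qed

lemma bracket_eq: "\<exists>C. \<forall>z\<in>upper_half_plane. bracket z = C * (eis 4 z * delta z ^ 2)"
proof -
  define c :: complex where "c = 2 * of_real pi * \<i>"
  define F1 where "F1 = fps_const c * (fps_X * fps_deriv delta_fps)"
  define F2 where "F2 = fps_const c * (fps_X * fps_deriv F1)"
  have q1: "qexp (deriv delta) F1" unfolding F1_def c_def by (rule qexp_deriv[OF qexp_delta])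
  have q2: "qexp (deriv (deriv delta)) F2" unfolding F2_def c_def by (rule qexp_deriv[OF q1])
  define W where "W = fps_const 13 * F1 ^ 2 - fps_const 12 * (delta_fps * F2)"
  have qW: "qexp bracket W" unfolding bracket_def[abs_def] W_def
    by (intro qexp_diff qexp_cmult qexp_power qexp_mult q1 q2 qexp_delta)
  have lW: "level_one 28 bracket W" using qW bracket_transform by (simp add: level_one_def)
  have lD: "level_one (4 + 12 * 2) (\<lambda>z. eis 4 z * delta z ^ 2) (eis_fps 4 * delta_fps ^ 2)"
    by (intro level_one_mult level_one_power level_one_delta level_one_eis) auto
  define V where "V = eis_fps 4 * delta_fps ^ 2"
  have o: "fps_nth delta_fps i = 0" "fps_nth F1 i = 0" "fps_nth F2 i = 0" if "i < 1" for i
    using that by (simp_all add: delta_fps_nth F1_def F2_def)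
  have V: "fps_nth V i = 0" if "i < 2" for i
    unfolding V_def power2_eq_square using that
    by (intro fps_mult_nth_order(1)[of 0 _ 2] fps_mult_nth_order(1)[of 1 _ 1]) (auto intro: o)
  have V2: "fps_nth V 2 = 1728^2"
  proof -
    have "fps_nth (delta_fps * delta_fps) i = 0" if "i < 2" for i
      using that fps_mult_nth_order(1)[of 1 delta_fps 1 delta_fps i] o by auto
    moreover have "fps_nth (delta_fps * delta_fps) 2 = 1728^2"
      using fps_mult_nth_order(2)[of 1 delta_fps 1 delta_fps] o by (simp add: delta_fps_nth numeral_2_eq_2)
    moreover from calculation(1) have "fps_nth (eis_fps 4 * (delta_fps * delta_fps)) (0 + 2) = fps_nth (eis_fps 4) 0 * fps_nth (delta_fps * delta_fps) 2"
      by (intro fps_mult_nth_order(2)) auto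
    ultimately have "fps_nth (eis_fps 4 * (delta_fps * delta_fps)) 2 = 1 * 1728^2"
      unfolding add_0 by (simp only: eis_fps_nth) simp
    then show ?thesis by (simp add: V_def power2_eq_square)
  qed
  have W: "fps_nth W i = 0" if "i < 2" for i
    using that fps_mult_nth_order(1)[of 1 F1 1 F1 i] fps_mult_nth_order(1)[of 1 delta_fps 1 F2 i] o
    by (simp add: W_def power2_eq_square)
  define C where "C = fps_nth W 2 / 1728^2"
  have "level_one 28 (\<lambda>z. bracket z - C * (eis 4 z * delta z ^ 2)) (W - fps_const C * V)"
    using level_one_diff[OF lW level_one_cmult, of "\<lambda>z. eis 4 z * delta z ^ 2" V C] lD by (simp add: V_def)
  then have l: "level_one 28 (\<lambda>z. bracket z - C * (eis 4 z * delta z ^ 2)) (W - fps_const C * V)" .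
  \<comment> \<open>As \<open>28 < 10 * 3\<close>, it is enough that the coefficients below index 3
    vanish.\<close>
  have "W - fps_const C * V = 0"
  proof (rule level_one_vanishing[OF l, of 3])
    fix i :: nat assume "i < 3"
    then have "i < 2 \<or> i = 2" by auto
    then show "fps_nth (W - fps_const C * V) i = 0" using V W V2 by (auto simp: C_def)
  qed auto
  then have "qexp (\<lambda>z. bracket z - C * (eis 4 z * delta z ^ 2)) 0" using l by (simp add: level_one_def)
  then have "\<forall>z\<in>upper_half_plane. bracket z - C * (eis 4 z * delta z ^ 2) = 0" by (simp add: qexp_def)
  then show ?thesis by auto
qed

lemma deriv_shift: "deriv (\<lambda>x. f (x + z)) = (\<lambda>x. deriv f (x + z))" for f :: "complex \<Rightarrow> complex"
  by (rule ext) (simp add: deriv_def DERIV_shift)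

text \<open>At a zero of order \<open>r > 0\<close> with leading coefficient \<open>a\<close>, the
  bracket has lowest coefficient \<open>(13 * r ^ 2 - 12 * r * (r - 1)) * a ^ 2\<close> in degree
  \<open>2 * r - 2\<close>. This is \<open>r ^ 2 + 12 * r\<close> times \<open>a ^ 2\<close>, not
  zero, whereas the square of \<open>delta\<close> starts only in degree
  \<open>2 * r\<close>.\<close>

lemma delta_nonzero: assumes z0: "z0 \<in> upper_half_plane" shows "delta z0 \<noteq> 0"
proof
  assume zero: "delta z0 = 0"
  obtain C where C: "\<And>z. z \<in> upper_half_plane \<Longrightarrow> bracket z = C * (eis 4 z * delta z ^ 2)" using bracket_eq by blast
  define S where "S = (\<lambda>x. x + z0) -` upper_half_plane"
  have opS: "open S" unfolding S_def by (intro open_vimage open_upper_half_plane continuous_intros)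
  have S0: "0 \<in> S" using z0 by (simp add: S_def)
  have shift_hol: "(\<lambda>x. f (x + z0)) holomorphic_on S" if "f holomorphic_on upper_half_plane" for f
  proof -
    have "(\<lambda>x. x + z0) holomorphic_on S" by (intro holomorphic_intros)
    from holomorphic_on_compose_gen[OF this that] show ?thesis by (auto simp: o_def S_def)
  qed
  have hol: "delta holomorphic_on upper_half_plane" by (rule qexp_holomorphic[OF qexp_delta])
  have "level_one 4 (eis 4) (eis_fps 4)" by (rule level_one_eis) auto
  then have holE: "eis 4 holomorphic_on upper_half_plane" unfolding level_one_def using qexp_holomorphic by blast
  define D where "D = (\<lambda>x. delta (x + z0))"
  define E where "E = (\<lambda>x. eis 4 (x + z0))"
  obtain d where d: "D has_fps_expansion d"
    using has_fps_expansion_fps_expansion[OF opS S0 shift_hol[OF hol]] by (auto simp: D_def)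
  obtain e where e: "E has_fps_expansion e"
    using has_fps_expansion_fps_expansion[OF opS S0 shift_hol[OF holE]] by (auto simp: E_def)
  have d1: "deriv D has_fps_expansion fps_deriv d" by (rule has_fps_expansion_deriv[OF d])
  have d2: "deriv (deriv D) has_fps_expansion fps_deriv (fps_deriv d)" by (rule has_fps_expansion_deriv[OF d1])
  have "(\<lambda>x. 13 * deriv D x ^ 2 - 12 * (D x * deriv (deriv D) x)) has_fps_expansion 13 * fps_deriv d ^ 2 - 12 * (d * fps_deriv (fps_deriv d))"
    by (intro fps_expansion_intros d d1 d2)
  then have x1: "(\<lambda>x. 13 * deriv D x ^ 2 - 12 * (D x * deriv (deriv D) x)) has_fps_expansion 13 * fps_deriv d ^ 2 - 12 * (d * fps_deriv (fps_deriv d))" .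
  have x2: "(\<lambda>x. C * (E x * D x ^ 2)) has_fps_expansion fps_const C * (e * d ^ 2)"
    by (intro fps_expansion_intros d e)
  have ev: "eventually (\<lambda>x. 13 * deriv D x ^ 2 - 12 * (D x * deriv (deriv D) x) = C * (E x * D x ^ 2)) (nhds 0)"
    unfolding eventually_nhds
  proof (intro exI[of _ S] conjI ballI opS S0)
    fix x assume "x \<in> S"
    then show "13 * deriv D x ^ 2 - 12 * (D x * deriv (deriv D) x) = C * (E x * D x ^ 2)"
      using C[of "x + z0"] by (simp add: D_def E_def deriv_shift bracket_def S_def)
  qed
  have eq: "13 * fps_deriv d ^ 2 - 12 * (d * fps_deriv (fps_deriv d)) = fps_const C * (e * d ^ 2)"
    by (rule fps_expansion_unique_complex[OF iffD1[OF has_fps_expansion_cong[OF ev refl] x1] x2])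
  have dne: "d \<noteq> 0"
  proof
    assume "d = 0"
    then have "eventually (\<lambda>x. D x = 0) (nhds 0)" using d by (simp add: has_fps_expansion_0_iff)
    then obtain r where r: "r > 0" "\<And>x. dist x 0 < r \<Longrightarrow> D x = 0" unfolding eventually_nhds_metric by blast
    have "delta z = 0" if z: "z \<in> upper_half_plane" for z
    proof (rule analytic_continuation_open[of "ball z0 r \<inter> upper_half_plane" upper_half_plane delta "\<lambda>_. 0"])
      show "ball z0 r \<inter> upper_half_plane \<noteq> {}"
      proof -
        have "z0 \<in> ball z0 r \<inter> upper_half_plane" using r(1) z0 by simp
        then show ?thesis by blast
      qed
      show "connected upper_half_plane" by (rule convex_connected[OF convex_upper_half_plane])
      fix w assume "w \<in> ball z0 r \<inter> upper_half_plane"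
      then have "dist (w - z0) 0 < r" by (simp add: dist_norm norm_minus_commute)
      then show "delta w = 0" using r(2)[of "w - z0"] by (simp add: D_def)
    qed (use hol z open_upper_half_plane in auto)
    then have "qexp delta 0" using qexp_cong[OF qexp_const[of 0]] by simp
    then have "delta_fps = 0" using qexp_unique[OF qexp_delta] by blast
    then show False using delta_fps_nth(2) by simp
  qed
  define r where "r = subdegree d"
  define a where "a = fps_nth d r"
  have a0: "a \<noteq> 0" using dne by (simp add: a_def r_def)
  have ord: "fps_nth d i = 0" if "i < r" for i using that unfolding r_def by (rule nth_less_subdegree_zero)
  have "fps_nth d 0 = 0" using has_fps_expansion_imp_0_eq_fps_nth_0[OF d] zero by (simp add: D_def)
  then have r0: "r > 0" using a0 by (intro Nat.gr0I) (auto simp: a_def)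
  \<comment> \<open>Operators of the form \<open>x d/dx\<close> act diagonally on coefficients, so
    all lowest terms are compared at index \<open>r + r\<close> without shifts.\<close>
  define p where "p = fps_X * fps_deriv d"
  define p2 where "p2 = fps_X * fps_deriv p"
  have p: "fps_nth p i = of_nat i * fps_nth d i" for i by (cases i) (simp_all add: p_def)
  have p2: "fps_nth p2 i = of_nat i ^ 2 * fps_nth d i" for i
    by (cases i) (simp_all add: p2_def p power2_eq_square)
  have p2_eq: "fps_X * (fps_X * fps_deriv (fps_deriv d)) = p2 - p"
    by (simp add: p2_def p_def algebra_simps)
  have "fps_X * fps_X * (13 * fps_deriv d ^ 2 - 12 * (d * fps_deriv (fps_deriv d))) = 13 * (p * p) - 12 * (d * (p2 - p))"
    by (subst p2_eq[symmetric]) (simp add: p_def algebra_simps power2_eq_square)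
  then have eq2: "13 * (p * p) - 12 * (d * (p2 - p)) = fps_X * fps_X * (fps_const C * (e * d ^ 2))" using eq by simp
  have "fps_nth (13 * (p * p) - 12 * (d * (p2 - p))) (r + r) = 13 * (fps_nth p r * fps_nth p r) - 12 * (fps_nth d r * fps_nth (p2 - p) r)"
    using fps_mult_nth_order(2)[of r p r p] fps_mult_nth_order(2)[of r d r "p2 - p"] ord
    by (simp add: p p2)
  also have "\<dots> = (of_nat r ^ 2 + 12 * of_nat r) * a ^ 2"
    by (simp add: p p2 a_def algebra_simps power2_eq_square)
  finally have l: "fps_nth (13 * (p * p) - 12 * (d * (p2 - p))) (r + r) = (of_nat r ^ 2 + 12 * of_nat r) * a ^ 2" .
  have "fps_nth (e * (d * d)) i = 0" if "i < r + r" for i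
    using fps_mult_nth_order(1)[of 0 e "r + r" "d * d" i] fps_mult_nth_order(1)[of r d r d] ord that by auto
  then have "fps_nth (fps_X * fps_X * (fps_const C * (e * d ^ 2))) (r + r) = 0"
    using r0 by (simp add: power2_eq_square mult.assoc fps_X_mult_nth)
  then have "(of_nat r ^ 2 + 12 * of_nat r) * a ^ 2 = 0" using l eq2 by simp
  then have "of_nat (r ^ 2 + 12 * r) = (0::complex)" using a0 by simp
  then have "r ^ 2 + 12 * r = 0" by (simp only: of_nat_eq_0_iff)
  then show False using r0 by simp
qed

lemma qexp_of_holomorphic:
  assumes g: "g holomorphic_on ball 0 1" and f: "\<And>z. z \<in> upper_half_plane \<Longrightarrow> f z = g (nome z)"
  obtains F where "qexp f F"
proof -
  define a where "a n = (deriv ^^ n) g 0 / fact n" for n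
  have "has_q_expansion 1 f a"
    unfolding has_q_expansion_def
  proof
    fix z assume z: "z \<in> upper_half_plane"
    then have q: "nome z \<in> ball 0 1" using norm_nome_less_1 by simp
    have "(\<lambda>n. a n * (nome z - 0) ^ n) sums g (nome z)"
      unfolding a_def by (rule holomorphic_power_series[OF g q])
    moreover have "exp (2 * of_real pi * \<i> * of_nat n * z / of_nat 1) = nome z ^ n" for n
      by (simp add: nome_def exp_of_nat_mult[symmetric] mult_ac)
    ultimately show "(\<lambda>n. a n * exp (2 * of_real pi * \<i> * of_nat n * z / of_nat 1)) sums f z" using f[OF z] by simp
  qed
  then show ?thesis using that unfolding has_q_expansion_1_iff by blast
qed

lemma fps_shift_1_mult: "fps_nth F 0 = 0 \<Longrightarrow> F = fps_X * fps_shift 1 F" for F :: "complex fps"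
  by (rule fps_ext) (auto simp: fps_X_mult_nth)

lemma qexp_shift:
  assumes "qexp f F" "fps_nth F 0 = 0" "z \<in> upper_half_plane"
  shows "f z = nome z * eval_fps (fps_shift 1 F) (nome z)"
proof -
  have "ereal (norm (nome z)) < fps_conv_radius (fps_shift 1 F)" using qexp_in_eball[OF assms(1,3)] by simp
  then have "eval_fps (fps_X * fps_shift 1 F) (nome z) = nome z * eval_fps (fps_shift 1 F) (nome z)"
    by (subst eval_fps_mult) auto
  then show ?thesis using assms fps_shift_1_mult[OF assms(2)] by (simp add: qexp_def)
qed

text \<open>In the variable \<open>q\<close> the form \<open>delta\<close> has a simple zero at 0
  and no other zero in the unit disc, so one factor \<open>q\<close> cancels and the quotient is
  holomorphic there.\<close>

lemma level_one_divide_delta: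
  assumes f: "level_one (w + 12) f F" and F0: "fps_nth F 0 = 0"
  obtains H where "level_one w (\<lambda>z. f z / delta z) H" "F = H * delta_fps"
proof -
  have qf: "qexp f F" using f by (simp add: level_one_def)
  define G1 where "G1 = eval_fps (fps_shift 1 F)"
  define G2 where "G2 = eval_fps (fps_shift 1 delta_fps)"
  have ball: "ball (0::complex) 1 \<subseteq> eball 0 (fps_conv_radius (fps_shift 1 A))" if "qexp a A" for a A
  proof
    fix x :: complex assume "x \<in> ball 0 1"
    then show "x \<in> eball 0 (fps_conv_radius (fps_shift 1 A))"
      using less_conv_radius[of "norm x" "fps_conv_radius A"] that by (simp add: qexp_def)
  qed
  have h1: "G1 holomorphic_on ball 0 1" and h2: "G2 holomorphic_on ball 0 1"
    unfolding G1_def G2_def by (intro holomorphic_on_eval_fps ball[OF qf] ball[OF qexp_delta])+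
  have nz: "G2 q \<noteq> 0" if q: "q \<in> ball 0 1" for q
  proof (cases "q = 0")
    case True
    then show ?thesis by (simp add: G2_def eval_fps_at_0 delta_fps_nth)
  next
    case False
    then obtain z where z: "z \<in> upper_half_plane" "nome z = q" using q by (auto intro: nome_surj)
    then show ?thesis using delta_nonzero[OF z(1)] qexp_shift[OF qexp_delta delta_fps_nth(1) z(1)] by (auto simp: G2_def)
  qed
  have "(\<lambda>q. G1 q / G2 q) holomorphic_on ball 0 1" using nz h1 h2 by (intro holomorphic_intros) auto
  moreover have "f z / delta z = G1 (nome z) / G2 (nome z)" if z: "z \<in> upper_half_plane" for z
    using qexp_shift[OF qf F0 z] qexp_shift[OF qexp_delta delta_fps_nth(1) z] by (simp add: G1_def G2_def)
  ultimately obtain H where H: "qexp (\<lambda>z. f z / delta z) H" by (rule qexp_of_holomorphic)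
  have "level_one w (\<lambda>z. f z / delta z) H"
    unfolding level_one_def
  proof (intro conjI H ballI)
    fix A z assume A: "A \<in> carrier SL2Z" and z: "z \<in> upper_half_plane"
    show "f (mobius A z) / delta (mobius A z) = automorphy_factor A z ^ w * (f z / delta z)"
      using f level_one_delta A z automorphy_factor_nonzero[OF A z] by (simp add: level_one_def power_add)
  qed
  moreover have "F = H * delta_fps"
  proof (rule qexp_unique[OF qf])
    show "qexp f (H * delta_fps)"
      by (rule qexp_cong[OF qexp_mult[OF H qexp_delta]]) (use delta_nonzero in simp)
  qed
  ultimately show ?thesis using that by blast
qed

text \<open>A power of \<open>eis 4\<close> with constant term 1 removes the constant term, and
  division by \<open>delta\<close> lowers the weight by 12. Weights divisible by 12 allow this with
  powers of \<open>eis 4\<close> alone.\<close>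

lemma level_one_span:
  "level_one (12 * w) f F \<Longrightarrow> \<exists>c. F = (\<Sum>j\<le>w. fps_const (c j) * (delta_fps ^ j * eis_fps 4 ^ (3 * (w - j))))"
proof (induction w arbitrary: f F)
  case 0
  have "F - fps_const (fps_nth F 0) = 0"
  proof (rule level_one_vanishing[where n = 1])
    show "level_one 0 (\<lambda>z. f z - fps_nth F 0) (F - fps_const (fps_nth F 0))"
      using 0 by (intro level_one_diff level_one_const) simp
  qed auto
  then show ?case by (intro exI[of _ "\<lambda>_. fps_nth F 0"]) simp
next
  case (Suc w)
  define a where "a = fps_nth F 0"
  have "level_one (4 * (3 * Suc w)) (\<lambda>z. eis 4 z ^ (3 * Suc w)) (eis_fps 4 ^ (3 * Suc w))"
    by (intro level_one_power level_one_eis) auto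
  then have "level_one (12 * Suc w) (\<lambda>z. eis 4 z ^ (3 * Suc w)) (eis_fps 4 ^ (3 * Suc w))"
    by (simp only: mult.assoc[symmetric]) simp
  then have "level_one (12 * Suc w) (\<lambda>z. f z - a * eis 4 z ^ (3 * Suc w)) (F - fps_const a * eis_fps 4 ^ (3 * Suc w))"
    using Suc.prems by (intro level_one_diff level_one_cmult)
  moreover have "12 * Suc w = 12 * w + 12" by simp
  ultimately have l: "level_one (12 * w + 12) (\<lambda>z. f z - a * eis 4 z ^ (3 * Suc w)) (F - fps_const a * eis_fps 4 ^ (3 * Suc w))" by (simp only:)
  have "fps_nth (eis_fps 4 ^ (3 * Suc w)) 0 = 1" by (simp add: fps_nth_power_0 eis_fps_nth)
  then have "fps_nth (F - fps_const a * eis_fps 4 ^ (3 * Suc w)) 0 = 0" by (simp add: a_def)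
  from level_one_divide_delta[OF l this] obtain h H where h: "level_one (12 * w) h H"
    and H: "F - fps_const a * eis_fps 4 ^ (3 * Suc w) = H * delta_fps" by metis
  from Suc.IH[OF h] obtain c where c: "H = (\<Sum>j\<le>w. fps_const (c j) * (delta_fps ^ j * eis_fps 4 ^ (3 * (w - j))))" by blast
  define c' where "c' j = (case j of 0 \<Rightarrow> a | Suc i \<Rightarrow> c i)" for j
  have "F = fps_const a * eis_fps 4 ^ (3 * Suc w) + H * delta_fps" using H by (simp add: algebra_simps)
  also have "H * delta_fps = (\<Sum>j\<le>w. fps_const (c' (Suc j)) * (delta_fps ^ Suc j * eis_fps 4 ^ (3 * (Suc w - Suc j))))"
    unfolding c sum_distrib_right by (intro sum.cong) (simp_all add: c'_def mult_ac)
  also have "fps_const a * eis_fps 4 ^ (3 * Suc w) + \<dots> = (\<Sum>j\<le>Suc w. fps_const (c' j) * (delta_fps ^ j * eis_fps 4 ^ (3 * (Suc w - j))))"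
    unfolding sum.atMost_Suc_shift by (simp add: c'_def)
  finally show ?case by blast
qed

section \<open>Sturm's bound\<close>

context valuation_ring
begin

definition integral_fps :: "'a fps \<Rightarrow> bool" where
  "integral_fps F \<longleftrightarrow> (\<forall>n. fps_nth F n \<in> V)"

lemma integral_fps_mult: "integral_fps F \<Longrightarrow> integral_fps G \<Longrightarrow> integral_fps (F * G)"
  unfolding integral_fps_def fps_mult_nth by (intro allI subring_set_sum[OF subring] VD(4)) auto

lemma integral_fps_const: "c \<in> V \<Longrightarrow> integral_fps (fps_const c)"
  using VD(2) by (auto simp: integral_fps_def)

lemma integral_fps_1: "integral_fps 1"
  using integral_fps_const[OF VD(1)] by simp

lemma integral_fps_power: "integral_fps F \<Longrightarrow> integral_fps (F ^ n)"
  by (induction n) (auto intro: integral_fps_mult integral_fps_1)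

lemma integral_fps_diff: "integral_fps F \<Longrightarrow> integral_fps G \<Longrightarrow> integral_fps (F - G)"
  unfolding integral_fps_def fps_sub_nth using V_diff by blast

lemma integral_fps_sum: "(\<And>i. i \<in> A \<Longrightarrow> integral_fps (F i)) \<Longrightarrow> integral_fps (\<Sum>i\<in>A. F i)"
  unfolding integral_fps_def fps_sum_nth by (intro allI subring_set_sum[OF subring]) auto

lemma fps_power_order:
  assumes F: "integral_fps F" and n: "\<And>i. i < n \<Longrightarrow> fps_nth F i \<in> M"
  shows "(\<forall>i<e * n. fps_nth (F ^ e) i \<in> M) \<and> fps_nth (F ^ e) (e * n) - fps_nth F n ^ e \<in> M"
proof (induction e)
  case 0 show ?case using M_0 by simp
next
  case (Suc e)
  have Fe: "\<And>i. fps_nth (F ^ e) i \<in> V" "\<And>i. fps_nth F i \<in> V"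
    using integral_fps_power[OF F, of e] F by (auto simp: integral_fps_def)
  have IH: "\<And>i. i < e * n \<Longrightarrow> fps_nth (F ^ e) i \<in> M" "fps_nth (F ^ e) (e * n) - fps_nth F n ^ e \<in> M"
    using Suc by auto
  note * = fps_mult_nth_ideal[OF subring M_ideal Fe(2) n Fe(1) IH(1)]
  have "fps_nth F n * (fps_nth (F ^ e) (e * n) - fps_nth F n ^ e) \<in> M"
    using M_mult Fe(2) IH(2) by blast
  then have "(fps_nth (F * F ^ e) (n + e * n) - fps_nth F n * fps_nth (F ^ e) (e * n)) + fps_nth F n * (fps_nth (F ^ e) (e * n) - fps_nth F n ^ e) \<in> M"
    by (intro M_add *(2))
  then have "fps_nth (F ^ Suc e) (Suc e * n) - fps_nth F n ^ Suc e \<in> M"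
    by (simp add: algebra_simps)
  moreover have "\<forall>i<Suc e * n. fps_nth (F ^ Suc e) i \<in> M" using *(1) by simp
  ultimately show ?case by blast
qed

end

section \<open>Symmetric functions of the conjugates of a form\<close>

lemma monic_mult_linear:
  fixes q :: "complex poly"
  assumes "Polynomial.lead_coeff q = 1"
  shows "Polynomial.lead_coeff ([:- c, 1:] * q) = 1" "Polynomial.degree ([:- c, 1:] * q) = Suc (Polynomial.degree q)"
proof -
  have "Polynomial.lead_coeff [:- c, 1:] = 1" by simp
  then show "Polynomial.lead_coeff ([:- c, 1:] * q) = 1" using assms by (simp only: lead_coeff_mult mult_1)
  have "q \<noteq> 0" using assms by auto
  then have "Polynomial.degree ([:- c, 1:] * q) = Polynomial.degree [:- c, 1:] + Polynomial.degree q"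
    by (intro degree_mult_eq) auto
  then show "Polynomial.degree ([:- c, 1:] * q) = Suc (Polynomial.degree q)" by simp
qed

lemma prod_linear_monic:
  fixes a :: "'a \<Rightarrow> complex"
  assumes "finite Q"
  shows "Polynomial.degree (\<Prod>x\<in>Q. [:- a x, 1:]) = card Q \<and> Polynomial.lead_coeff (\<Prod>x\<in>Q. [:- a x, 1:]) = 1"
  using assms
proof (induction Q)
  case (insert x Q)
  then show ?case unfolding prod.insert[OF insert(1,2)] card_insert_disjoint[OF insert(1,2)]
    using monic_mult_linear[of "\<Prod>x\<in>Q. [:- a x, 1:]" "a x"] by metis
qed simp

lemma coeff_linear_mult:
  fixes p :: "complex poly"
  shows "Polynomial.coeff ([:b, 1:] * p) i = b * Polynomial.coeff p i + (if i = 0 then 0 else Polynomial.coeff p (i - 1))"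
  by (cases i) (simp_all add: mult_pCons_left)

text \<open>The coefficient is homogeneous of degree \<open>card Q - i\<close> in the roots; this
  determines the weight of the level-one forms in the proof of Sturm's bound.\<close>

lemma coeff_prod_linear_scale:
  fixes a :: "'a \<Rightarrow> complex"
  assumes "finite Q"
  shows "i \<le> card Q \<Longrightarrow> Polynomial.coeff (\<Prod>x\<in>Q. [:- (l * a x), 1:]) i = l ^ (card Q - i) * Polynomial.coeff (\<Prod>x\<in>Q. [:- a x, 1:]) i"
  using assms
proof (induction Q arbitrary: i)
  case (insert x Q)
  have top: "Polynomial.coeff (\<Prod>x\<in>Q. [:- b x, 1:]) i = 0" if "i > card Q" for b :: "'a \<Rightarrow> complex" and i
    using prod_linear_monic[OF insert(1), of b] that by (intro coeff_eq_0) simp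
  show ?case
  proof (cases "i \<le> card Q")
    case True
    then have e: "l ^ (card (insert x Q) - i) = l * l ^ (card Q - i)" using insert by (simp add: Suc_diff_le)
    have "i \<noteq> 0 \<Longrightarrow> l ^ (card (insert x Q) - i) = l ^ (card Q - (i - 1))" using insert by simp
    then show ?thesis using insert True e by (auto simp: coeff_linear_mult algebra_simps simp del: mult_pCons_left)
  next
    case False
    then have i: "i = Suc (card Q)" using insert by simp
    then show ?thesis using insert top[of i] by (auto simp: coeff_linear_mult simp del: mult_pCons_left)
  qed
qed simp

lemma coeff_prod_linear_holomorphic:
  assumes "finite Q" "\<And>x. x \<in> Q \<Longrightarrow> a x holomorphic_on S"
  shows "(\<lambda>z. Polynomial.coeff (\<Prod>x\<in>Q. [:- a x z, 1:]) i) holomorphic_on S"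
  using assms
proof (induction Q arbitrary: i)
  case (insert x Q)
  have "(\<lambda>z. - a x z * Polynomial.coeff (\<Prod>x\<in>Q. [:- a x z, 1:]) i + (if i = 0 then 0 else Polynomial.coeff (\<Prod>x\<in>Q. [:- a x z, 1:]) (i - 1))) holomorphic_on S"
    using insert by (cases "i = 0") (auto intro!: holomorphic_intros)
  then show ?case using insert by (simp add: coeff_linear_mult del: mult_pCons_left)
qed (auto intro!: holomorphic_intros)

lemma coeff_prod_linear_bounded:
  assumes "finite Q" "\<And>x. x \<in> Q \<Longrightarrow> \<exists>B. \<forall>z\<in>S. cmod (a x z) \<le> B"
  shows "\<exists>B. \<forall>z\<in>S. cmod (Polynomial.coeff (\<Prod>x\<in>Q. [:- a x z, 1:]) i) \<le> B"
  using assms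
proof (induction Q arbitrary: i)
  case (insert x Q)
  obtain B where B: "\<And>z. z \<in> S \<Longrightarrow> cmod (a x z) \<le> B" using insert.prems[of x] by auto
  have "\<exists>B. \<forall>z\<in>S. cmod (Polynomial.coeff (\<Prod>x\<in>Q. [:- a x z, 1:]) j) \<le> B" for j
    using insert.IH insert.prems by auto
  then obtain C where C: "\<And>j z. z \<in> S \<Longrightarrow> cmod (Polynomial.coeff (\<Prod>x\<in>Q. [:- a x z, 1:]) j) \<le> C j" by metis
  show ?case
  proof (intro exI ballI)
    fix z assume z: "z \<in> S"
    have "0 \<le> C (i - 1)" using C[OF z, of "i - 1"] norm_ge_zero order_trans by blast
    moreover have "cmod (- a x z * Polynomial.coeff (\<Prod>x\<in>Q. [:- a x z, 1:]) i) \<le> \<bar>B\<bar> * C i"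
      unfolding norm_mult norm_minus_cancel using B[OF z] C[OF z, of i] by (intro mult_mono) auto
    ultimately have "cmod (- a x z * Polynomial.coeff (\<Prod>x\<in>Q. [:- a x z, 1:]) i + (if i = 0 then 0 else Polynomial.coeff (\<Prod>x\<in>Q. [:- a x z, 1:]) (i - 1))) \<le> \<bar>B\<bar> * C i + C (i - 1)"
      using C[OF z, of "i - 1"] by (intro order_trans[OF norm_triangle_ineq] add_mono) auto
    then show "cmod (Polynomial.coeff (\<Prod>x\<in>insert x Q. [:- a x z, 1:]) i) \<le> \<bar>B\<bar> * C i + C (i - 1)"
      using insert by (simp add: coeff_linear_mult del: mult_pCons_left)
  qed
qed (auto intro!: exI[of _ 1] simp: coeff_1)

section \<open>Cosets of the congruence subgroup\<close>

definition adj2 :: "int^2^2 \<Rightarrow> int^2^2" where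
  "adj2 A = mat2 (A$2$2) (- (A$1$2)) (- (A$2$1)) (A$1$1)"

lemma mat2_eqI: "(A::int^2^2)$1$1 = B$1$1 \<Longrightarrow> A$1$2 = B$1$2 \<Longrightarrow> A$2$1 = B$2$1 \<Longrightarrow> A$2$2 = B$2$2 \<Longrightarrow> A = B"
  by (simp add: vec_eq_iff forall_2)

lemma adj2:
  assumes "A \<in> carrier SL2Z"
  shows "adj2 A \<in> carrier SL2Z" "A ** adj2 A = mat 1" "adj2 A ** A = mat 1"
  using assms unfolding SL2Z_iff adj2_def
  by (auto intro!: mat2_eqI simp: matrix_mult_2 algebra_simps)

definition coset :: "nat \<Rightarrow> int^2^2 \<Rightarrow> (int^2^2) set" where
  "coset N A = (\<lambda>C. C ** A) ` Gamma0 N"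

lemma rcosets_eq: "rcosets\<^bsub>SL2Z\<^esub> (Gamma0 N) = coset N ` carrier SL2Z"
  by (auto simp: RCOSETS_def r_coset_def coset_def SL2Z_def)

lemma Gamma0_SL2Z: "C \<in> Gamma0 N \<Longrightarrow> C \<in> carrier SL2Z"
  by (simp add: Gamma0_def)

lemma mat_1_Gamma0: "mat 1 \<in> Gamma0 N"
  using mat_1_SL2Z by (simp add: Gamma0_def)

lemma Gamma0_mult: "C \<in> Gamma0 N \<Longrightarrow> D \<in> Gamma0 N \<Longrightarrow> C ** D \<in> Gamma0 N"
  using SL2Z_mult by (auto simp: Gamma0_def matrix_mult_2)

lemma adj2_Gamma0: "C \<in> Gamma0 N \<Longrightarrow> adj2 C \<in> Gamma0 N"
  using adj2(1) by (auto simp: Gamma0_def) (simp add: adj2_def)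

lemma coset_eqI: assumes "C \<in> Gamma0 N" shows "coset N (C ** A) = coset N A"
proof
  show "coset N (C ** A) \<subseteq> coset N A"
    using Gamma0_mult assms by (auto simp: coset_def matrix_mul_assoc)
  show "coset N A \<subseteq> coset N (C ** A)"
  proof
    fix x assume "x \<in> coset N A"
    then obtain D where D: "D \<in> Gamma0 N" "x = D ** A" by (auto simp: coset_def)
    have "x = (D ** adj2 C) ** (C ** A)"
      using adj2(3)[OF Gamma0_SL2Z[OF assms]] by (simp add: D(2) matrix_mul_assoc[symmetric]) (simp add: matrix_mul_assoc)
    then show "x \<in> coset N (C ** A)" using Gamma0_mult[OF D(1) adj2_Gamma0[OF assms]] by (auto simp: coset_def)
  qed
qed

text \<open>The coset of a matrix is determined by its bottom row modulo \<open>N\<close>: for two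
  such matrices the lower left entry of the quotient is a two-by-two determinant of bottom
  rows.\<close>

lemma finite_index: assumes "N \<ge> 1" shows "finite (coset N ` carrier SL2Z)"
proof -
  define \<phi> where "\<phi> = (\<lambda>A::int^2^2. (A$2$1 mod int N, A$2$2 mod int N))"
  have eq: "coset N A = coset N B" if AB: "A \<in> carrier SL2Z" "B \<in> carrier SL2Z" "\<phi> A = \<phi> B" for A B
  proof -
    define C where "C = A ** adj2 B"
    have "C ** B = A" unfolding C_def using adj2(3)[OF AB(2)] by (simp add: matrix_mul_assoc[symmetric])
    moreover have "C \<in> Gamma0 N"
    proof -
      have "[A$2$1 = B$2$1] (mod int N)" "[A$2$2 = B$2$2] (mod int N)" using AB(3) by (simp_all add: \<phi>_def cong_def)
      then have "[A$2$1 * B$2$2 - A$2$2 * B$2$1 = B$2$1 * B$2$2 - B$2$2 * B$2$1] (mod int N)"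
        by (intro cong_diff cong_mult cong_refl)
      then have "int N dvd A$2$1 * B$2$2 - A$2$2 * B$2$1" by (simp add: cong_iff_dvd_diff mult.commute)
      then have "int N dvd C$2$1" by (simp add: C_def matrix_mult_2 adj2_def)
      then show ?thesis using SL2Z_mult[OF AB(1) adj2(1)[OF AB(2)]] by (simp add: Gamma0_def C_def)
    qed
    ultimately show ?thesis using coset_eqI[of C N B] by simp
  qed
  have "\<phi> ` carrier SL2Z \<subseteq> {0..<int N} \<times> {0..<int N}" using assms by (auto simp: \<phi>_def)
  then have fin: "finite (\<phi> ` carrier SL2Z)" by (rule finite_subset) auto
  define r where "r y = (SOME A. A \<in> carrier SL2Z \<and> \<phi> A = y)" for y
  have r: "r (\<phi> A) \<in> carrier SL2Z \<and> \<phi> (r (\<phi> A)) = \<phi> A" if "A \<in> carrier SL2Z" for A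
    unfolding r_def by (rule someI[of _ A]) (use that in simp)
  have "coset N ` carrier SL2Z \<subseteq> (\<lambda>y. coset N (r y)) ` \<phi> ` carrier SL2Z"
  proof
    fix X' assume "X' \<in> coset N ` carrier SL2Z"
    then obtain A where A: "A \<in> carrier SL2Z" "X' = coset N A" by blast
    then have "X' = coset N (r (\<phi> A))" using eq[of A "r (\<phi> A)"] r[OF A(1)] by simp
    then show "X' \<in> (\<lambda>y. coset N (r y)) ` \<phi> ` carrier SL2Z" using A(1) by blast
  qed
  then show ?thesis using fin finite_subset by blast
qed

text \<open>Euler's theorem makes the nonzero values roots of unity. This removes the character from
  powers of a form, and it makes the values units of the valuation ring.\<close>

lemma dirichlet_character_facts:
  assumes chi: "dirichlet_character N chi" and N: "N \<ge> 1"
  shows "chi 1 = 1" and "coprime a (int N) \<Longrightarrow> chi a ^ totient N = 1"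
proof -
  have m: "chi (a * b) = chi a * chi b" and per: "chi (a + int N) = chi a" and nz: "chi a \<noteq> 0 \<longleftrightarrow> coprime a (int N)" for a b
    using chi by (auto simp: dirichlet_character_def)
  have "chi 1 * chi 1 = chi 1" using m[of 1 1] by simp
  moreover have "chi 1 \<noteq> 0" using nz[of 1] by simp
  ultimately show one: "chi 1 = 1" by simp
  have pern: "chi (a + int n * int N) = chi a" for a n
  proof (induction n)
    case (Suc n)
    have "chi (a + int (Suc n) * int N) = chi (a + int n * int N + int N)" by (simp add: algebra_simps)
    then show ?case using per Suc by simp
  qed simp
  have permod: "chi (a mod int N) = chi a" for a
  proof (cases "a div int N \<ge> 0")
    case True
    then have "a = a mod int N + int (nat (a div int N)) * int N" by (simp add: mult.commute)
    then show ?thesis using pern[of "a mod int N" "nat (a div int N)"] by metis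
  next
    case False
    then have "a mod int N = a + int (nat (- (a div int N))) * int N" using minus_div_mult_eq_mod[of a "int N"] by simp
    then show ?thesis using pern[of a "nat (- (a div int N))"] by metis
  qed
  have pow: "chi (a ^ n) = chi a ^ n" for a n
    by (induction n) (simp_all add: one m)
  assume a: "coprime a (int N)"
  define b where "b = nat (a mod int N)"
  have b: "int b = a mod int N" using N by (simp add: b_def)
  have "coprime (int b) (int N)" using a N unfolding b by (simp add: coprime_mod_left_iff)
  then have "coprime b N" by simp
  then have "[b ^ totient N = 1] (mod N)" by (rule euler_theorem)
  then have "[int b ^ totient N = 1] (mod int N)" by (metis cong_int_iff of_nat_1 of_nat_power)
  then have "chi (int b ^ totient N) = chi 1" using permod by (metis cong_def)
  then have "chi (int b) ^ totient N = 1" using pow one by simp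
  then show "chi a ^ totient N = 1" using permod[of a] b by simp
qed

lemma Gamma0_coprime: assumes "C \<in> Gamma0 N" shows "coprime (C$2$2) (int N)"
proof (rule coprimeI)
  fix d assume d: "d dvd C$2$2" "d dvd int N"
  have "int N dvd C$2$1" using assms by (simp add: Gamma0_def)
  then have "d dvd C$1$1 * C$2$2 - C$1$2 * C$2$1" using d by (meson dvd_diff dvd_mult dvd_trans)
  then show "is_unit d" using assms by (simp add: Gamma0_def SL2Z_iff)
qed

text \<open>Sturm's theorem. The form \<open>h\<^sup>e\<close> (\<open>e = 12 \<phi>(N)\<close>) is a root of the polynomial \<open>\<Prod>(T - (h|\<gamma>)\<^sup>e)\<close>
  over \<open>\<Gamma>\<^sub>0(N) \<setminus> SL\<^sub>2(\<int>)\<close>, whose coefficients are forms of level one and so combinations of the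
  \<open>delta\<^sup>j eis 4\<^bsup>3(w-j)\<^esup>\<close>. Scaling makes all these coefficients integral and one of them a unit; no integrality of
  the conjugates \<open>h|\<gamma>\<close> is needed. As a form of level one and weight \<open>12 w\<close> that does not vanish
  modulo the maximal ideal has order at most \<open>w\<close>, a large order of \<open>h\<close> would leave a unique
  summand of least order in \<open>\<Sum>s\<^sub>i h\<^bsup>e i\<^esup> = 0\<close>.\<close>

theorem sturm_bound:
  fixes V :: "complex set"
  assumes V: "valuation_ring V" and u: "1728 \<notin> valuation_ring.M V"
    and N: "N \<ge> 1" and chi: "dirichlet_character N chi"
    and hol: "h holomorphic_on upper_half_plane"
    and tr: "\<And>A z. A \<in> Gamma0 N \<Longrightarrow> z \<in> upper_half_plane \<Longrightarrow> h (mobius A z) = chi (A$2$2) * automorphy_factor A z ^ k * h z"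
    and bdd: "\<And>A. A \<in> carrier SL2Z \<Longrightarrow> \<exists>B. \<forall>z. Im z \<ge> 1 \<longrightarrow> cmod (slash k h A z) \<le> B"
    and qF: "qexp h F" and FV: "\<And>n. fps_nth F n \<in> V"
    and small: "\<And>n. real n \<le> real k / 12 * real (group_index SL2Z (Gamma0 N)) \<Longrightarrow> fps_nth F n \<in> valuation_ring.M V"
  shows "fps_nth F n \<in> valuation_ring.M V"
proof (rule ccontr)
  interpret valuation_ring V by fact
  assume "fps_nth F n \<notin> M"
  define n1 where "n1 = (LEAST n. fps_nth F n \<notin> M)"
  have n1: "fps_nth F n1 \<notin> M" unfolding n1_def using \<open>fps_nth F n \<notin> M\<close> by (rule LeastI)
  have n1_least: "fps_nth F i \<in> M" if "i < n1" for i using that not_less_Least unfolding n1_def by blast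
  define Q where "Q = coset N ` carrier SL2Z"
  define m where "m = card Q"
  have finQ: "finite Q" unfolding Q_def by (rule finite_index[OF N])
  have idx: "group_index SL2Z (Gamma0 N) = m" by (simp add: group_index_def rcosets_eq m_def Q_def)
  have n1_big: "real n1 > real k / 12 * real m" using small[of n1] n1 unfolding idx by fastforce
  \<comment> \<open>The factor \<open>totient N\<close> trivialises the character, and the factor 12
    brings all weights into the range of \<open>level_one_span\<close>.\<close>
  define e where "e = 12 * totient N"
  have e0: "e > 0" using N by (simp add: e_def)
  define w where "w = k * totient N"
  have ke: "k * e = 12 * w" by (simp add: e_def w_def)
  define H where "H A z = slash k h A z ^ e" for A z
  have H_left: "H (C ** A) z = H A z" if C: "C \<in> Gamma0 N" and A: "A \<in> carrier SL2Z" and z: "z \<in> upper_half_plane" for C A z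
  proof -
    have CS: "C \<in> carrier SL2Z" by (rule Gamma0_SL2Z[OF C])
    have nz: "automorphy_factor C (mobius A z) \<noteq> 0"
      by (rule automorphy_factor_nonzero[OF CS mobius_upper_half_plane[OF A z]])
    have "slash k h (C ** A) z = chi (C$2$2) * slash k h A z"
      using nz tr[OF C mobius_upper_half_plane[OF A z]]
      by (simp add: slash_def mobius_mult[OF CS A z] power_mult_distrib)
    moreover have "chi (C$2$2) ^ e = 1"
      using dirichlet_character_facts(2)[OF chi N Gamma0_coprime[OF C]] by (simp add: e_def mult.commute[of 12] power_mult)
    ultimately show ?thesis by (simp add: H_def power_mult_distrib)
  qed
  have H_right: "H A (mobius B z) = automorphy_factor B z ^ (k * e) * H (A ** B) z"
    if A: "A \<in> carrier SL2Z" and B: "B \<in> carrier SL2Z" and z: "z \<in> upper_half_plane" for A B z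
  proof -
    have nz: "automorphy_factor B z \<noteq> 0" by (rule automorphy_factor_nonzero[OF B z])
    have "slash k h A (mobius B z) = automorphy_factor B z ^ k * slash k h (A ** B) z"
      using nz by (simp add: slash_def mobius_mult[OF A B z] power_mult_distrib)
    then show ?thesis by (simp add: H_def power_mult_distrib power_mult)
  qed
  \<comment> \<open>By \<open>H_left\<close> the conjugate depends only on the coset, so an
    arbitrary representative may be chosen.\<close>
  define HX where "HX Y z = H (SOME A. A \<in> Y) z" for Y z
  have HX: "HX (coset N A) z = H A z" if A: "A \<in> carrier SL2Z" and z: "z \<in> upper_half_plane" for A z
  proof -
    have "A \<in> coset N A" unfolding coset_def using mat_1_Gamma0[of N] by (intro image_eqI[of _ _ "mat 1"]) auto
    then have "(SOME B. B \<in> coset N A) \<in> coset N A" by (rule someI)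
    then obtain C where "C \<in> Gamma0 N" "(SOME B. B \<in> coset N A) = C ** A" by (auto simp: coset_def)
    then show ?thesis using H_left A z by (simp add: HX_def)
  qed
  have H_hol: "H A holomorphic_on upper_half_plane" if A: "A \<in> carrier SL2Z" for A
  proof -
    have "mobius A holomorphic_on upper_half_plane"
      unfolding holomorphic_on_open[OF open_upper_half_plane] using mobius_has_derivative(1)[OF A] by blast
    then have "(h \<circ> mobius A) holomorphic_on upper_half_plane"
      by (rule holomorphic_on_compose_gen[OF _ hol]) (use mobius_upper_half_plane[OF A] in auto)
    moreover have "automorphy_factor A holomorphic_on upper_half_plane"
      unfolding automorphy_factor_def[abs_def] by (intro holomorphic_intros)
    ultimately show ?thesis unfolding H_def[abs_def] slash_def
      using automorphy_factor_nonzero[OF A] by (auto intro!: holomorphic_intros simp: o_def)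
  qed
  have HX_hol: "HX Y holomorphic_on upper_half_plane" if "Y \<in> Q" for Y
  proof -
    obtain A where A: "A \<in> carrier SL2Z" "Y = coset N A" using \<open>Y \<in> Q\<close> by (auto simp: Q_def)
    show ?thesis by (rule holomorphic_transform[OF H_hol[OF A(1)]]) (simp add: A HX)
  qed
  have HX_bdd: "\<exists>B. \<forall>z\<in>{z. Im z \<ge> 1}. cmod (HX Y z) \<le> B" if "Y \<in> Q" for Y
  proof -
    obtain A where A: "A \<in> carrier SL2Z" "Y = coset N A" using \<open>Y \<in> Q\<close> by (auto simp: Q_def)
    obtain B where B: "\<And>z. Im z \<ge> 1 \<Longrightarrow> cmod (slash k h A z) \<le> B" using bdd[OF A(1)] by blast
    have "cmod (HX Y z) \<le> B ^ e" if "Im z \<ge> 1" for z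
      using B[OF that] HX[OF A(1), of z] that
      by (simp add: A(2) upper_half_plane_iff H_def norm_power power_mono)
    then show ?thesis by blast
  qed
  define act where "act B Y = (\<lambda>A. A ** B) ` Y" for B :: "int^2^2" and Y :: "(int^2^2) set"
  have act: "act B (coset N A) = coset N (A ** B)" for A B
    by (auto simp: act_def coset_def matrix_mul_assoc image_image)
  have act_bij: "bij_betw (act B) Q Q" if B: "B \<in> carrier SL2Z" for B
  proof (rule bij_betw_byWitness[where f' = "act (adj2 B)"])
    show "\<forall>a\<in>Q. act (adj2 B) (act B a) = a"
      using adj2(2)[OF B] by (auto simp: Q_def act matrix_mul_assoc[symmetric])
    show "\<forall>a\<in>Q. act B (act (adj2 B) a) = a"
      using adj2(3)[OF B] by (auto simp: Q_def act matrix_mul_assoc[symmetric])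
    show "act B ` Q \<subseteq> Q" using SL2Z_mult B by (auto simp: Q_def act)
    show "act (adj2 B) ` Q \<subseteq> Q" using SL2Z_mult adj2(1)[OF B] by (auto simp: Q_def act)
  qed
  have HX_act: "HX Y (mobius B z) = automorphy_factor B z ^ (k * e) * HX (act B Y) z"
    if "Y \<in> Q" and B: "B \<in> carrier SL2Z" and z: "z \<in> upper_half_plane" for Y B z
  proof -
    obtain A where A: "A \<in> carrier SL2Z" "Y = coset N A" using \<open>Y \<in> Q\<close> by (auto simp: Q_def)
    show ?thesis using H_right[OF A(1) B z] HX[OF A(1) mobius_upper_half_plane[OF B z]] HX[OF SL2Z_mult[OF A(1) B] z]
      by (simp add: A(2) act)
  qed
  define Pz where "Pz z = (\<Prod>Y\<in>Q. [:- HX Y z, 1:])" for z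
  define s where "s i z = Polynomial.coeff (Pz z) i" for i z
  have s_trans: "s i (mobius B z) = automorphy_factor B z ^ (k * e * (m - i)) * s i z"
    if i: "i \<le> m" and B: "B \<in> carrier SL2Z" and z: "z \<in> upper_half_plane" for i B z
  proof -
    have "Pz (mobius B z) = (\<Prod>Y\<in>Q. [:- (automorphy_factor B z ^ (k * e) * HX (act B Y) z), 1:])"
      unfolding Pz_def by (intro prod.cong) (simp_all add: HX_act B z)
    then have "s i (mobius B z) = (automorphy_factor B z ^ (k * e)) ^ (m - i) * Polynomial.coeff (\<Prod>Y\<in>Q. [:- HX (act B Y) z, 1:]) i"
      unfolding s_def m_def using coeff_prod_linear_scale[OF finQ] i by (simp add: m_def)
    also have "(\<Prod>Y\<in>Q. [:- HX (act B Y) z, 1:]) = Pz z"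
      unfolding Pz_def by (rule prod.reindex_bij_betw[OF act_bij[OF B]])
    finally show ?thesis by (simp add: s_def power_mult)
  qed
  have s_level_one: "\<exists>S. level_one (12 * (w * (m - i))) (s i) S" if i: "i \<le> m" for i
  proof -
    have sh: "s i holomorphic_on upper_half_plane"
      unfolding s_def[abs_def] Pz_def by (rule coeff_prod_linear_holomorphic[of Q HX, OF finQ HX_hol])
    obtain B where B: "\<forall>z\<in>{z. Im z \<ge> 1}. cmod (s i z) \<le> B"
      using coeff_prod_linear_bounded[of Q "{z. Im z \<ge> 1}" HX i, OF finQ HX_bdd] unfolding s_def Pz_def by blast
    have per: "s i (z + 1) = s i z" if "z \<in> upper_half_plane" for z
      using s_trans[OF i translation_SL2Z that, of 1] by (simp add: mobius_translation automorphy_factor_translation)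
    obtain S where "qexp (s i) S"
      by (rule periodic_bounded_qexp[OF sh per, of B]) (use B in auto)
    moreover have "k * e * (m - i) = 12 * (w * (m - i))" by (simp add: ke)
    ultimately show ?thesis using s_trans[OF i] unfolding level_one_def by metis
  qed
  then obtain S where S: "\<And>i. i \<le> m \<Longrightarrow> level_one (12 * (w * (m - i))) (s i) (S i)" by metis
  have "\<exists>c. S i = (\<Sum>j\<le>w * (m - i). fps_const (c j) * (delta_fps ^ j * eis_fps 4 ^ (3 * (w * (m - i) - j))))" if "i \<le> m" for i
    by (rule level_one_span[OF S[OF that]])
  then obtain c where c: "\<And>i. i \<le> m \<Longrightarrow> S i = (\<Sum>j\<le>w * (m - i). fps_const (c i j) * (delta_fps ^ j * eis_fps 4 ^ (3 * (w * (m - i) - j))))"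
    by metis
  have qs: "qexp (s i) (S i)" if "i \<le> m" for i using S[OF that] by (simp add: level_one_def)
  have monic: "Polynomial.degree (Pz z) = m" "s m z = 1" for z
    using prod_linear_monic[OF finQ, of "\<lambda>Y. HX Y z"] by (auto simp: Pz_def s_def m_def)
  have "S m = 1"
    using qexp_unique[OF qs[of m] qexp_cong[OF qexp_const[of 1]]] monic by simp
  moreover have "fps_nth (S m) 0 = c m 0" using c[of m] by simp
  ultimately have cm: "c m 0 = 1" by simp
  \<comment> \<open>The coset of the identity contributes \<open>h ^ e\<close> itself, which is
    therefore a root of the polynomial at every point.\<close>
  have rel: "(\<Sum>i\<le>m. S i * (F ^ e) ^ i) = 0"
  proof (rule qexp_unique)
    show "qexp (\<lambda>z. \<Sum>i\<le>m. s i z * (h z ^ e) ^ i) (\<Sum>i\<le>m. S i * (F ^ e) ^ i)"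
      by (intro qexp_sum qexp_mult qexp_power qs qF) simp
    have "(\<Sum>i\<le>m. s i z * (h z ^ e) ^ i) = 0" if z: "z \<in> upper_half_plane" for z
    proof -
      have "mobius (mat 1) z = z" "automorphy_factor (mat 1) z = 1" by (simp_all add: mobius_def automorphy_factor_def)
      then have hz: "HX (coset N (mat 1)) z = h z ^ e"
        using HX[OF mat_1_SL2Z z] by (simp add: H_def slash_def)
      have "poly (Pz z) (h z ^ e) = (\<Prod>Y\<in>Q. h z ^ e - HX Y z)" by (simp add: Pz_def poly_prod)
      also have "\<dots> = 0"
        using finQ hz mat_1_SL2Z by (auto simp: Q_def prod_zero_iff intro!: bexI[of _ "mat 1"])
      finally show ?thesis unfolding poly_altdef monic(1) s_def .
    qed
    then show "qexp (\<lambda>z. \<Sum>i\<le>m. s i z * (h z ^ e) ^ i) 0"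
      using qexp_cong[OF qexp_const[of 0]] by simp
  qed
  define IJ where "IJ = Sigma {..m} (\<lambda>i. {..w * (m - i)})"
  have "finite ((\<lambda>(i, j). c i j) ` IJ)" "(\<lambda>(i, j). c i j) ` IJ \<noteq> {}" by (auto simp: IJ_def)
  \<comment> \<open>All coefficients become integral on division by \<open>a\<close>, and
    \<open>a\<close> itself becomes 1. As the polynomial is monic, 1 occurs among the coefficients,
    so \<open>a\<close> is not 0.\<close>
  from exists_max_divisor[OF this] obtain a where a: "a \<in> (\<lambda>(i, j). c i j) ` IJ"
    "\<forall>b\<in>(\<lambda>(i, j). c i j) ` IJ. \<exists>v\<in>V. b = v * a" by blast
  have "c m 0 \<in> (\<lambda>(i, j). c i j) ` IJ" by (intro image_eqI[of _ _ "(m, 0)"]) (auto simp: IJ_def)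
  then have a0: "a \<noteq> 0" using a(2) cm by force
  define c' where "c' i j = c i j / a" for i j
  have c'V: "c' i j \<in> V" if "i \<le> m" "j \<le> w * (m - i)" for i j
  proof -
    have "c i j \<in> (\<lambda>(i, j). c i j) ` IJ" using that by (intro image_eqI[of _ _ "(i, j)"]) (auto simp: IJ_def)
    then obtain v where "v \<in> V" "c i j = v * a" using a(2) by blast
    then show ?thesis using a0 by (simp add: c'_def)
  qed
  define good where "good i j \<longleftrightarrow> i \<le> m \<and> j \<le> w * (m - i) \<and> c' i j \<notin> M" for i j
  obtain ia ja where "good ia ja"
  proof -
    obtain ia ja where "ia \<le> m" "ja \<le> w * (m - ia)" "a = c ia ja" using a(1) by (auto simp: IJ_def)
    then have "good ia ja" using a0 one_notin_M by (simp add: good_def c'_def)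
    then show thesis by (rule that)
  qed
  \<comment> \<open>\<open>i0\<close> is the least exponent whose coefficient series does not reduce
    to zero, and \<open>j0\<close> will be the order of that series after reduction.\<close>
  define i0 where "i0 = (LEAST i. \<exists>j. good i j)"
  have "\<exists>j. good i0 j" unfolding i0_def by (rule LeastI[of "\<lambda>i. \<exists>j. good i j" ia]) (rule exI, fact)
  define j0 where "j0 = (LEAST j. good i0 j)"
  have good0: "good i0 j0" unfolding j0_def by (rule LeastI_ex[of "\<lambda>j. good i0 j"]) fact
  have i0_least: "\<not> good i j" if "i < i0" for i j
    using not_less_Least[of i "\<lambda>i. \<exists>j. good i j"] that unfolding i0_def[symmetric] by blast
  have j0_least: "\<not> good i0 j" if "j < j0" for j
    using not_less_Least[of j "\<lambda>j. good i0 j"] that unfolding j0_def[symmetric] by blast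
  define b where "b i j = delta_fps ^ j * eis_fps 4 ^ (3 * (w * (m - i) - j))" for i j
  define S' where "S' i = (\<Sum>j\<le>w * (m - i). fps_const (c' i j) * b i j)" for i
  have S'_eq: "S i = fps_const a * S' i" if "i \<le> m" for i
    unfolding c[OF that] S'_def b_def sum_distrib_left c'_def using a0 by (intro sum.cong) (simp_all add: mult.assoc[symmetric])
  have rel': "(\<Sum>i\<le>m. S' i * F ^ (e * i)) = 0"
  proof -
    have "fps_const a * (\<Sum>i\<le>m. S' i * F ^ (e * i)) = (\<Sum>i\<le>m. S i * (F ^ e) ^ i)"
      unfolding sum_distrib_left by (intro sum.cong) (simp_all add: S'_eq power_mult mult.assoc)
    then have "fps_const a * (\<Sum>i\<le>m. S' i * F ^ (e * i)) = 0" using rel by simp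
    then show ?thesis using a0 by simp
  qed
  have ints: "of_nat i \<in> V" for i by (rule of_nat_V)
  have E4V: "integral_fps (eis_fps 4)"
    unfolding integral_fps_def eis_fps_nth
  proof
    fix n
    have "(if n = 0 then 1 else 0) + 240 * of_nat (divisor_sum 3 n) = (of_nat ((if n = 0 then 1 else 0) + 240 * divisor_sum 3 n) :: complex)" by simp
    then show "(if n = 0 then 1 else 0) + 240 * of_nat (divisor_sum 3 n) \<in> V" by (simp only: ints)
  qed
  have E6V: "integral_fps (eis_fps 6)"
    unfolding integral_fps_def eis_fps_nth
  proof
    fix n
    have "(if n = 0 then 1 else 0) - 504 * of_nat (divisor_sum 5 n) = (of_int ((if n = 0 then 1 else 0) - 504 * int (divisor_sum 5 n)) :: complex)" by simp
    then show "(if n = 0 then 1 else 0) - 504 * of_nat (divisor_sum 5 n) \<in> V" by (simp only: of_int_V)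
  qed
  have DV: "integral_fps delta_fps" unfolding delta_fps_def
    by (intro integral_fps_diff integral_fps_power E4V E6V)
  have bV: "integral_fps (b i j)" for i j unfolding b_def by (intro integral_fps_mult integral_fps_power DV E4V)
  have Dpow: "(\<forall>i<j. fps_nth (delta_fps ^ j) i = 0) \<and> fps_nth (delta_fps ^ j) j = 1728 ^ j" for j
  proof (induction j)
    case (Suc j)
    have z: "\<And>i. i < 1 \<Longrightarrow> fps_nth delta_fps i = 0" by (simp add: delta_fps_nth)
    have IH: "\<And>i. i < j \<Longrightarrow> fps_nth (delta_fps ^ j) i = 0" using Suc by blast
    note * = fps_mult_nth_order[of 1 delta_fps j "delta_fps ^ j", OF z IH]
    show ?case using *(1) *(2) Suc by (simp add: delta_fps_nth)
  qed simp
  \<comment> \<open>The basis is triangular: the element with index \<open>j\<close> starts in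
    degree \<open>j\<close> with the unit \<open>1728 ^ j\<close>. Hence the least \<open>j\<close>
    with unit coefficient is the order of the combination modulo \<open>M\<close>.\<close>
  have b_low: "fps_nth (b i j) l = 0" if "l < j" for i j l
    using fps_mult_nth_order(1)[of j "delta_fps ^ j" 0 "eis_fps 4 ^ (3 * (w * (m - i) - j))" l] Dpow[of j] that by (simp add: b_def)
  have b_lead: "fps_nth (b i j) j = 1728 ^ j" for i j
    using fps_mult_nth_order(2)[of j "delta_fps ^ j" 0 "eis_fps 4 ^ (3 * (w * (m - i) - j))"] Dpow[of j]
    by (simp add: b_def fps_nth_power_0 eis_fps_nth)
  have S'V: "integral_fps (S' i)" if "i \<le> m" for i
    unfolding S'_def by (intro integral_fps_sum integral_fps_mult integral_fps_const bV c'V that) auto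
  have S'M: "fps_nth (S' i) l \<in> M" if "i < i0" for i l
  proof -
    have im: "i \<le> m" using that good0 by (simp add: good_def)
    have "c' i j \<in> M" if "j \<le> w * (m - i)" for j
      using i0_least[OF \<open>i < i0\<close>, of j] im that by (simp add: good_def)
    then show ?thesis unfolding S'_def fps_sum_nth
      using bV by (intro ideal_of_set_sum[OF M_ideal]) (auto simp: integral_fps_def intro: M_D(5))
  qed
  have i0m: "i0 \<le> m" "j0 \<le> w * (m - i0)" "c' i0 j0 \<notin> M" using good0 by (auto simp: good_def)
  have S'0_term: "c' i0 j * fps_nth (b i0 j) l \<in> M" if "j \<le> w * (m - i0)" "l \<le> j0" "j \<noteq> j0 \<or> l < j0" for j l
  proof (cases "j < j0")
    case True
    then have "c' i0 j \<in> M" using j0_least[OF True] that(1) i0m by (simp add: good_def)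
    then show ?thesis using bV[of i0 j] by (intro M_D(5)) (auto simp: integral_fps_def)
  next
    case False
    then have "l < j" using that by auto
    then show ?thesis using b_low M_0 by simp
  qed
  have S'0_low: "fps_nth (S' i0) l \<in> M" if "l < j0" for l
    unfolding S'_def fps_sum_nth using that by (intro ideal_of_set_sum[OF M_ideal]) (auto intro!: S'0_term)
  have S'0_lead: "fps_nth (S' i0) j0 \<notin> M"
  proof
    assume in_M: "fps_nth (S' i0) j0 \<in> M"
    have "fps_nth (S' i0) j0 = c' i0 j0 * 1728 ^ j0 + (\<Sum>j\<in>{..w * (m - i0)} - {j0}. c' i0 j * fps_nth (b i0 j) j0)"
      unfolding S'_def fps_sum_nth using i0m(2) by (subst sum.remove[of _ j0]) (auto simp: b_lead)
    moreover have "(\<Sum>j\<in>{..w * (m - i0)} - {j0}. c' i0 j * fps_nth (b i0 j) j0) \<in> M"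
      by (intro ideal_of_set_sum[OF M_ideal] S'0_term) auto
    ultimately have "c' i0 j0 * 1728 ^ j0 \<in> M" using M_diff[OF in_M] by (metis add_diff_cancel_right')
    moreover have v1728: "(1728::complex) \<in> V" using ints[of 1728] by simp
    ultimately have "c' i0 j0 \<in> M \<or> (1728::complex) ^ j0 \<in> M"
      using M_prime c'V[OF i0m(1,2)] VD(6) by blast
    then show False using i0m(3) M_pow[OF v1728] u by blast
  qed
  have FI: "integral_fps F" using FV by (simp add: integral_fps_def)
  have Fpow: "(\<forall>l<e * i * n1. fps_nth (F ^ (e * i)) l \<in> M) \<and> fps_nth (F ^ (e * i)) (e * i * n1) - fps_nth F n1 ^ (e * i) \<in> M" for i
    using fps_power_order[OF FI n1_least] by blast
  have FpowV: "fps_nth (F ^ j) l \<in> V" for j l using integral_fps_power[OF FI, of j] by (simp add: integral_fps_def)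
  \<comment> \<open>The order of the summand with index \<open>i0\<close>. Smaller indices vanish
    modulo \<open>M\<close> altogether; larger ones have order at least
    \<open>e * (i0 + 1) * n1\<close>, which exceeds \<open>T\<close> as soon as
    \<open>j0 < e * n1\<close>.\<close>
  define T where "T = j0 + e * i0 * n1"
  \<comment> \<open>The numerical bound enters here: \<open>k * m < 12 * n1\<close>, multiplied by
    \<open>totient N\<close>, reads \<open>w * m < e * n1\<close>, and \<open>j0\<close> is at most
    \<open>w * m\<close>.\<close>
  have j0e: "j0 < e * n1"
  proof -
    have "real k * real m < 12 * real n1" using n1_big by simp
    then have "real (k * m) < real (12 * n1)" by simp
    then have "k * m < 12 * n1" by (simp only: of_nat_less_iff)
    moreover have "totient N > 0" using N by simp
    ultimately have "totient N * (k * m) < totient N * (12 * n1)" by simp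
    then have "w * m < e * n1" by (simp add: w_def e_def mult_ac)
    moreover have "j0 \<le> w * m" using i0m(2) by (meson diff_le_self le_trans mult_le_mono2)
    ultimately show ?thesis by simp
  qed
  have terms: "fps_nth (S' i * F ^ (e * i)) T \<in> M" if "i \<le> m" "i \<noteq> i0" for i
  proof (cases "i < i0")
    case True
    show ?thesis unfolding fps_mult_nth
      using S'M[OF True] FpowV by (intro ideal_of_set_sum[OF M_ideal] M_D(5)) auto
  next
    case False
    then have "i0 + 1 \<le> i" using that by simp
    then have "e * (i0 + 1) * n1 \<le> e * i * n1" by (intro mult_le_mono order_refl)
    then have "T < 0 + e * i * n1" using j0e by (simp add: T_def algebra_simps)
    moreover have "\<And>l. fps_nth (S' i) l \<in> V" using S'V[OF that(1)] by (simp add: integral_fps_def)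
    ultimately show ?thesis
      using fps_mult_nth_ideal(1)[OF subring M_ideal, of "S' i" 0 "F ^ (e * i)" "e * i * n1" T] Fpow[of i] FpowV by blast
  qed
  have M_cancel: "b \<in> M" if "a \<in> M" "a - b \<in> M" for a b
    using M_diff[OF that] by simp
  define A where "A = fps_nth (S' i0 * F ^ (e * i0)) T"
  define B where "B = (\<Sum>i\<in>{..m} - {i0}. fps_nth (S' i * F ^ (e * i)) T)"
  have "fps_nth (\<Sum>i\<le>m. S' i * F ^ (e * i)) T = A + B"
    unfolding fps_sum_nth A_def B_def using i0m(1) by (subst sum.remove[of _ i0]) auto
  then have "A = - B" unfolding rel' by (simp add: eq_neg_iff_add_eq_0)
  moreover have "B \<in> M" unfolding B_def
    by (intro ideal_of_set_sum[OF M_ideal] terms) auto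
  ultimately have main: "A \<in> M" using M_uminus[of B] by simp
  have S0V: "fps_nth (S' i0) l \<in> V" for l using S'V[OF i0m(1)] by (simp add: integral_fps_def)
  have Fp: "fps_nth (F ^ (e * i0)) l \<in> M" if "l < e * i0 * n1" for l using Fpow[of i0] that by blast
  have "A - fps_nth (S' i0) j0 * fps_nth (F ^ (e * i0)) (e * i0 * n1) \<in> M"
    unfolding A_def T_def by (rule fps_mult_nth_ideal(2)[OF subring M_ideal S0V S'0_low FpowV Fp])
  then have "fps_nth (S' i0) j0 * fps_nth (F ^ (e * i0)) (e * i0 * n1) \<in> M"
    by (rule M_cancel[OF main])
  then have "fps_nth (F ^ (e * i0)) (e * i0 * n1) \<in> M"
    using M_prime[OF S0V FpowV] S'0_lead by blast
  then have "fps_nth F n1 ^ (e * i0) \<in> M"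
    by (rule M_cancel) (use Fpow[of i0] in blast)
  then show False using M_pow[OF FV] n1 by blast
qed

section \<open>Hecke operators\<close>

lemma nome_power: "nome z ^ n = nome (of_nat n * z)"
  by (simp add: nome_def exp_of_nat_mult[symmetric] mult_ac)

lemma nome_add: "nome (x + y) = nome x * nome y"
  by (simp add: nome_def distrib_left exp_add)

lemma qexpI:
  assumes "\<And>z. z \<in> upper_half_plane \<Longrightarrow> (\<lambda>n. a n * nome z ^ n) sums f z"
  shows "qexp f (Abs_fps a)"
proof -
  have e: "exp (2 * of_real pi * \<i> * of_nat n * z / of_nat 1) = nome z ^ n" for n z
    unfolding nome_power unfolding nome_def by (simp add: mult_ac)
  show ?thesis unfolding has_q_expansion_1_iff[symmetric] has_q_expansion_def e using assms by blast
qed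

lemma modular_form_slash_bounded:
  assumes f: "modular_form N k chi f" and N: "N \<ge> 1" and A: "A \<in> carrier SL2Z"
  shows "\<exists>B. \<forall>z. Im z \<ge> 1 \<longrightarrow> cmod (slash k f A z) \<le> B"
proof -
  obtain a where "has_q_expansion N (slash k f A) a" using f A by (auto simp: modular_form_def)
  then obtain B where "\<And>z. Im z \<ge> 1 \<Longrightarrow> cmod (slash k f A z) \<le> B"
    using has_q_expansion_bounded N by (metis less_eq_Suc_le One_nat_def)
  then show ?thesis by blast
qed

lemma modular_form_qexp:
  assumes f: "modular_form N k chi f" and N: "N \<ge> 1" and chi: "chi 1 = 1"
  obtains F where "qexp f F"
proof -
  have hol: "f holomorphic_on upper_half_plane" using f by (simp add: modular_form_def)
  have per: "f (z + 1) = f z" if z: "z \<in> upper_half_plane" for z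
  proof -
    have "mat2 1 1 0 1 \<in> Gamma0 N" using translation_SL2Z[of 1] by (simp add: Gamma0_def)
    then have "f (mobius (mat2 1 1 0 1) z) = chi (mat2 1 1 0 1 $ 2 $ 2) * automorphy_factor (mat2 1 1 0 1) z ^ k * f z"
      using f z unfolding modular_form_def by blast
    then show ?thesis by (simp add: mobius_translation automorphy_factor_translation chi)
  qed
  obtain B where B: "\<And>z. Im z \<ge> 1 \<Longrightarrow> cmod (slash k f (mat 1) z) \<le> B"
    using modular_form_slash_bounded[OF f N mat_1_SL2Z] by blast
  have "slash k f (mat 1) z = f z" for z by (simp add: slash_def mobius_def automorphy_factor_def)
  then have "\<And>z. Im z \<ge> 1 \<Longrightarrow> cmod (f z) \<le> B" using B by simp
  from periodic_bounded_qexp[OF hol per this] that show thesis by blast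
qed

lemma root_of_unity_sum:
  assumes l: "l > 0"
  shows "(\<Sum>b<l. nome (of_nat n / of_nat l) ^ b) = (if l dvd n then of_nat l else 0)"
proof -
  define w where "w = nome (of_nat n / of_nat l)"
  have w1: "w = 1 \<longleftrightarrow> l dvd n"
    using complex_root_unity_eq_1[of l n] l by (simp add: w_def nome_def)
  have "w ^ l = nome (0 + of_int (int n))" using l by (simp add: w_def nome_power)
  then have wl: "w ^ l = 1" unfolding nome_add_int by (simp add: nome_def)
  show ?thesis
  proof (cases "l dvd n")
    case True
    then show ?thesis using w1 by (simp add: w_def)
  next
    case False
    then have "w \<noteq> 1" using w1 by simp
    then have "(\<Sum>b<l. w ^ b) = (w ^ l - 1) / (w - 1)" by (rule geometric_sum)
    then show ?thesis using False wl by (simp add: w_def)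
  qed
qed

text \<open>The classical effect of the Hecke operator at a prime \<open>l\<close> on coefficients,
  with \<open>c\<close> in the place of the character value at \<open>l\<close>.\<close>

definition hecke_fps :: "nat \<Rightarrow> complex \<Rightarrow> nat \<Rightarrow> complex fps \<Rightarrow> complex fps" where
  "hecke_fps k c l F = Abs_fps (\<lambda>n. fps_nth F (l * n) + c * of_nat l ^ (k - 1) * (if l dvd n then fps_nth F (n div l) else 0))"

lemma hecke_op_prime:
  assumes l: "Factorial_Ring.prime l" and k: "k > 0" and chi: "chi 1 = 1"
  shows "hecke_op k chi l f z = chi (int l) * of_nat l ^ (k - 1) * f (of_nat l * z)
    + (\<Sum>b<l. f ((z + of_nat b) / of_nat l)) / of_nat l"
proof -
  have l0: "l > 0" and l1: "l \<noteq> 1" using l prime_gt_0_nat by auto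
  have div: "{d. d dvd l} = {1, l}" using l by (auto simp: prime_nat_iff)
  have powi: "(of_nat l :: complex) powi (int k - 1) = of_nat l ^ (k - 1)"
    using k by (simp add: power_int_def nat_diff_distrib')
  have "hecke_op k chi l f z = of_nat l ^ (k - 1) * (chi (int l) * f (of_nat l * z)
      + (\<Sum>b<l. 1 / of_nat l ^ k * f ((z + of_nat b) / of_nat l)))"
    unfolding hecke_op_def powi div using l1 l0 chi by (simp add: lessThan_Suc)
  also have "\<dots> = chi (int l) * of_nat l ^ (k - 1) * f (of_nat l * z)
      + (of_nat l ^ (k - 1) / of_nat l ^ k) * (\<Sum>b<l. f ((z + of_nat b) / of_nat l))"
    by (simp add: sum_distrib_left[symmetric] sum_divide_distrib[symmetric] distrib_left mult_ac)
  also have "(of_nat l ^ (k - 1) / of_nat l ^ k :: complex) = 1 / of_nat l"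
    using k l0 by (cases k) auto
  finally show ?thesis by simp
qed

text \<open>Averaging over the translates by \<open>b\<close> retains exactly the indices divisible
  by \<open>l\<close>, by orthogonality of roots of unity; the term at \<open>l * z\<close> spreads
  the coefficients out. Both series are reindexed along multiples of \<open>l\<close>.\<close>

lemma qexp_hecke_op:
  assumes q: "qexp f F" and l: "Factorial_Ring.prime l" and k: "k > 0" and chi: "chi 1 = 1"
  shows "qexp (hecke_op k chi l f) (hecke_fps k (chi (int l)) l F)"
  unfolding hecke_fps_def
proof (rule qexpI)
  fix z assume z: "z \<in> upper_half_plane"
  have l0: "l > 0" using l prime_gt_0_nat by auto
  define a where "a = fps_nth F"
  have sm: "strict_mono (\<lambda>n. l * n)" using l0 by (simp add: strict_mono_def)
  have rng: "n \<notin> range (\<lambda>n. l * n) \<Longrightarrow> \<not> l dvd n" for n by (auto simp: dvd_def)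
  have "(\<lambda>n. a n * nome (of_nat l * z) ^ n) sums f (of_nat l * z)"
    unfolding a_def by (rule sums_qexp[OF q]) (use z l0 in \<open>simp add: upper_half_plane_iff\<close>)
  then have "(\<lambda>n. (\<lambda>m. (if l dvd m then a (m div l) else 0) * nome z ^ m) (l * n)) sums f (of_nat l * z)"
    using l0 by (simp add: nome_power[of z l, symmetric] power_mult[symmetric])
  then have 1: "(\<lambda>m. (if l dvd m then a (m div l) else 0) * nome z ^ m) sums f (of_nat l * z)"
    by (subst (asm) sums_mono_reindex[OF sm]) (use rng in auto)
  have "(\<lambda>n. a n * nome ((z + of_nat b) / of_nat l) ^ n) sums f ((z + of_nat b) / of_nat l)" for b
    unfolding a_def by (rule sums_qexp[OF q]) (use z l0 in \<open>simp add: upper_half_plane_iff\<close>)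
  then have "(\<lambda>n. (\<Sum>b<l. a n * nome ((z + of_nat b) / of_nat l) ^ n) / of_nat l) sums ((\<Sum>b<l. f ((z + of_nat b) / of_nat l)) / of_nat l)"
    by (intro sums_divide sums_sum)
  moreover have "(\<Sum>b<l. a n * nome ((z + of_nat b) / of_nat l) ^ n) / of_nat l = (if l dvd n then a n * nome z ^ (n div l) else 0)" for n
  proof -
    have e: "nome ((z + of_nat b) / of_nat l) ^ n = nome (of_nat n * z / of_nat l) * nome (of_nat n / of_nat l) ^ b" for b
    proof -
      have "of_nat n * ((z + of_nat b) / of_nat l) = of_nat n * z / of_nat l + of_nat b * (of_nat n / of_nat l)"
        by (simp add: add_divide_distrib distrib_left mult.commute)
      then show ?thesis by (simp only: nome_power nome_add)
    qed
    have "(\<Sum>b<l. a n * nome ((z + of_nat b) / of_nat l) ^ n) = a n * nome (of_nat n * z / of_nat l) * (\<Sum>b<l. nome (of_nat n / of_nat l) ^ b)"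
      unfolding e sum_distrib_left by (simp only: mult.assoc)
    also have "\<dots> = (if l dvd n then a n * nome z ^ (n div l) * of_nat l else 0)"
      unfolding root_of_unity_sum[OF l0] using l0 by (auto simp: nome_power elim!: dvdE)
    finally show ?thesis using l0 by simp
  qed
  ultimately have "(\<lambda>n. if l dvd n then a n * nome z ^ (n div l) else 0) sums ((\<Sum>b<l. f ((z + of_nat b) / of_nat l)) / of_nat l)"
    by simp
  then have "(\<lambda>n. (\<lambda>n. if l dvd n then a n * nome z ^ (n div l) else 0) (l * n)) sums ((\<Sum>b<l. f ((z + of_nat b) / of_nat l)) / of_nat l)"
    by (subst sums_mono_reindex[OF sm]) (use rng in auto)
  then have 2: "(\<lambda>n. a (l * n) * nome z ^ n) sums ((\<Sum>b<l. f ((z + of_nat b) / of_nat l)) / of_nat l)"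
    using l0 by simp
  have "(\<lambda>n. chi (int l) * of_nat l ^ (k - 1) * ((if l dvd n then a (n div l) else 0) * nome z ^ n) + a (l * n) * nome z ^ n)
      sums hecke_op k chi l f z"
    unfolding hecke_op_prime[where k = k and chi = chi, OF l k chi] by (intro sums_add sums_mult 1 2)
  then show "(\<lambda>n. (fps_nth F (l * n) + chi (int l) * of_nat l ^ (k - 1) * (if l dvd n then fps_nth F (n div l) else 0)) * nome z ^ n)
      sums hecke_op k chi l f z"
    unfolding a_def by (simp add: distrib_right mult.assoc add.commute)
qed

text \<open>The coefficient at 1 identifies the eigenvalue as the coefficient of the form at
  \<open>l\<close>; the coefficient at \<open>l\<close> then gives the relation.\<close>

lemma eigenform_coeff_square:
  assumes f: "normalised_eigenform N k chi f" and q: "qexp f F"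
    and l: "Factorial_Ring.prime l" and k: "k > 0" and chi: "chi 1 = 1"
  shows "fps_nth F (l ^ 2) = fps_nth F l ^ 2 - chi (int l) * of_nat l ^ (k - 1)"
proof -
  have l0: "l > 0" "l \<noteq> 1" using l prime_gt_0_nat by auto
  have F1: "fps_nth F 1 = 1" using f qexp_fourier_coeff[OF q] by (simp add: normalised_eigenform_def)
  have "hecke_op k chi l \<in> hecke_algebra k chi" by (rule hecke_algebra.hecke_op[OF l0(1)])
  then obtain c where c: "\<And>z. z \<in> upper_half_plane \<Longrightarrow> hecke_op k chi l f z = c * f z"
    using f unfolding normalised_eigenform_def eigenform_def by blast
  have "hecke_fps k (chi (int l)) l F = fps_const c * F"
    by (rule qexp_unique[OF qexp_cong[OF qexp_hecke_op[where chi = chi, OF q l k chi] c] qexp_cmult[OF q]])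
  then have t: "fps_nth (hecke_fps k (chi (int l)) l F) n = c * fps_nth F n" for n by simp
  have "\<not> l dvd 1" using l0 by simp
  then have "fps_nth F l = c * fps_nth F 1" using t[of 1] by (simp add: hecke_fps_def)
  then have c_eq: "c = fps_nth F l" using F1 by simp
  have "fps_nth F (l * l) + chi (int l) * of_nat l ^ (k - 1) * fps_nth F 1 = c * fps_nth F l"
    using t[of l] l0 by (simp add: hecke_fps_def)
  then show ?thesis using c_eq F1 by (simp add: power2_eq_square eq_diff_eq)
qed

section \<open>Reduction modulo the prime ideal\<close>

text \<open>Passage from the record-based algebra to predicates on sets. Closure of \<open>R\<close>
  under the ring operations is part of the locale \<open>primeideal\<close>.\<close>

lemma prime_ideal_of_facts:
  assumes "prime_ideal_of P R"
  shows "subring_set R" "ideal_of_set P R" "1 \<notin> P"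
    and "\<And>x y. x \<in> R \<Longrightarrow> y \<in> R \<Longrightarrow> x * y \<in> P \<Longrightarrow> x \<in> P \<or> y \<in> P"
proof -
  define Q :: "complex ring" where "Q = ring_of_type_algebra\<lparr>carrier := R\<rparr>"
  have Q: "carrier Q = R" "mult Q = (*)" "add Q = (+)" "zero Q = 0" "one Q = 1"
    by (simp_all add: Q_def ring_of_type_algebra_def fun_eq_iff)
  interpret primeideal P Q using assms by (simp add: prime_ideal_of_def Q_def)
  have "- x \<in> R" if "x \<in> R" for x
  proof -
    have "add Q (a_inv Q x) x = zero Q" "a_inv Q x \<in> carrier Q"
      using that l_neg a_inv_closed unfolding Q(1) by blast+
    then show ?thesis unfolding Q by (simp add: eq_neg_iff_add_eq_0[symmetric])
  qed
  then show R: "subring_set R"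
    using one_closed add.m_closed m_closed
    unfolding Q subring_set_def by blast
  show "ideal_of_set P R"
    using a_subset additive_subgroup.zero_closed[OF is_additive_subgroup] additive_subgroup.a_closed[OF is_additive_subgroup] I_l_closed
    unfolding Q ideal_of_set_def by blast
  show "1 \<notin> P" using one_imp_carrier I_notcarr unfolding Q by blast
  show "\<And>x y. x \<in> R \<Longrightarrow> y \<in> R \<Longrightarrow> x * y \<in> P \<Longrightarrow> x \<in> P \<or> y \<in> P"
    using I_prime unfolding Q by blast
qed

lemma subring_set_of_int: assumes "subring_set S" shows "of_int n \<in> S"
proof -
  have n: "of_nat n \<in> S" for n by (induction n) (use subring_setD[OF assms] in auto)
  show ?thesis by (cases n rule: int_cases2) (use n subring_setD(5)[OF assms] in auto)
qed

text \<open>The von Staudt--Clausen congruence at \<open>p\<close> in the index \<open>p - 1\<close>: read modulo \<open>p\<close>, the recursion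
  of the Bernoulli numbers gives \<open>p B\<^bsub>p-1\<^esub> = -1\<close>, because \<open>p\<close> divides the intermediate binomial coefficients.\<close>

lemma eis_cong_1:
  assumes V: "valuation_ring V" and p: "Factorial_Ring.prime p" "p \<ge> 5"
    and pM: "\<And>n. of_int n \<in> valuation_ring.M V \<longleftrightarrow> int p dvd n"
  shows "fps_nth (eis_fps (p - 1) - 1) n \<in> valuation_ring.M V"
proof -
  interpret valuation_ring V by fact
  have pN: "(of_nat m :: complex) \<in> M \<longleftrightarrow> p dvd m" for m using pM[of "int m"] by simp
  \<comment> \<open>Below the index \<open>p - 1\<close> the recursion divides only by integers
    smaller than \<open>p\<close>, which are units of \<open>V\<close>.\<close>
  have bV: "bern j \<in> V" if "j < p - 1" for j
    using that
  proof (induction j rule: less_induct)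
    case (less j)
    show ?case
    proof (cases j)
      case 0 then show ?thesis using VD(1) by simp
    next
      case (Suc m)
      have "\<not> p dvd Suc (Suc m)" using less.prems Suc by (auto dest: dvd_imp_le)
      then have "inverse (of_nat (Suc (Suc m))) \<in> V" using unit_inverse[OF of_nat_V] pN by blast
      moreover have "(\<Sum>i\<le>m. of_nat (Suc (Suc m) choose i) * bern i) \<in> V"
        using less Suc by (intro subring_set_sum[OF subring] VD(4) of_nat_V) auto
      ultimately have "- (\<Sum>i\<le>m. of_nat (Suc (Suc m) choose i) * bern i) * inverse (of_nat (Suc (Suc m))) \<in> V"
        by (intro VD(4) VD(5))
      then show ?thesis unfolding Suc bern.simps divide_inverse .
    qed
  qed
  define m where "m = p - 2"
  have m: "p = Suc (Suc m)" "p - 1 = Suc m" using p by (auto simp: m_def)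
  have summand: "of_nat (p choose i) * bern i \<in> M" if "i \<in> {1..m}" for i
  proof -
    have "p dvd (p choose i)" using that m p by (intro dvd_choose_prime) auto
    then show ?thesis using bV[of i] that m by (intro M_D(5)) (auto simp: pN)
  qed
  have "of_nat p * bern (p - 1) = - (\<Sum>i\<le>m. of_nat (p choose i) * bern i)"
    unfolding m(2) bern.simps m(1)[symmetric] using p by simp
  also have "(\<Sum>i\<le>m. of_nat (p choose i) * bern i) = 1 + (\<Sum>i\<in>{1..m}. of_nat (p choose i) * bern i)"
    by (simp add: atMost_atLeast0 sum.atLeast_Suc_atMost)
  finally have u: "of_nat p * bern (p - 1) = - 1 - (\<Sum>i\<in>{1..m}. of_nat (p choose i) * bern i)" by simp
  define S where "S = (\<Sum>i\<in>{1..m}. of_nat (p choose i) * bern i)"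
  have S: "S \<in> M" unfolding S_def by (rule ideal_of_set_sum[OF M_ideal summand])
  \<comment> \<open>\<open>p\<close> times the Bernoulli number is congruent to -1, hence a unit.
    The Bernoulli number thus has \<open>p\<close> exactly in its denominator, and its reciprocal
    carries the factor \<open>p\<close>.\<close>
  define u where "u = of_nat p * bern (p - 1)"
  have uS: "u = - 1 - S" using u by (simp add: u_def S_def)
  have uV: "u \<in> V" unfolding uS using M_V[OF S] VD(1) by (intro V_diff VD(5))
  have uM: "u \<notin> M"
  proof
    assume "u \<in> M"
    then have "u + S \<in> M" using S by (rule M_add)
    then have "- 1 \<in> M" by (simp add: uS)
    then show False using M_uminus[of "- 1"] one_notin_M by simp
  qed
  have "of_nat p * (2 * of_nat (p - 1) * inverse u) \<in> M"
  proof (rule M_D(5))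
    show "of_nat p \<in> M" by (simp add: pN)
    have "2 * of_nat (p - 1) = (of_nat (2 * (p - 1)) :: complex)" by (simp only: of_nat_mult of_nat_numeral)
    then have "2 * of_nat (p - 1) \<in> V" by (simp only: of_nat_V)
    then show "2 * of_nat (p - 1) * inverse u \<in> V" by (rule VD(4)[OF _ unit_inverse[OF uV uM]])
  qed
  also have "of_nat p * (2 * of_nat (p - 1) * inverse u) = 2 * of_nat (p - 1) / bern (p - 1)"
  proof -
    have "x \<noteq> 0 \<Longrightarrow> x * (y * inverse (x * b)) = y / b" for x y b :: complex
      by (cases "b = 0") (simp_all add: field_simps)
    moreover have "(of_nat p :: complex) \<noteq> 0" using p by simp
    ultimately show ?thesis unfolding u_def by blast
  qed
  finally have c: "2 * of_nat (p - 1) / bern (p - 1) \<in> M" .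
  have "fps_nth (eis_fps (p - 1) - 1) n = - (2 * of_nat (p - 1) / bern (p - 1) * of_nat (divisor_sum (p - 1 - 1) n))"
    by (simp add: eis_fps_def)
  moreover have "2 * of_nat (p - 1) / bern (p - 1) * of_nat (divisor_sum (p - 1 - 1) n) \<in> M"
    by (rule M_D(5)[OF of_nat_V c])
  ultimately show ?thesis using M_uminus by simp
qed

context valuation_ring
begin

lemma fps_cong_1_power_mult:
  assumes E: "\<And>n. fps_nth (E - 1) n \<in> M" and F: "integral_fps F"
  shows "fps_nth (E ^ r * F - F) n \<in> M"
proof (induction r arbitrary: n)
  case 0 show ?case using M_0 by simp
next
  case (Suc r)
  have "fps_nth E i \<in> V" for i
    using VD(3)[OF M_V[OF E[of i]], of "fps_nth 1 i"] integral_fps_1 by (simp add: integral_fps_def)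
  then have "integral_fps (E ^ r * F)" by (intro integral_fps_mult integral_fps_power F) (simp add: integral_fps_def)
  then have V: "fps_nth (E ^ r * F) i \<in> V" for i by (simp only: integral_fps_def)
  have "fps_nth ((E - 1) * (E ^ r * F)) n \<in> M"
    unfolding fps_mult_nth[of "E - 1"] by (intro ideal_of_set_sum[OF M_ideal] M_D(5)[OF V E])
  from M_add[OF this Suc] have "fps_nth ((E - 1) * (E ^ r * F) + (E ^ r * F - F)) n \<in> M" by (simp only: fps_add_nth)
  moreover have "(E - 1) * (E ^ r * F) + (E ^ r * F - F) = E ^ Suc r * F - F" by (simp add: algebra_simps)
  ultimately show ?case by (simp only:)
qed

end

lemma prime_ge_5_dvd_1728:
  assumes "Factorial_Ring.prime p" "p \<ge> (5::nat)" shows "\<not> p dvd 1728"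
proof
  assume "p dvd 1728"
  then have "p dvd 2 ^ 6 * 3 ^ 3" by simp
  then have "p dvd 2 \<or> p dvd 3" using assms(1) by (meson prime_dvd_mult_iff prime_dvd_power)
  then show False using assms(2) by (auto dest: dvd_imp_le)
qed

lemma primroot_power_diff_dvd:
  assumes p: "Factorial_Ring.prime p" and l: "residue_primroot p l"
    and d: "int p dvd int l ^ a - int l ^ b" and ab: "a \<le> b"
  shows "p - 1 dvd b - a"
proof -
  have "coprime p l" "ord p l = p - 1" using l p by (auto simp: residue_primroot_def totient_prime)
  moreover have "[int (l ^ a) = int (l ^ b)] (mod int p)" using d by (simp add: cong_iff_dvd_diff)
  then have "[l ^ a = l ^ b] (mod p)" by (simp only: cong_int_iff)
  ultimately have "[a = b] (mod (p - 1))" using order_divides_expdiff[of p l a b] by simp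
  then have "[b = a] (mod (p - 1))" by (rule cong_sym)
  then show ?thesis using ab by (simp add: cong_altdef_nat)
qed

theorem theorem1p4:
  fixes N k1 k2 p :: nat
    and chi :: "int \<Rightarrow> complex"
    and f g :: "complex \<Rightarrow> complex"
    and K R P :: "complex set"
  assumes "N \<ge> 1"
    and "dirichlet_character N chi"
    and "0 < k1" and "k1 \<le> k2"
    and "normalised_eigenform N k1 chi f"
    and "normalised_eigenform N k2 chi g"
    and "number_field K" and "R = ring_of_integers K"
    and "\<forall>n. fourier_coeff f n \<in> R" and "\<forall>n. fourier_coeff g n \<in> R"
    and "prime_ideal_of P R" and "P \<noteq> {0}"
    and "Factorial_Ring.prime p" and "{of_int (int p * m) | m. True} = P \<inter> \<int>"
    and "p \<ge> 5"
    and "\<not> form_cong P f g"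
  shows "\<exists>n::nat. real n \<le> max (real ((least_prime_primroot p N)\<^sup>2))
                             (real k2 / 12 * real (group_index SL2Z (Gamma0 N))) \<and>
                  \<not> cong_ideal P (fourier_coeff f n) (fourier_coeff g n)"
proof (rule ccontr)
  assume "\<not> ?thesis"
  then have small_P: "cong_ideal P (fourier_coeff f n) (fourier_coeff g n)"
    if "real n \<le> max (real ((least_prime_primroot p N)\<^sup>2)) (real k2 / 12 * real (group_index SL2Z (Gamma0 N)))" for n
    using that by blast
  note R = prime_ideal_of_facts[OF assms(11)]
  obtain V where V: "valuation_ring V" "R \<subseteq> V" "R \<inter> valuation_ring.M V = P"
    by (rule exists_valuation_ring[OF R])
  interpret valuation_ring V by (rule V(1))
  have p: "Factorial_Ring.prime p" "p \<ge> 5" by fact+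
  \<comment> \<open>Rational integers in the maximal ideal are those of \<open>P\<close>, since
    \<open>V\<close> lies over the pair of \<open>R\<close> and \<open>P\<close>, and these are the
    multiples of \<open>p\<close>.\<close>
  have pM: "of_int n \<in> M \<longleftrightarrow> int p dvd n" for n
  proof -
    have "of_int n \<in> M \<longleftrightarrow> of_int n \<in> P \<inter> (\<int> :: complex set)"
      using V(3) subring_set_of_int[OF R(1), of n] by auto
    also have "\<dots> \<longleftrightarrow> (\<exists>m. (of_int n :: complex) = of_int (int p * m))"
      unfolding assms(14)[symmetric] by blast
    also have "\<dots> \<longleftrightarrow> int p dvd n" unfolding of_int_eq_iff by (auto simp: dvd_def)
    finally show ?thesis .
  qed
  note chi = dirichlet_character_facts[OF assms(2,1)]
  have mf: "modular_form N k1 chi f" "modular_form N k2 chi g"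
    using assms(5,6) by (simp_all add: normalised_eigenform_def eigenform_def)
  obtain F where F: "qexp f F" by (rule modular_form_qexp[OF mf(1) assms(1) chi(1)])
  obtain G where G: "qexp g G" by (rule modular_form_qexp[OF mf(2) assms(1) chi(1)])
  note FG = qexp_fourier_coeff[OF F] qexp_fourier_coeff[OF G]
  have coeffs: "fps_nth F n \<in> R" "fps_nth G n \<in> R" for n using assms(9,10) by (simp_all add: FG)
  have FV: "integral_fps F" "integral_fps G" using coeffs V(2) by (auto simp: integral_fps_def)
  have small: "fps_nth F n - fps_nth G n \<in> M"
    if "real n \<le> max (real ((least_prime_primroot p N)\<^sup>2)) (real k2 / 12 * real (group_index SL2Z (Gamma0 N)))" for n
    using small_P[OF that] V(3) by (auto simp: cong_ideal_def FG)
  define l where "l = least_prime_primroot p N"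
  have "\<exists>l. Factorial_Ring.prime l \<and> residue_primroot p l \<and> \<not> l dvd N"
    by (rule exists_prime_primroot) (use p assms(1) in auto)
  then have l: "Factorial_Ring.prime l" "residue_primroot p l" "\<not> l dvd N"
    using LeastI_ex[of "\<lambda>l. Factorial_Ring.prime l \<and> residue_primroot p l \<and> \<not> l dvd N"]
    unfolding l_def least_prime_primroot_def by blast+
  have "p - 1 dvd (k2 - 1) - (k1 - 1)"
  proof (rule primroot_power_diff_dvd[OF p(1) l(2)])
    have k2: "k2 > 0" using assms(3,4) by simp
    define c where "c = chi (int l)"
    define d where "d = (of_int (int l ^ (k1 - 1) - int l ^ (k2 - 1)) :: complex)"
    have "coprime l N" using l(1,3) by (rule prime_imp_coprime)
    then have c: "c ^ totient N = 1" unfolding c_def by (intro chi(2)) simp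
    have tot: "totient N > 0" using assms(1) by simp
    have cV: "c \<in> V" by (rule root_of_unity_V[OF c tot])
    have cM: "c \<notin> M"
    proof
      assume "c \<in> M"
      then have "c ^ (totient N - 1) * c \<in> M" by (intro M_D(4) VD(6) cV)
      moreover have "c ^ (totient N - 1) * c = c ^ totient N" by (rule power_minus_mult[OF tot])
      ultimately show False using c one_notin_M by simp
    qed
    \<comment> \<open>Both \<open>l\<close> and \<open>l ^ 2\<close> must lie in the range where the
      coefficients are known to agree; the square in the bound provides for this.\<close>
    have l1: "real l \<le> real (l ^ 2)" by (simp only: of_nat_le_iff) (simp add: power2_eq_square)
    have s: "fps_nth F l - fps_nth G l \<in> M" "fps_nth F (l ^ 2) - fps_nth G (l ^ 2) \<in> M"
      using l1 by (auto intro!: small simp: l_def[symmetric] le_max_iff_disj simp del: of_nat_power)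
    have t: "fps_nth F l + fps_nth G l \<in> V" using FV by (auto simp: integral_fps_def intro: VD(3))
    \<comment> \<open>A difference of two squares minus the difference of the coefficients at
      \<open>l ^ 2\<close>. By the Hecke relations only the character value times the difference of
      the two powers of \<open>l\<close> remains, and the character value is a unit.\<close>
    have "(fps_nth F l + fps_nth G l) * (fps_nth F l - fps_nth G l) - (fps_nth F (l ^ 2) - fps_nth G (l ^ 2)) \<in> M"
      by (rule M_diff[OF M_D(4)[OF t s(1)] s(2)])
    also have "(fps_nth F l + fps_nth G l) * (fps_nth F l - fps_nth G l) - (fps_nth F (l ^ 2) - fps_nth G (l ^ 2)) = c * d"
      unfolding eigenform_coeff_square[where chi = chi, OF assms(5) F l(1) assms(3) chi(1)]
        eigenform_coeff_square[where chi = chi, OF assms(6) G l(1) k2 chi(1)]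
      by (simp add: c_def d_def algebra_simps power2_eq_square)
    finally have "d \<in> M" using M_prime[OF cV, of d] cM of_int_V unfolding d_def by blast
    then show "int p dvd int l ^ (k1 - 1) - int l ^ (k2 - 1)" by (simp only: d_def pM)
    show "k1 - 1 \<le> k2 - 1" using assms(4) by simp
  qed
  then have "p - 1 dvd k2 - k1" using assms(3) by simp
  then obtain r where "k2 - k1 = (p - 1) * r" by (elim dvdE)
  then have k2: "k2 = (p - 1) * r + k1" using assms(4) by simp
  define w where "w = p - 1"
  have "odd p" using p prime_odd_nat[of p] by simp
  then have w: "w \<ge> 4" "even w" using p by (auto simp: w_def)
  note E = level_one_eis(1)[OF w, unfolded level_one_def]
  \<comment> \<open>The Eisenstein factor raises the weight of \<open>f\<close> to that of
    \<open>g\<close> without altering its reduction, so \<open>h\<close> reduces to the difference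
    of the two forms.\<close>
  define h where "h = (\<lambda>z. eis w z ^ r * f z - g z)"
  define H where "H = eis_fps w ^ r * F - G"
  have H: "qexp h H" unfolding h_def H_def by (intro qexp_diff qexp_mult qexp_power F G) (use E in blast)
  have H_nth: "fps_nth H n = fps_nth (eis_fps w ^ r * F - F) n + (fps_nth F n - fps_nth G n)" for n
    by (simp add: H_def)
  have EM: "fps_nth (eis_fps w ^ r * F - F) n \<in> M" for n
    unfolding w_def by (rule fps_cong_1_power_mult[OF eis_cong_1[OF V(1) p pM] FV(1)])
  have HM: "fps_nth H n \<in> M" for n
  proof (rule sturm_bound[OF V(1) _ assms(1,2) _ _ _ H, where k = k2])
    show "1728 \<notin> M" using pM[of 1728] prime_ge_5_dvd_1728[OF p] by (simp flip: int_dvd_int_iff)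
    show "h holomorphic_on upper_half_plane" by (rule qexp_holomorphic[OF H])
    show "h (mobius A z) = chi (A $ 2 $ 2) * automorphy_factor A z ^ k2 * h z"
      if A: "A \<in> Gamma0 N" and z: "z \<in> upper_half_plane" for A z
    proof -
      have "eis w (mobius A z) = automorphy_factor A z ^ w * eis w z"
        using E Gamma0_SL2Z[OF A] z by blast
      moreover have "f (mobius A z) = chi (A $ 2 $ 2) * automorphy_factor A z ^ k1 * f z"
        "g (mobius A z) = chi (A $ 2 $ 2) * automorphy_factor A z ^ k2 * g z"
        using mf A z unfolding modular_form_def by blast+
      ultimately show ?thesis unfolding h_def k2 w_def[symmetric]
        by (simp add: power_mult_distrib power_add power_mult[symmetric] algebra_simps)
    qed
    show "\<exists>B. \<forall>z. Im z \<ge> 1 \<longrightarrow> cmod (slash k2 h A z) \<le> B" if A: "A \<in> carrier SL2Z" for A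
    proof -
      obtain B1 where B1: "Im z \<ge> 1 \<Longrightarrow> cmod (slash k1 f A z) \<le> B1" for z
        using modular_form_slash_bounded[OF mf(1) assms(1) A] by blast
      obtain B2 where B2: "Im z \<ge> 1 \<Longrightarrow> cmod (slash k2 g A z) \<le> B2" for z
        using modular_form_slash_bounded[OF mf(2) assms(1) A] by blast
      have "has_q_expansion 1 (eis w) (fps_nth (eis_fps w))"
        unfolding has_q_expansion_1_iff fps_nth_inverse using E by blast
      then obtain B0 where B0: "Im z \<ge> 1 \<Longrightarrow> cmod (eis w z) \<le> B0" for z
        using has_q_expansion_bounded[of 1 "eis w"] by (metis zero_less_one)
      \<comment> \<open>The Eisenstein series has level one, so slashing by any \<open>A\<close>
        leaves it unchanged and only \<open>f\<close> and \<open>g\<close> require bounds at the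
        cusp of \<open>A\<close>.\<close>
      have "cmod (slash k2 h A z) \<le> B0 ^ r * B1 + B2" if "Im z \<ge> 1" for z
      proof -
        have z: "z \<in> upper_half_plane" using that by (simp add: upper_half_plane_iff)
        have "automorphy_factor A z \<noteq> 0" by (rule automorphy_factor_nonzero[OF A z])
        moreover have "eis w (mobius A z) = automorphy_factor A z ^ w * eis w z" using E A z by blast
        ultimately have "slash k2 h A z = eis w z ^ r * slash k1 f A z - slash k2 g A z"
          unfolding slash_def h_def k2 w_def[symmetric]
          by (simp add: power_mult_distrib power_add power_mult diff_divide_distrib)
        also have "cmod \<dots> \<le> cmod (eis w z) ^ r * cmod (slash k1 f A z) + cmod (slash k2 g A z)"
          by (rule order_trans[OF norm_triangle_ineq4]) (simp add: norm_mult norm_power)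
        also have "\<dots> \<le> B0 ^ r * B1 + B2"
          using order_trans[OF norm_ge_zero B0[OF that]]
          by (intro add_mono mult_mono power_mono B0 B1 B2 that) auto
        finally show ?thesis .
      qed
      then show ?thesis by blast
    qed
    show "fps_nth H n \<in> V" for n
      unfolding H_nth using FV by (intro VD(3) M_V[OF EM] V_diff) (auto simp: integral_fps_def)
    show "fps_nth H n \<in> M" if "real n \<le> real k2 / 12 * real (group_index SL2Z (Gamma0 N))" for n
      unfolding H_nth using that by (intro M_add EM small) simp
  qed
  \<comment> \<open>The congruence descends from \<open>M\<close> to \<open>P\<close> because the
    difference of the coefficients lies in \<open>R\<close>.\<close>
  have "fps_nth F n - fps_nth G n \<in> P" for n
  proof -
    have "fps_nth F n - fps_nth G n = fps_nth H n - fps_nth (eis_fps w ^ r * F - F) n" by (simp add: H_def)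
    then have "fps_nth F n - fps_nth G n \<in> M" by (simp only: M_diff[OF HM EM])
    moreover have "fps_nth F n + - fps_nth G n \<in> R" using coeffs by (intro subring_setD[OF R(1)])
    ultimately show ?thesis using V(3) by auto
  qed
  then show False using assms(16) by (simp add: form_cong_def cong_ideal_def FG)
qed

end
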